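(* Let $1\le p,q<\infty$ and $1\le p_i,q_i<\infty$ for $i=1,\dots,m$ with $\sum_{i=1}^m\frac1{p_i}=\frac1p$ and $\sum_{i=1}^m\frac1{q_i}=\frac1q$. Let $1\le q^*,\xi<\infty$, and $\alpha_i<0$, $\lambda_i\ge0$ for all $i=1,\dots,m$. Let $\omega\in A_\xi(\mathbb{R}^n)$ have finite reverse Hölder critical index $r_\omega$. Assume $q>q^*\xi r'_\omega$, $\delta\in(1,r_\omega)$, and that $\alpha^*,\lambda^*$ are two real numbers satisfying $$\lambda^*=\lambda_1+\cdots+\lambda_m\quad\text{and}\quad\frac{\alpha^*}{n}+\frac1{q^*}=\frac{\sum_{i=1}^m\alpha_i}{n}+\frac1q .$$ Suppose that either (a) $\frac{\alpha_i}{n}+\frac1{q_i}\le0$ for all $i=1,\dots,m$ and $$\mathcal{C}_{6.1}=\prod_{i=1}^m\Big(\int_{\mathbb{R}^n}\frac{|\Phi(y)|}{|y|^n}|\det A_i^{-1}(y)|^{\frac{m\xi}{q_i}}\|A_i(y)\|^{\frac{m\xi n}{q_i}}\Psi_{1i}(y)\,dy\Big)^{\frac1m}<\infty,$$ where $$\begin{aligned}\Psi_{1i}(y)=&\ \|A_i(y)\|^{m\left(\lambda_i-n\left(\frac{\alpha_i}{n}+\frac1{q_i}\right)\right)\left(\frac{\delta-1}{\delta}\right)}\chi_{\{y\in\mathbb{R}^n:\|A_i(y)\|<1\}}\\&+\|A_i(y)\|^{m\xi\left(\lambda_i-n\left(\frac{\alpha_i}{n}+\frac1{q_i}\right)\right)}\chi_{\{y\in\mathbb{R}^n:\|A_i(y)\|\ge1\}},\end{aligned}$$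 or (b) $\frac{\alpha_i}{n}+\frac1{q_i}>0$ for all $i=1,\dots,m$ and $$\mathcal{C}_{6.2}=\prod_{i=1}^m\Big(\int_{\mathbb{R}^n}\frac{|\Phi(y)|}{|y|^n}|\det A_i^{-1}(y)|^{\frac{m\xi}{q_i}}\|A_i(y)\|^{\frac{m\xi n}{q_i}}\Psi_{2i}(y)\,dy\Big)^{\frac1m}<\infty,$$ where $$\begin{aligned}\Psi_{2i}(y)=&\ \|A_i(y)\|^{m\left(\lambda_i\left(\frac{\delta-1}{\delta}\right)-n\xi\left(\frac{\alpha_i}{n}+\frac1{q_i}\right)\right)}\chi_{\{y\in\mathbb{R}^n:\|A_i(y)\|<1\}}\\&+\|A_i(y)\|^{m\left(\lambda_i\xi-n\left(\frac{\alpha_i}{n}+\frac1{q_i}\right)\left(\frac{\delta-1}{\delta}\right)\right)}\chi_{\{y\in\mathbb{R}^n:\|A_i(y)\|\ge1\}}.\end{aligned}$$ Then $\mathcal{H}_{\Phi,\vec{A}}$ is bounded from $\prod_{i=1}^m M\dot{K}^{\alpha_i,\lambda_i}_{p_i,q_i}(\omega,\mathbb{R}^n)$ to $M\dot{K}^{\alpha^*,\lambda^*}_{p,q^*}(\omega,\mathbb{R}^n)$.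
   Context: $n,m\ge 1$ are integers. $\Phi$ is a locally integrable function on $\mathbb{R}^n$; $A_1,\dots,A_m$ are measurable functions on $\mathbb{R}^n$ with values in the $n\times n$ real matrices, with $\det A_i(y)\ne0$ for almost every $y$ in the support of $\Phi$ (integrands are read as $0$ where $\Phi(y)=0$). For a matrix $A=(a_{ij})$, $\|A\|=\big(\sum_{i,j=1}^n|a_{ij}|^2\big)^{1/2}$; $A_i^{-1}(y)$ is the inverse of $A_i(y)$; $\chi_E$ is the characteristic function of $E$. The multilinear Hausdorff operator is, for $\vec f=(f_1,\dots,f_m)$ with $f_i$ complex-valued measurable functions on $\mathbb{R}^n$, $$\mathcal{H}_{\Phi,\vec{A}}(\vec{f})(x)=\int_{\mathbb{R}^n}\frac{\Phi(y)}{|y|^n}\prod_{i=1}^m f_i(A_i(y)x)\,dy,\qquad x\in\mathbb{R}^n.$$ A weight is a nonnegative locally integrable function on $\mathbb{R}^n$; $\omega(E)=\int_E\omega(x)\,dx$. Muckenhoupt classes: for $1<\xi<\infty$, $\omega\in A_\xi(\mathbb{R}^n)$ if there is $C>0$ with $\big(\frac1{|B|}\int_B\omega\,dx\big)\big(\frac1{|B|}\int_B\omega^{-\frac1{\xi-1}}dx\big)^{\xi-1}\le C$ for all balls $B$; $\omega\in A_1(\mathbb{R}^n)$ if there is $C>0$ with $\frac1{|B|}\int_B\omega\,dx\le C\operatorname{ess\,inf}_{x\in B}\omega(x)$ for all balls $B$. Reverse Hölder: for $r>1$, $\omega\in RH_r$ if there is $C$ with $\big(\frac1{|B|}\int_B\omega^r\,dx\big)^{1/r}\le\frac{C}{|B|}\int_B\omega\,dx$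 for all balls $B$; the critical index is $r_\omega=\sup\{r>1:\omega\in RH_r\}$. $r'_\omega$ is the conjugate exponent: $\frac1{r_\omega}+\frac1{r'_\omega}=1$. For $k\in\mathbb{Z}$ let $B_k=\{x\in\mathbb{R}^n:|x|\le 2^k\}$, $C_k=B_k\setminus B_{k-1}$, $\chi_k=\chi_{C_k}$, and $\|f\|_{L^q_\omega(\mathbb{R}^n)}=\big(\int_{\mathbb{R}^n}|f|^q\omega\,dx\big)^{1/q}$. Weighted Morrey-Herz space: for a weight $\omega$, $\alpha\in\mathbb{R}$, $0<p<\infty$, $1\le q<\infty$, $\lambda\ge0$, $M\dot{K}^{\alpha,\lambda}_{p,q}(\omega,\mathbb{R}^n)$ is the set of measurable $f$ with $\int_K|f|^q\omega\,dx<\infty$ for all compact $K\subset\mathbb{R}^n\setminus\{0\}$ and $$\|f\|_{M\dot{K}^{\alpha,\lambda}_{p,q}(\omega,\mathbb{R}^n)}=\sup_{k_0\in\mathbb{Z}}\Big(\omega(B_{k_0})^{-\frac{\lambda}{n}}\Big(\sum_{k=-\infty}^{k_0}\omega(B_k)^{\frac{\alpha p}{n}}\|f\chi_k\|^p_{L^q_\omega(\mathbb{R}^n)}\Big)^{1/p}\Big)<\infty .$$ Boundedness of an $m$-linear operator $T$ from $\prod X_i$ to $Y$ means that there is a constant $C$ with $\|T(\vec f)\|_Y\le C\prod_i\|f_i\|_{X_i}$ for all $f_i\in X_i$, $T(\vec f)$ being well defined almost everywhere. *)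

theory Defs
  imports "HOL-Analysis.Analysis"
begin

text \<open>
  The Euclidean space is \<^typ>\<open>real^'n\<close> (so the dimension is \<open>CARD('n)\<close>), and measurability and
  integrals refer to the complete Lebesgue measure. Weights and averages, as well as (quasi-)norms,
  are evaluated in \<^typ>\<open>ennreal\<close>, so that no value depends on a convention for divergent integrals.
\<close>

text \<open>The real power on the extended half-line: negative powers of \<open>0\<close> are \<open>\<infinity>\<close> and negative
  powers of \<open>\<infinity>\<close> are \<open>0\<close>. (On \<^typ>\<open>real\<close>, \<open>0 powr a = 0\<close> even for \<open>a < 0\<close>.)\<close>

definition epowr :: "ennreal \<Rightarrow> real \<Rightarrow> ennreal"  (infixr \<open>epowr\<close> 80) where
  "x epowr a =
    (if a = 0 then 1
     else if x = 0 then (if a < 0 then \<infinity> else 0)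
     else if x = \<infinity> then (if a < 0 then 0 else \<infinity>)
     else ennreal (enn2real x powr a))"

definition locally_integrable ::
    "('a::euclidean_space \<Rightarrow> 'b::{banach, second_countable_topology}) \<Rightarrow> bool" where
  "locally_integrable f \<longleftrightarrow> (\<forall>K. compact K \<longrightarrow> set_integrable lebesgue K f)"

definition weight :: "(real^'n \<Rightarrow> real) \<Rightarrow> bool" where
  "weight \<omega> \<longleftrightarrow> (\<forall>x. 0 \<le> \<omega> x) \<and> locally_integrable \<omega>"

definition wmeas :: "(real^'n \<Rightarrow> real) \<Rightarrow> (real^'n) set \<Rightarrow> ennreal" where
  "wmeas \<omega> E = (\<integral>\<^sup>+x\<in>E. ennreal (\<omega> x) \<partial>lebesgue)"

definition average :: "(real^'n) set \<Rightarrow> (real^'n \<Rightarrow> ennreal) \<Rightarrow> ennreal" where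
  "average B f = (\<integral>\<^sup>+x\<in>B. f x \<partial>lebesgue) / emeasure lebesgue B"

definition ess_inf :: "(real^'n) set \<Rightarrow> (real^'n \<Rightarrow> ennreal) \<Rightarrow> ennreal" where
  "ess_inf B f = Sup {c. AE x\<in>B in lebesgue. c \<le> f x}"

text \<open>The classes \<open>A\<^sub>\<xi>\<close>, for \<open>\<xi> \<ge> 1\<close>.\<close>

definition muckenhoupt :: "real \<Rightarrow> (real^'n \<Rightarrow> real) set" where
  "muckenhoupt \<xi> = {\<omega>. weight \<omega> \<and>
    (\<exists>C::real. 0 < C \<and> (\<forall>z r. 0 < r \<longrightarrow>
      (if \<xi> = 1
       then average (ball z r) (\<lambda>x. ennreal (\<omega> x))
              \<le> ennreal C * ess_inf (ball z r) (\<lambda>x. ennreal (\<omega> x))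
       else average (ball z r) (\<lambda>x. ennreal (\<omega> x)) *
            average (ball z r) (\<lambda>x. ennreal (\<omega> x) epowr (- 1 / (\<xi> - 1))) epowr (\<xi> - 1)
              \<le> ennreal C)))}"

definition reverse_hoelder :: "real \<Rightarrow> (real^'n \<Rightarrow> real) set" where
  "reverse_hoelder r = {\<omega>. weight \<omega> \<and>
    (\<exists>C::real. 0 < C \<and> (\<forall>z s. 0 < s \<longrightarrow>
      average (ball z s) (\<lambda>x. ennreal (\<omega> x) epowr r) epowr (1 / r)
        \<le> ennreal C * average (ball z s) (\<lambda>x. ennreal (\<omega> x))))}"

definition rh_index :: "(real^'n \<Rightarrow> real) \<Rightarrow> ereal" where
  "rh_index \<omega> = Sup {ereal r |r. 1 < r \<and> \<omega> \<in> reverse_hoelder r}"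

definition dyadic_ball :: "int \<Rightarrow> (real^'n) set" where
  "dyadic_ball k = cball 0 (2 powi k)"

definition dyadic_shell :: "int \<Rightarrow> (real^'n) set" where
  "dyadic_shell k = dyadic_ball k - dyadic_ball (k - 1)"

definition wLq_norm :: "(real^'n \<Rightarrow> real) \<Rightarrow> real \<Rightarrow> (real^'n \<Rightarrow> complex) \<Rightarrow> ennreal" where
  "wLq_norm \<omega> q f = (\<integral>\<^sup>+x. ennreal (norm (f x) powr q * \<omega> x) \<partial>lebesgue) epowr (1 / q)"

text \<open>The arguments of the Morrey-Herz norm and space are, in order, the weight,
  \<open>\<alpha>\<close>, \<open>\<lambda>\<close>, \<open>p\<close> and \<open>q\<close>.\<close>

definition morrey_herz_norm ::
    "(real^'n \<Rightarrow> real) \<Rightarrow> real \<Rightarrow> real \<Rightarrow> real \<Rightarrow> real \<Rightarrow> (real^'n \<Rightarrow> complex) \<Rightarrow> ennreal" where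
  "morrey_herz_norm \<omega> \<alpha> l p q f =
    (SUP k0::int.
      wmeas \<omega> (dyadic_ball k0) epowr (- l / real CARD('n)) *
      (\<Sum>\<^sub>\<infinity>k\<in>{..k0}.
         wmeas \<omega> (dyadic_ball k) epowr (\<alpha> * p / real CARD('n)) *
         wLq_norm \<omega> q (\<lambda>x. indicator (dyadic_shell k) x * f x) epowr p) epowr (1 / p))"

definition morrey_herz ::
    "(real^'n \<Rightarrow> real) \<Rightarrow> real \<Rightarrow> real \<Rightarrow> real \<Rightarrow> real \<Rightarrow> (real^'n \<Rightarrow> complex) set" where
  "morrey_herz \<omega> \<alpha> l p q =
    {f \<in> borel_measurable lebesgue.
      (\<forall>K. compact K \<and> K \<subseteq> UNIV - {0} \<longrightarrow>
         (\<integral>\<^sup>+x\<in>K. ennreal (norm (f x) powr q * \<omega> x) \<partial>lebesgue) < \<infinity>) \<and>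
      morrey_herz_norm \<omega> \<alpha> l p q f < \<infinity>}"

definition hausdorff_integrand ::
    "nat \<Rightarrow> (real^'n \<Rightarrow> complex) \<Rightarrow> (nat \<Rightarrow> real^'n \<Rightarrow> real^'n^'n) \<Rightarrow>
     (nat \<Rightarrow> real^'n \<Rightarrow> complex) \<Rightarrow> real^'n \<Rightarrow> real^'n \<Rightarrow> complex" where
  "hausdorff_integrand m \<Phi> A f x y =
    \<Phi> y / complex_of_real (norm y ^ CARD('n)) * (\<Prod>i=1..m. f i (A i y *v x))"

definition hausdorff_op ::
    "nat \<Rightarrow> (real^'n \<Rightarrow> complex) \<Rightarrow> (nat \<Rightarrow> real^'n \<Rightarrow> real^'n^'n) \<Rightarrow>
     (nat \<Rightarrow> real^'n \<Rightarrow> complex) \<Rightarrow> real^'n \<Rightarrow> complex" where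
  "hausdorff_op m \<Phi> A f x = (\<integral>y. hausdorff_integrand m \<Phi> A f x y \<partial>lebesgue)"

text \<open>The library norm on matrices is the one required, \<open>\<parallel>A\<parallel> = (\<Sum>|a\<^sub>i\<^sub>j|\<^sup>2)\<^sup>1\<^sup>/\<^sup>2\<close>.\<close>

lemma norm_matrix_eq:
  fixes A :: "real^'n^'n"
  shows "norm A = sqrt (\<Sum>i\<in>UNIV. \<Sum>j\<in>UNIV. \<bar>A $ i $ j\<bar>\<^sup>2)"
  by (simp add: norm_vec_def L2_set_def sum_nonneg)

definition Psi1 ::
    "nat \<Rightarrow> real \<Rightarrow> real \<Rightarrow> real \<Rightarrow> real \<Rightarrow> real \<Rightarrow> (real^'n \<Rightarrow> real^'n^'n) \<Rightarrow> real^'n \<Rightarrow> real" where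
  "Psi1 m \<xi> \<delta> \<alpha> l q A y =
    (let n = real CARD('n) in
      norm (A y) powr (real m * (l - n * (\<alpha> / n + 1 / q)) * ((\<delta> - 1) / \<delta>))
        * indicator {y. norm (A y) < 1} y
      + norm (A y) powr (real m * \<xi> * (l - n * (\<alpha> / n + 1 / q)))
        * indicator {y. 1 \<le> norm (A y)} y)"

definition Psi2 ::
    "nat \<Rightarrow> real \<Rightarrow> real \<Rightarrow> real \<Rightarrow> real \<Rightarrow> real \<Rightarrow> (real^'n \<Rightarrow> real^'n^'n) \<Rightarrow> real^'n \<Rightarrow> real" where
  "Psi2 m \<xi> \<delta> \<alpha> l q A y =
    (let n = real CARD('n) in
      norm (A y) powr (real m * (l * ((\<delta> - 1) / \<delta>) - n * \<xi> * (\<alpha> / n + 1 / q)))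
        * indicator {y. norm (A y) < 1} y
      + norm (A y) powr (real m * (l * \<xi> - n * (\<alpha> / n + 1 / q) * ((\<delta> - 1) / \<delta>)))
        * indicator {y. 1 \<le> norm (A y)} y)"

text \<open>The common shape of the constants \<open>\<C>\<^sub>6\<^sub>.\<^sub>1\<close> and \<open>\<C>\<^sub>6\<^sub>.\<^sub>2\<close>, which are obtained for
  \<open>\<Psi> i\<close> given by \<^const>\<open>Psi1\<close> and \<^const>\<open>Psi2\<close>. The inverse matrix is only relevant where
  \<open>\<Phi> y \<noteq> 0\<close>, and there it exists almost everywhere.\<close>

definition hausdorff_const ::
    "nat \<Rightarrow> (real^'n \<Rightarrow> complex) \<Rightarrow> (nat \<Rightarrow> real^'n \<Rightarrow> real^'n^'n) \<Rightarrow> real \<Rightarrow> (nat \<Rightarrow> real) \<Rightarrow>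
     (nat \<Rightarrow> real^'n \<Rightarrow> real) \<Rightarrow> ennreal" where
  "hausdorff_const m \<Phi> A \<xi> qs \<Psi> =
    (\<Prod>i=1..m.
      (\<integral>\<^sup>+y. ennreal
         (norm (\<Phi> y) / norm y ^ CARD('n)
          * \<bar>det (matrix_inv (A i y))\<bar> powr (real m * \<xi> / qs i)
          * norm (A i y) powr (real m * \<xi> * real CARD('n) / qs i)
          * \<Psi> i y) \<partial>lebesgue) epowr (1 / real m))"

end

theory Submission
  imports Defs
begin

text \<open>
  Minkowski's integral inequality, applied first to the \<open>L\<^sup>q\<close> norm on a dyadic shell and then to the
  \<open>\<ell>\<^sup>p\<close> norm over the shells, reduces the bound to a single \<open>y\<close>, that is, to the dilation operator
  \<open>(g\<^sub>i) \<mapsto> \<Prod>\<^sub>i g\<^sub>i(B\<^sub>i x)\<close> with fixed nonsingular matrices \<open>B\<^sub>i\<close>. On a shell the reverse Hoelder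
  inequality trades \<open>L\<^sup>q\<^sup>*\<close> with weight for unweighted \<open>L\<^sup>q\<^sup>/\<^sup>\<xi>\<close>, where a linear change of variables is
  possible, and \<open>A\<^sub>\<xi>\<close> trades the unweighted \<open>L\<^sup>Q\<^sup>/\<^sup>\<xi>\<close> norm back for the weighted \<open>L\<^sup>Q\<close> norm, on the
  ball of radius \<open>2\<^sup>k\<^sup>+\<^sup>\<kappa>\<close> with \<open>2\<^sup>\<kappa> \<approx> \<parallel>B\<parallel>\<close>. The same two inequalities compare the weights
  of concentric balls by powers of the ratio of the radii, which produces the powers of \<open>\<parallel>B\<parallel>\<close> in \<open>\<Psi>\<close>.
  Hoelder's inequality in \<open>y\<close> with \<open>m\<close> equal exponents ends the proof.
\<close>

section \<open>Powers and integral inequalities on the extended half-line\<close>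

text \<open>Measurability shapes the last steps. The \<open>f i\<close> are only Lebesgue
  measurable, so \<open>f i (A i y *v x)\<close> need not be jointly measurable, and neither Fubini
  nor Minkowski applies to it. Each \<open>f i\<close> is replaced by a Borel function
  \<open>g i\<close> that agrees with it off a Borel null set; since almost every relevant
  \<open>A i y\<close> is nonsingular, for almost every x this changes the integrand only on a null
  set of y. The assumption q > qstar \<xi> r' enters through the reverse Hoelder step, which
  requires qstar \<xi> / q \<le> 1 - 1/s. Its strictness leaves room for an admissible s, and s can
  be taken above \<delta> at the same time, so that (\<delta> - 1)/\<delta> \<le> 1 - 1/s as well.
  One s thus serves the shell estimate and the comparison of balls. Finiteness of the critical index
  excludes the zero weight. Every ball then has positive mass, and negative powers of masses are
  harmless. All constants are uniform in y, and all estimates are between extended nonnegative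
  quantities; absolute convergence of the operator is a consequence of the norm bound.\<close>

lemma ennreal_cases_pos:
  obtains "(x::ennreal) = 0" | "x = top" | r where "0 < r" "x = ennreal r"
proof (cases x)
  case (real r)
  then show ?thesis using that by (cases "r = 0") auto
qed (use that in auto)

lemma epowr_zero_right [simp]: "x epowr 0 = 1"
  by (simp add: epowr_def)

lemma epowr_one [simp]: "x epowr 1 = x"
  by (cases x) (auto simp: epowr_def)

lemma ennreal_epowr: "0 < r \<Longrightarrow> ennreal r epowr a = ennreal (r powr a)"
  by (auto simp: epowr_def)

lemma ennreal_epowr_nonneg: "0 \<le> r \<Longrightarrow> 0 < a \<Longrightarrow> ennreal r epowr a = ennreal (r powr a)"
  by (cases "r = 0") (auto simp: epowr_def)

lemma one_epowr [simp]: "1 epowr a = 1"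
  using ennreal_epowr[of 1 a] by simp

lemma zero_epowr: "0 epowr a = (if a = 0 then 1 else if a < 0 then \<infinity> else 0)"
  by (simp add: epowr_def)

lemma top_epowr: "top epowr a = (if a = 0 then 1 else if a < 0 then 0 else top)"
  by (simp add: epowr_def)

text \<open>Valid for all signs of a and b because a negative power exchanges 0 and \<infinity>, so
  that two of them undo the exchange.\<close>

lemma epowr_epowr: "(x epowr a) epowr b = x epowr (a * b)"
  by (cases x rule: ennreal_cases_pos)
    (auto simp: zero_epowr top_epowr ennreal_epowr powr_powr mult_less_0_iff)

text \<open>The sign matters: for a < 0, x = 0 and y = \<infinity> the product is 0 and its power
  \<infinity>, while the right side is \<infinity> * 0 = 0.\<close>

lemma epowr_mult:
  assumes "0 \<le> a"
  shows "(x * y) epowr a = x epowr a * y epowr a"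
proof (cases "a = 0")
  case False
  then show ?thesis using assms
    by (cases x rule: ennreal_cases_pos; cases y rule: ennreal_cases_pos)
      (auto simp: zero_epowr top_epowr ennreal_epowr powr_mult
        ennreal_top_mult ennreal_mult_top simp flip: ennreal_mult)
qed auto

lemma epowr_prod:
  assumes "0 \<le> a"
  shows "(\<Prod>i\<in>I. f i) epowr a = (\<Prod>i\<in>I. f i epowr a)"
  by (induction I rule: infinite_finite_induct) (auto simp: epowr_mult assms)

text \<open>Opposite signs fail at the end points: 0 to the power 1 - 1 is 1, but 0 * \<infinity> =
  0. Hence the side condition.\<close>

lemma epowr_add:
  assumes "0 < x \<and> x < \<infinity> \<or> 0 \<le> a \<and> 0 \<le> b"
  shows "x epowr (a + b) = x epowr a * x epowr b"
  using assms
  by (cases x rule: ennreal_cases_pos)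
    (auto simp: zero_epowr top_epowr ennreal_epowr powr_add
      ennreal_top_mult ennreal_mult_top simp flip: ennreal_mult)

lemma epowr_mono:
  assumes "0 \<le> a" "x \<le> y"
  shows "x epowr a \<le> y epowr a"
  using assms
  by (cases x rule: ennreal_cases_pos; cases y rule: ennreal_cases_pos)
    (auto simp: zero_epowr top_epowr ennreal_epowr powr_mono2 top_unique)

lemma epowr_eq_0_iff: "0 < a \<Longrightarrow> x epowr a = 0 \<longleftrightarrow> x = 0"
  by (cases x rule: ennreal_cases_pos) (auto simp: zero_epowr top_epowr ennreal_epowr)

lemma epowr_eq_top_iff: "0 < a \<Longrightarrow> x epowr a = \<infinity> \<longleftrightarrow> x = \<infinity>"
  by (cases x rule: ennreal_cases_pos) (auto simp: zero_epowr top_epowr ennreal_epowr)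

lemma epowr_less_top_iff: "0 < a \<Longrightarrow> x epowr a < top \<longleftrightarrow> x < top"
  using epowr_eq_top_iff[of a x] by (simp flip: less_top)

lemma epowr_power: "0 \<le> a \<Longrightarrow> (x epowr a) ^ m = x epowr (real m * a)"
  by (induction m) (simp_all add: epowr_add ring_distribs)

lemma borel_measurable_epowr [measurable (raw)]:
  assumes [measurable]: "f \<in> borel_measurable M"
  shows "(\<lambda>x. f x epowr a) \<in> borel_measurable M"
  unfolding epowr_def by measurable

section \<open>Arithmetic-geometric mean and Hoelder's inequality for finitely many factors\<close>

lemma weighted_arith_geom_mean:
  fixes x :: "'a \<Rightarrow> real"
  assumes I: "finite I" and a: "\<And>i. i \<in> I \<Longrightarrow> 0 < a i" "sum a I = 1"
    and x: "\<And>i. i \<in> I \<Longrightarrow> 0 \<le> x i"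
  shows "(\<Prod>i\<in>I. x i powr a i) \<le> (\<Sum>i\<in>I. a i * x i)"
\<comment> \<open>Jensen's inequality for \<open>ln\<close> requires positive values; a zero factor
  makes the geometric mean vanish.\<close>
proof (cases "\<exists>i\<in>I. x i = 0")
  case True
  then have "(\<Prod>i\<in>I. x i powr a i) = 0"
    using I by auto
  then show ?thesis
    using a(1) x by (simp add: sum_nonneg less_imp_le)
next
  case False
  with x have x: "0 < x i" if "i \<in> I" for i
    using that x[OF that] by force
  have ne: "I \<noteq> {}" using a by auto
  have "(\<Sum>i\<in>I. a i * ln (x i)) \<le> ln (\<Sum>i\<in>I. a i *\<^sub>R x i)"
    by (intro concave_on_sum[where C="{0<..}"]) (use I a x ne in \<open>auto simp: ln_concave less_imp_le\<close>)
  moreover have pos: "0 < (\<Sum>i\<in>I. a i * x i)"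
    using I ne a x by (intro sum_pos) auto
  ultimately have "exp (\<Sum>i\<in>I. a i * ln (x i)) \<le> (\<Sum>i\<in>I. a i * x i)"
    by (simp add: ln_ge_iff)
  also have "exp (\<Sum>i\<in>I. a i * ln (x i)) = (\<Prod>i\<in>I. x i powr a i)"
    unfolding exp_sum[OF I] by (rule prod.cong) (use x in \<open>force simp: powr_def\<close>)+
  finally show ?thesis .
qed

lemma weighted_arith_geom_mean_ennreal:
  assumes I: "finite I" and a: "\<And>i. i \<in> I \<Longrightarrow> 0 < a i" "sum a I = 1"
    and x: "\<And>i. i \<in> I \<Longrightarrow> x i < \<infinity>"
  shows "(\<Prod>i\<in>I. x i epowr a i) \<le> (\<Sum>i\<in>I. ennreal (a i) * x i)"
proof -
  have *: "x i = ennreal (enn2real (x i))" if "i \<in> I" for i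
    using x[OF that] by (simp add: less_top)
  have "(\<Prod>i\<in>I. x i epowr a i) = (\<Prod>i\<in>I. ennreal (enn2real (x i) powr a i))"
    by (intro prod.cong refl) (metis * a(1) enn2real_nonneg ennreal_epowr_nonneg)
  also have "\<dots> = ennreal (\<Prod>i\<in>I. enn2real (x i) powr a i)"
    by (simp add: prod_ennreal)
  also have "\<dots> \<le> ennreal (\<Sum>i\<in>I. a i * enn2real (x i))"
    by (intro ennreal_leI weighted_arith_geom_mean) (use I a in auto)
  also have "\<dots> = (\<Sum>i\<in>I. ennreal (a i * enn2real (x i)))"
    by (rule sum_ennreal[symmetric]) (use a in \<open>auto simp: less_imp_le\<close>)
  also have "\<dots> = (\<Sum>i\<in>I. ennreal (a i) * x i)"
    by (rule sum.cong) (use a in \<open>simp_all add: ennreal_mult less_imp_le flip: *\<close>)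
  finally show ?thesis .
qed

text \<open>After division of each f i by its integral J i, the pointwise arithmetic-geometric mean
  inequality integrates to the sum of the a i, which is 1. The normalisation requires every J i to
  be positive and finite.\<close>

lemma nn_integral_Hoelder_pos:
  assumes I: "finite I" and a: "\<And>i. i \<in> I \<Longrightarrow> 0 < a i" "sum a I = 1"
    and f[measurable]: "\<And>i. i \<in> I \<Longrightarrow> f i \<in> borel_measurable M"
  shows "(\<integral>\<^sup>+x. (\<Prod>i\<in>I. f i x epowr a i) \<partial>M) \<le> (\<Prod>i\<in>I. (\<integral>\<^sup>+x. f i x \<partial>M) epowr a i)"
proof -
  define J where "J i = (\<integral>\<^sup>+x. f i x \<partial>M)" for i
  \<comment> \<open>If some J i is 0, the left side vanishes whatever the other integrals are. In
    the second case no factor on the right is 0, so their product is infinite.\<close>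
  consider (zero) i where "i \<in> I" "J i = 0"
    | (top) i where "i \<in> I" "J i = top" "\<forall>j\<in>I. J j \<noteq> 0"
    | (fin) "\<And>i. i \<in> I \<Longrightarrow> J i \<noteq> 0 \<and> J i \<noteq> top"
    by blast
  then show ?thesis
  proof cases
    case zero
    have "AE x in M. f i x = 0"
      using zero by (subst (asm) J_def, subst (asm) nn_integral_0_iff_AE) auto
    then have "AE x in M. (\<Prod>i\<in>I. f i x epowr a i) = 0"
      by eventually_elim (use zero I a(1)[of i] in \<open>auto intro!: prod_zero bexI[of _ i] simp: zero_epowr\<close>)
    then have "(\<integral>\<^sup>+x. (\<Prod>i\<in>I. f i x epowr a i) \<partial>M) = 0"
      by (subst nn_integral_cong_AE[where v="\<lambda>_. 0"]) auto
    then show ?thesis by simp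
  next
    case top
    have "\<forall>j\<in>I. J j epowr a j \<noteq> 0"
      using top a by (simp add: epowr_eq_0_iff)
    moreover have "J i epowr a i = top"
      using top a epowr_eq_top_iff[of "a i" "J i"] by simp
    ultimately have "(\<Prod>i\<in>I. J i epowr a i) = top"
      using top I by (auto simp: ennreal_prod_eq_top intro!: bexI[of _ i])
    then show ?thesis by (simp add: J_def)
  next
    case fin
    have "AE x in M. \<forall>i\<in>I. f i x \<noteq> top"
      using I fin nn_integral_PInf_AE[OF f]
      by (subst AE_ball_countable) (auto simp: countable_finite J_def)
    then have "AE x in M. (\<Prod>i\<in>I. f i x epowr a i)
        \<le> (\<Prod>i\<in>I. J i epowr a i) * (\<Sum>i\<in>I. ennreal (a i) * (f i x / J i))"
    proof eventually_elim
      case (elim x)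
      have "f i x epowr a i = J i epowr a i * (f i x / J i) epowr a i" if i: "i \<in> I" for i
      proof -
        have "f i x = J i * (f i x / J i)"
          using fin[OF i] by (simp add: ennreal_times_divide mult.commute[of "J i"] mult_divide_eq_ennreal)
        then show ?thesis using a i by (metis epowr_mult less_imp_le)
      qed
      then have "(\<Prod>i\<in>I. f i x epowr a i) = (\<Prod>i\<in>I. J i epowr a i) * (\<Prod>i\<in>I. (f i x / J i) epowr a i)"
        by (simp add: prod.distrib cong: prod.cong)
      also have "(\<Prod>i\<in>I. (f i x / J i) epowr a i) \<le> (\<Sum>i\<in>I. ennreal (a i) * (f i x / J i))"
        by (rule weighted_arith_geom_mean_ennreal)
          (use I a fin elim in \<open>auto simp: less_top[symmetric] ennreal_divide_eq_top_iff\<close>)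
      finally show ?case by (simp add: mult_left_mono)
    qed
    then have "(\<integral>\<^sup>+x. (\<Prod>i\<in>I. f i x epowr a i) \<partial>M)
       \<le> (\<integral>\<^sup>+x. (\<Prod>i\<in>I. J i epowr a i) * (\<Sum>i\<in>I. ennreal (a i) * (f i x / J i)) \<partial>M)"
      by (rule nn_integral_mono_AE)
    also have "\<dots> = (\<Prod>i\<in>I. J i epowr a i) * (\<Sum>i\<in>I. ennreal (a i) * (J i / J i))"
      by (simp add: nn_integral_cmult nn_integral_sum nn_integral_divide J_def)
    also have "(\<Sum>i\<in>I. ennreal (a i) * (J i / J i)) = (\<Sum>i\<in>I. ennreal (a i))"
      using fin by (intro sum.cong) (auto simp: ennreal_divide_self less_top[symmetric])
    also have "\<dots> = 1"
      using a by (subst sum_ennreal) (auto simp: less_imp_le)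
    finally show ?thesis by (simp add: J_def)
  qed
qed

text \<open>An exponent 0 gives the factor 1 on both sides, also at 0 and \<infinity>, so such
  indices drop out.\<close>

theorem nn_integral_Hoelder:
  assumes I: "finite I" and a: "\<And>i. i \<in> I \<Longrightarrow> 0 \<le> a i" "sum a I = 1"
    and f: "\<And>i. i \<in> I \<Longrightarrow> f i \<in> borel_measurable M"
  shows "(\<integral>\<^sup>+x. (\<Prod>i\<in>I. f i x epowr a i) \<partial>M) \<le> (\<Prod>i\<in>I. (\<integral>\<^sup>+x. f i x \<partial>M) epowr a i)"
proof -
  let ?I = "{i\<in>I. 0 < a i}"
  have nz: "a i = 0" if "i \<in> I" "\<not> 0 < a i" for i
    using a(1)[of i] that by simp
  have *: "(\<Prod>i\<in>I. h i epowr a i) = (\<Prod>i\<in>?I. h i epowr a i)" for h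
    by (rule prod.mono_neutral_right) (use I in \<open>auto simp: nz\<close>)
  have "sum a ?I = sum a I"
    by (rule sum.mono_neutral_left) (use I in \<open>auto simp: nz\<close>)
  then show ?thesis
    unfolding * by (intro nn_integral_Hoelder_pos) (use I a f in auto)
qed

corollary nn_integral_Hoelder2:
  assumes "0 \<le> a" "a \<le> 1" and [measurable]: "f \<in> borel_measurable M" "g \<in> borel_measurable M"
  shows "(\<integral>\<^sup>+x. f x epowr a * g x epowr (1 - a) \<partial>M)
           \<le> (\<integral>\<^sup>+x. f x \<partial>M) epowr a * (\<integral>\<^sup>+x. g x \<partial>M) epowr (1 - a)"
  using nn_integral_Hoelder[of "UNIV :: bool set" "\<lambda>b. if b then a else 1 - a"
      "\<lambda>b. if b then f else g" M] assms
  by (simp add: UNIV_bool mult.commute split: if_splits)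

text \<open>Let h y be the L^p norm of F in x and H the integral of h. Hoelder against the measure h
  dN bounds the p-th power of the y-integral of F by H^(p-1) times the y-integral of F^p h^(1-p).
  Integration in x and Fubini turn this into H^p. Nothing is divided by the left side of the claim,
  so it may be infinite a priori.\<close>

theorem nn_integral_Minkowski:
  assumes M: "sigma_finite_measure M" and N: "sigma_finite_measure N"
    and F [measurable]: "(\<lambda>(x, y). F x y) \<in> borel_measurable (M \<Otimes>\<^sub>M N)" and p: "1 \<le> p"
  shows "(\<integral>\<^sup>+x. (\<integral>\<^sup>+y. F x y \<partial>N) epowr p \<partial>M) epowr (1 / p)
           \<le> (\<integral>\<^sup>+y. (\<integral>\<^sup>+x. F x y epowr p \<partial>M) epowr (1 / p) \<partial>N)"
proof -
  interpret M: sigma_finite_measure M by fact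
  interpret N: sigma_finite_measure N by fact
  interpret pair_sigma_finite M N ..
  define h where "h y = (\<integral>\<^sup>+x. F x y epowr p \<partial>M) epowr (1 / p)" for y
  define H where "H = (\<integral>\<^sup>+y. h y \<partial>N)"
  have h [measurable]: "h \<in> borel_measurable N"
    unfolding h_def by measurable
  consider "p = 1" | "1 < p" "H = top" | "1 < p" "H \<noteq> top"
    using p by fastforce
  then show ?thesis
  proof cases
    case 1
    have "(\<integral>\<^sup>+x. \<integral>\<^sup>+y. F x y \<partial>N \<partial>M) = (\<integral>\<^sup>+y. \<integral>\<^sup>+x. F x y \<partial>M \<partial>N)"
      by (rule Fubini'[symmetric]) measurable
    with 1 show ?thesis by simp
  next
    case 2
    then show ?thesis by (simp add: H_def h_def)
  next
    case 3
    have fin: "AE y in N. h y \<noteq> top"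
      using 3 nn_integral_PInf_AE[OF h] by (simp add: H_def)
    \<comment> \<open>h^(1-p) is infinite where h vanishes; the Hoelder step survives because F
      vanishes there too, for almost every x.\<close>
    have "AE x in M. (h y = 0 \<longrightarrow> F x y = 0)" if y: "y \<in> space N" for y
    proof (cases "h y = 0")
      case True
      have [measurable]: "(\<lambda>x. F x y) \<in> borel_measurable M"
        using measurable_compose[OF measurable_Pair2'[OF y] F] by simp
      from True have "(\<integral>\<^sup>+x. F x y epowr p \<partial>M) = 0"
        using 3 by (simp add: h_def epowr_eq_0_iff)
      then have "AE x in M. F x y epowr p = 0"
        by (subst (asm) nn_integral_0_iff_AE) measurable
      then show ?thesis using 3 by (simp add: epowr_eq_0_iff)
    qed auto
    then have "AE x in M. AE y in N. h y = 0 \<longrightarrow> F x y = 0"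
      by (subst AE_commute) auto
    then have "AE x in M. (\<integral>\<^sup>+y. F x y \<partial>N) epowr p
        \<le> (\<integral>\<^sup>+y. F x y epowr p * h y epowr (1 - p) \<partial>N) * H epowr (p - 1)"
      using AE_space
    proof eventually_elim
      case (elim x)
      have [measurable]: "(\<lambda>y. F x y) \<in> borel_measurable N"
        using measurable_compose[OF measurable_Pair1'[OF elim(2)] F] by simp
      \<comment> \<open>This is the splitting of F to which Hoelder is applied. At b = 0 both sides
        are 0, by 0 * \<infinity> = 0.\<close>
      have eq: "a = (a epowr p * b epowr (1 - p)) epowr (1 / p) * b epowr (1 - 1 / p)"
        if "b = 0 \<longrightarrow> a = 0" "b \<noteq> top" for a b
      proof (cases "b = 0")
        case False
        have "(a epowr p * b epowr (1 - p)) epowr (1 / p) * b epowr (1 - 1 / p)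
            = a * (b epowr ((1 - p) / p) * b epowr (1 - 1 / p))"
          using 3 by (simp add: epowr_mult epowr_epowr mult.assoc)
        also have "b epowr ((1 - p) / p) * b epowr (1 - 1 / p) = b epowr ((1 - p) / p + (1 - 1 / p))"
          using False that by (intro epowr_add[symmetric]) (auto simp: less_top zero_less_iff_neq_zero)
        also have "(1 - p) / p + (1 - 1 / p) = 0"
          using 3 by (simp add: field_simps)
        finally show ?thesis by simp
      qed (use that 3 in \<open>auto simp: zero_epowr\<close>)
      have "(\<integral>\<^sup>+y. F x y \<partial>N)
          = (\<integral>\<^sup>+y. (F x y epowr p * h y epowr (1 - p)) epowr (1 / p) * h y epowr (1 - 1 / p) \<partial>N)"
        using elim(1) fin by (intro nn_integral_cong_AE; eventually_elim) (rule eq)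
      also have "\<dots> \<le> (\<integral>\<^sup>+y. F x y epowr p * h y epowr (1 - p) \<partial>N) epowr (1 / p) * H epowr (1 - 1 / p)"
        unfolding H_def by (rule nn_integral_Hoelder2) (use 3 in auto)
      finally have "(\<integral>\<^sup>+y. F x y \<partial>N) epowr p
        \<le> ((\<integral>\<^sup>+y. F x y epowr p * h y epowr (1 - p) \<partial>N) epowr (1 / p) * H epowr (1 - 1 / p)) epowr p"
        using 3 by (intro epowr_mono) auto
      also have "(1 - 1 / p) * p = p - 1"
        using 3 by (simp add: field_simps)
      then have "((\<integral>\<^sup>+y. F x y epowr p * h y epowr (1 - p) \<partial>N) epowr (1 / p) * H epowr (1 - 1 / p)) epowr p
          = (\<integral>\<^sup>+y. F x y epowr p * h y epowr (1 - p) \<partial>N) * H epowr (p - 1)"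
        using 3 by (simp add: epowr_mult epowr_epowr)
      finally show ?case .
    qed
    then have "(\<integral>\<^sup>+x. (\<integral>\<^sup>+y. F x y \<partial>N) epowr p \<partial>M)
        \<le> (\<integral>\<^sup>+x. (\<integral>\<^sup>+y. F x y epowr p * h y epowr (1 - p) \<partial>N) * H epowr (p - 1) \<partial>M)"
      by (rule nn_integral_mono_AE)
    also have "\<dots> = (\<integral>\<^sup>+x. \<integral>\<^sup>+y. F x y epowr p * h y epowr (1 - p) \<partial>N \<partial>M) * H epowr (p - 1)"
      by (rule nn_integral_multc) measurable
    also have "(\<integral>\<^sup>+x. \<integral>\<^sup>+y. F x y epowr p * h y epowr (1 - p) \<partial>N \<partial>M)
        = (\<integral>\<^sup>+y. \<integral>\<^sup>+x. F x y epowr p * h y epowr (1 - p) \<partial>M \<partial>N)"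
      by (rule Fubini'[symmetric]) measurable
    also have "\<dots> = (\<integral>\<^sup>+y. h y epowr p * h y epowr (1 - p) \<partial>N)"
    proof (rule nn_integral_cong)
      fix y assume y: "y \<in> space N"
      have [measurable]: "(\<lambda>x. F x y) \<in> borel_measurable M"
        using measurable_compose[OF measurable_Pair2'[OF y] F] by simp
      show "(\<integral>\<^sup>+x. F x y epowr p * h y epowr (1 - p) \<partial>M) = h y epowr p * h y epowr (1 - p)"
        using 3 by (simp add: nn_integral_multc h_def epowr_epowr)
    qed
    \<comment> \<open>Only an inequality: where h is infinite, h^p h^(1-p) is \<infinity> * 0 =
      0.\<close>
    also have "\<dots> \<le> H"
      unfolding H_def
    proof (rule nn_integral_mono)
      fix y show "h y epowr p * h y epowr (1 - p) \<le> h y"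
        using 3 epowr_add[of "h y" p "1 - p"]
        by (cases "h y" rule: ennreal_cases_pos) (auto simp: zero_epowr top_epowr)
    qed
    finally have "(\<integral>\<^sup>+x. (\<integral>\<^sup>+y. F x y \<partial>N) epowr p \<partial>M) \<le> H * H epowr (p - 1)"
      by (simp add: mult_right_mono)
    also have "\<dots> = H epowr p"
      using 3 epowr_add[of H 1 "p - 1"] by simp
    finally have "(\<integral>\<^sup>+x. (\<integral>\<^sup>+y. F x y \<partial>N) epowr p \<partial>M) epowr (1 / p) \<le> (H epowr p) epowr (1 / p)"
      using 3 by (intro epowr_mono) auto
    then show ?thesis
      using 3 by (simp add: epowr_epowr H_def h_def)
  qed
qed

text \<open>Turns the sums in the Morrey-Herz norm into integrals, so that Hoelder's and Minkowski's
  inequalities cover sequences as well.\<close>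

lemma infsum_eq_nn_integral_count_space:
  fixes f :: "'a \<Rightarrow> ennreal"
  assumes A: "countable A"
  shows "infsum f A = (\<integral>\<^sup>+x. f x \<partial>count_space A)"
proof (rule antisym)
  have *: "sum f F = (\<integral>\<^sup>+x. f x * indicator F x \<partial>count_space A)" if "finite F" "F \<subseteq> A" for F
    using that by (subst nn_integral_count_space'[of F])
      (auto simp: indicator_def intro!: sum.cong)
  show "infsum f A \<le> (\<integral>\<^sup>+x. f x \<partial>count_space A)"
    unfolding nonneg_infsum_complete[OF zero_le]
    by (rule SUP_least) (auto simp: * intro!: nn_integral_mono split: split_indicator)
  \<comment> \<open>An exhaustion of A by finite sets along an enumeration, for monotone
    convergence.\<close>
  define F where "F n = {x \<in> A. to_nat_on A x \<le> n}" for n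
  have F: "finite (F n)" "F n \<subseteq> A" for n
  proof -
    have "inj_on (to_nat_on A) (F n)"
      using A by (auto simp: F_def inj_on_def)
    moreover have "to_nat_on A ` F n \<subseteq> {..n}"
      by (auto simp: F_def)
    ultimately show "finite (F n)"
      using finite_surj finite_imageD by (metis finite_atMost finite_subset)
  qed (auto simp: F_def)
  have "(\<integral>\<^sup>+x. f x \<partial>count_space A) = (\<integral>\<^sup>+x. (SUP n. f x * indicator (F n) x) \<partial>count_space A)"
  proof (rule nn_integral_cong)
    fix x assume "x \<in> space (count_space A)"
    then show "f x = (SUP n. f x * indicator (F n) x)"
      by (intro antisym SUP_least SUP_upper2[of "to_nat_on A x"])
        (auto simp: F_def split: split_indicator)
  qed
  also have "\<dots> = (SUP n. \<integral>\<^sup>+x. f x * indicator (F n) x \<partial>count_space A)"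
    by (rule nn_integral_monotone_convergence_SUP)
      (auto simp: incseq_def le_fun_def F_def split: split_indicator)
  also have "\<dots> = (SUP n. sum f (F n))"
    using F by (simp add: *)
  also have "\<dots> \<le> infsum f A"
    unfolding nonneg_infsum_complete[OF zero_le] using F by (auto intro!: SUP_mono)
  finally show "(\<integral>\<^sup>+x. f x \<partial>count_space A) \<le> infsum f A" .
qed

section \<open>Lebesgue measure and linear maps\<close>

lemma borel_measurable_ident_lebesgue:
  "(\<lambda>x. x) \<in> borel_measurable (lebesgue :: 'a::euclidean_space measure)"
  by (rule measurable_completion) simp

lemma AE_lebesgue_neq_0: "AE x :: 'a::euclidean_space in lebesgue. x \<noteq> 0"
  by (rule AE_not_in[of "{0}", simplified]) (simp add: null_sets_def)

text \<open>Completeness of the measure: the preimages of a set under f and g differ by a null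
  set.\<close>

lemma borel_measurable_lebesgue_AE_cong:
  fixes f g :: "'a::euclidean_space \<Rightarrow> 'b::topological_space"
  assumes f: "f \<in> borel_measurable lebesgue" and eq: "AE x in lebesgue. f x = g x"
  shows "g \<in> borel_measurable lebesgue"
proof (rule measurableI)
  fix B :: "'b set" assume "B \<in> sets borel"
  then have A: "f -` B \<in> sets lebesgue"
    using measurable_sets[OF f] by simp
  have ae: "AE x in lebesgue. x \<in> f -` B \<longleftrightarrow> x \<in> g -` B"
    using eq by eventually_elim simp
  have "g -` B \<in> sets lebesgue"
    by (rule completion.in_sets_AE[OF ae A]) simp
  then show "g -` B \<inter> space lebesgue \<in> sets lebesgue"
    by simp
qed simp

text \<open>The exceptional set is itself Borel, so that its preimage under (x, y) \<mapsto> A y *v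
  x lies in the product sigma-algebra.\<close>

lemma ex_borel_modification:
  fixes f :: "'a::euclidean_space \<Rightarrow> complex"
  assumes "f \<in> borel_measurable lebesgue"
  obtains g N where "g \<in> borel_measurable borel" "N \<in> null_sets lborel" "\<And>x. x \<notin> N \<Longrightarrow> f x = g x"
proof -
  have "(\<lambda>x. Re (f x)) \<in> borel_measurable lebesgue" "(\<lambda>x. Im (f x)) \<in> borel_measurable lebesgue"
    using assms by measurable
  then obtain u v where uv [measurable]: "u \<in> borel_measurable lborel" "v \<in> borel_measurable lborel"
      and "AE x in lborel. Re (f x) = u x" "AE x in lborel. Im (f x) = v x"
    using completion_ex_borel_measurable_real by metis
  then have "AE x in lborel. f x = complex_of_real (u x) + \<i> * complex_of_real (v x)"
    by (auto simp: complex_eq_iff)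
  then obtain N where "N \<in> null_sets lborel"
      "{x \<in> space lborel. f x \<noteq> complex_of_real (u x) + \<i> * complex_of_real (v x)} \<subseteq> N"
    by (auto elim!: AE_E simp: null_sets_def)
  moreover have "(\<lambda>x. complex_of_real (u x) + \<i> * complex_of_real (v x)) \<in> borel_measurable borel"
    using uv by simp
  ultimately show ?thesis
    by (intro that[of "\<lambda>x. complex_of_real (u x) + \<i> * complex_of_real (v x)" N]) auto
qed

text \<open>The integral of a nonintegrable function is 0 by convention, which makes the bound
  trivial for it.\<close>

lemma norm_integral_le_nn_integral: "ennreal (norm (integral\<^sup>L M f)) \<le> (\<integral>\<^sup>+x. ennreal (norm (f x)) \<partial>M)"
proof (cases "integrable M f")
  case True
  then show ?thesis by (rule integral_norm_bound_ennreal)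
qed (simp add: not_integrable_integral_eq)

lemma sigma_finite_lebesgue: "sigma_finite_measure (lebesgue :: 'a::euclidean_space measure)"
proof
  obtain A :: "'a set set" where A: "countable A" "A \<subseteq> sets lborel" "\<Union>A = space lborel"
      "\<forall>a\<in>A. emeasure lborel a \<noteq> \<infinity>"
    using lborel.sigma_finite_countable by blast
  then show "\<exists>A::'a set set. countable A \<and> A \<subseteq> sets lebesgue \<and> \<Union> A = space lebesgue \<and>
      (\<forall>a\<in>A. emeasure lebesgue a \<noteq> \<infinity>)"
    by (intro exI[of _ A]) auto
qed

section \<open>Inverses, determinants and measurability of matrix-valued maps\<close>

lemma matrix_inv_mult:
  fixes A :: "'a::semiring_1^'n^'m"
  assumes "invertible A"
  shows "A ** matrix_inv A = mat 1" "matrix_inv A ** A = mat 1"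
  using someI_ex[OF assms[unfolded invertible_def]] by (simp_all add: matrix_inv_def)

lemma det_matrix_inv:
  fixes A :: "'a::field^'n^'n"
  assumes "invertible A"
  shows "det (matrix_inv A) = 1 / det A"
proof -
  have "det A * det (matrix_inv A) = 1"
    using matrix_inv_mult(1)[OF assms] by (metis det_I det_mul)
  then show ?thesis
    by (metis mult_zero_left nonzero_mult_div_cancel_left zero_neq_one)
qed

lemma det_zero_matrix: "det (0 :: real^'n^'n) = 0"
proof -
  have "row i (0 :: real^'n^'n) = 0" for i
    by (simp add: row_def vec_eq_iff)
  then show ?thesis
    using det_zero_row by blast
qed

lemma borel_measurable_matrix_vector_mult2 [measurable (raw)]:
  fixes A :: "'a \<Rightarrow> real^'n^'m"
  assumes "A \<in> borel_measurable M" "v \<in> borel_measurable M"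
  shows "(\<lambda>x. A x *v v x) \<in> borel_measurable M"
  using assms
  by (rule borel_measurable_continuous_Pair)
    (auto simp: matrix_vector_mult_def intro!: continuous_intros)

lemma borel_measurable_det [measurable (raw)]:
  fixes A :: "'a \<Rightarrow> real^'n^'n"
  assumes "A \<in> borel_measurable M"
  shows "(\<lambda>x. det (A x)) \<in> borel_measurable M"
proof (rule measurable_compose[OF assms])
  show "det \<in> borel_measurable (borel :: (real^'n^'n) measure)"
    unfolding det_def by (intro borel_measurable_continuous_onI continuous_intros)
qed

lemma borel_measurable_matrix_vector_mult [measurable]:
  fixes A :: "real^'n^'m"
  shows "(\<lambda>x. A *v x) \<in> borel_measurable borel"
  by (intro borel_measurable_continuous_onI linear_continuous_on) (simp add: matrix_vector_mul_bounded_linear)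

section \<open>Linear change of variables over an arbitrary finite index type\<close>

lemma Basis_cart: "(Basis :: (real^'n) set) = range (\<lambda>i. axis i 1)"
  by (auto simp: Basis_vec_def)

lemma inj_axis: "inj (\<lambda>i. axis i (1::real))"
  by (auto simp: inj_def axis_eq_axis)

lemma prod_Basis_cart: "(\<Prod>b\<in>Basis. h (b :: real^'n)) = (\<Prod>i\<in>UNIV. h (axis i 1))"
  unfolding Basis_cart prod.reindex[OF inj_axis] by simp

lemma sum_Basis_cart: "(\<Sum>b\<in>Basis. h (b :: real^'n)) = (\<Sum>i\<in>UNIV. h (axis i 1))"
  unfolding Basis_cart sum.reindex[OF inj_axis] by simp

text \<open>\<open>lborel_eqI\<close> asks for the measure of preimages, while the shear estimate
  for boxes measures images. Invariance is therefore shown for the inverse shear g, whose preimages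
  are images under f, and then transported by f.\<close>

lemma distr_lborel_shear:
  fixes m n :: "'n::finite"
  assumes mn: "m \<noteq> n"
  defines "f \<equiv> \<lambda>x::real^'n. \<chi> i. if i = m then x $ m + x $ n else x $ i"
  shows "distr lborel borel f = lborel"
proof -
  define g where "g = (\<lambda>x::real^'n. \<chi> i. if i = m then x $ m - x $ n else x $ i)"
  have lin: "linear f" "linear g"
    by (auto simp: f_def g_def linear_iff vec_eq_iff algebra_simps)
  have fg: "f (g x) = x" "g (f x) = x" for x
    using mn by (auto simp: f_def g_def vec_eq_iff)
  have [measurable]: "f \<in> borel_measurable borel" "g \<in> borel_measurable borel"
    using lin by (auto intro!: borel_measurable_continuous_onI linear_continuous_on simp: linear_linear)
  \<comment> \<open>A translation moves the lower corner of the box to 0, where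
    \<open>measure_shear_interval\<close> applies.\<close>
  have cbox: "f ` cbox a b \<in> lmeasurable \<and>
      measure lebesgue (f ` cbox a b) = 1 * measure lebesgue (cbox a b)" for a b
  proof (cases "cbox a b = {}")
    case False
    then have ne: "cbox 0 (b - a) \<noteq> {}"
      by (simp add: box_ne_empty inner_simps)
    have cb: "cbox a b = (+) a ` cbox 0 (b - a)"
      by (simp add: cbox_translation[symmetric])
    then have im: "f ` cbox a b = (+) (f a) ` f ` cbox 0 (b - a)"
      by (simp add: image_image linear_add[OF lin(1)])
    then have "measure lebesgue (f ` cbox a b) = measure lebesgue (f ` cbox 0 (b - a))"
      by (simp add: measure_translation)
    also have "\<dots> = measure lebesgue (cbox 0 (b - a))"
      using measure_shear_interval[OF mn ne] by (simp add: f_def)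
    also have "\<dots> = measure lebesgue (cbox a b)"
      unfolding cb by (rule measure_translation[symmetric])
    finally show ?thesis
      using measurable_linear_image_interval[OF lin(1)] by simp
  qed simp
  have "lborel = distr lborel borel g"
  proof (rule lborel_eqI)
    fix l u :: "real^'n" assume lu: "\<And>b. b \<in> Basis \<Longrightarrow> l \<bullet> b \<le> u \<bullet> b"
    have lm: "f ` box l u \<in> lmeasurable \<and>
        measure lebesgue (f ` box l u) = 1 * measure lebesgue (box l u)"
      using measure_linear_sufficient[OF lin(1), of "box l u" 1] cbox by auto
    have vim: "g -` box l u = f ` box l u"
      using fg by (auto simp: image_iff) metis
    have "emeasure (distr lborel borel g) (box l u) = emeasure lebesgue (f ` box l u)"
      using measurable_sets_borel[of g borel "box l u"] by (subst emeasure_distr) (auto simp: vim[symmetric])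
    also have "\<dots> = (\<Prod>b\<in>Basis. (u - l) \<bullet> b)"
      using lm lu by (simp add: emeasure_eq_measure2 prod_nonneg inner_simps)
    finally show "emeasure (distr lborel borel g) (box l u) = (\<Prod>b\<in>Basis. (u - l) \<bullet> b)" .
  qed simp
  then have "distr lborel borel f = distr (distr lborel borel g) borel f"
    by simp
  also have "\<dots> = distr lborel borel (f \<circ> g)"
    by (rule distr_distr) measurable
  also have "f \<circ> g = (\<lambda>x. x)"
    using fg by auto
  finally show ?thesis
    by (simp add: distr_id2)
qed

text \<open>Exchanging two coordinates maps boxes to boxes and only permutes the factors of their
  volume.\<close>

lemma distr_lborel_transpose:
  "distr lborel borel (\<lambda>x::real^'n. \<chi> i. x $ Transposition.transpose m n i) = lborel"
proof (rule lborel_eqI[symmetric])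
  let ?f = "\<lambda>x::real^'n. \<chi> i. x $ Transposition.transpose m n i"
  have "linear ?f"
    by (auto simp: linear_iff vec_eq_iff)
  then have [measurable]: "?f \<in> borel_measurable borel"
    by (auto intro!: borel_measurable_continuous_onI linear_continuous_on simp: linear_linear)
  fix l u :: "real^'n" assume lu: "\<And>b. b \<in> Basis \<Longrightarrow> l \<bullet> b \<le> u \<bullet> b"
  have vim: "?f -` box l u = box (?f l) (?f u)"
    by (auto simp: mem_box_cart) (metis transpose_involutory)+
  have le: "l $ i \<le> u $ i" for i
    using lu[of "axis i 1"] by (simp add: inner_axis axis_in_Basis_iff)
  have "emeasure (distr lborel borel ?f) (box l u) = emeasure lborel (box (?f l) (?f u))"
    by (subst emeasure_distr) (auto simp: vim)
  also have "\<dots> = (\<Prod>i\<in>UNIV. u $ Transposition.transpose m n i - l $ Transposition.transpose m n i)"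
    using le by (subst emeasure_lborel_box) (auto simp: prod_Basis_cart inner_axis, auto simp: Basis_cart inner_axis)
  also have "\<dots> = (\<Prod>i\<in>UNIV. u $ i - l $ i)"
    using prod.reindex_bij_betw[of "Transposition.transpose m n" UNIV UNIV "\<lambda>i. u $ i - l $ i"]
    by simp
  also have "\<dots> = (\<Prod>b\<in>Basis. (u - l) \<bullet> b)"
    by (simp add: prod_Basis_cart inner_axis)
  finally show "emeasure (distr lborel borel ?f) (box l u) = (\<Prod>b\<in>Basis. (u - l) \<bullet> b)" .
qed simp

text \<open>The library proves the linear change of variables only for well-ordered index types.\<close>

lemma nn_integral_lborel_linear:
  fixes A :: "real^'n^'n"
  assumes A: "det A \<noteq> 0" and g [measurable]: "g \<in> borel_measurable borel"
  shows "(\<integral>\<^sup>+x. g (A *v x) \<partial>lborel) = ennreal (1 / \<bar>det A\<bar>) * (\<integral>\<^sup>+x. g x \<partial>lborel)"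
proof -
  \<comment> \<open>The claim is quantified over g because the case of a product
    \<open>A ** B\<close> uses it for \<open>\<lambda>x. g (A *v x)\<close>.\<close>
  let ?P = "\<lambda>A::real^'n^'n. det A \<noteq> 0 \<longrightarrow> (\<forall>g\<in>borel_measurable borel.
     (\<integral>\<^sup>+x. g (A *v x) \<partial>lborel) = ennreal (1 / \<bar>det A\<bar>) * (\<integral>\<^sup>+x. g x \<partial>lborel))"
  have distr: "?P A" if D: "distr lborel borel (\<lambda>x. A *v x) = lborel" and "\<bar>det A\<bar> = 1" for A :: "real^'n^'n"
  proof (intro impI ballI)
    fix g :: "real^'n \<Rightarrow> ennreal" assume "g \<in> borel_measurable borel"
    then show "(\<integral>\<^sup>+x. g (A *v x) \<partial>lborel) = ennreal (1 / \<bar>det A\<bar>) * (\<integral>\<^sup>+x. g x \<partial>lborel)"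
      using that(2) by (subst (2) D[symmetric]) (simp add: nn_integral_distr)
  qed
  have "?P A"
  proof (rule induct_matrix_elementary_alt)
    fix A B :: "real^'n^'n"
    assume P: "?P A" "?P B"
    show "?P (A ** B)"
    proof (intro impI ballI)
      fix g :: "real^'n \<Rightarrow> ennreal" assume g [measurable]: "g \<in> borel_measurable borel"
      assume "det (A ** B) \<noteq> 0"
      then have d: "det A \<noteq> 0" "det B \<noteq> 0" by (auto simp: det_mul)
      have "(\<integral>\<^sup>+x. g (A *v (B *v x)) \<partial>lborel) = ennreal (1 / \<bar>det B\<bar>) * (\<integral>\<^sup>+x. g (A *v x) \<partial>lborel)"
        using P(2) d by (auto elim!: ballE[of _ _ "\<lambda>x. g (A *v x)"])
      also have "(\<integral>\<^sup>+x. g (A *v x) \<partial>lborel) = ennreal (1 / \<bar>det A\<bar>) * (\<integral>\<^sup>+x. g x \<partial>lborel)"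
        using P(1) d g by auto
      finally have "(\<integral>\<^sup>+x. g ((A ** B) *v x) \<partial>lborel)
          = ennreal (1 / \<bar>det B\<bar>) * (ennreal (1 / \<bar>det A\<bar>) * (\<integral>\<^sup>+x. g x \<partial>lborel))"
        by (simp add: matrix_vector_mul_assoc)
      moreover have "1 / \<bar>det (A ** B)\<bar> = 1 / \<bar>det B\<bar> * (1 / \<bar>det A\<bar>)"
        by (simp add: det_mul abs_mult)
      ultimately show "(\<integral>\<^sup>+x. g ((A ** B) *v x) \<partial>lborel)
          = ennreal (1 / \<bar>det (A ** B)\<bar>) * (\<integral>\<^sup>+x. g x \<partial>lborel)"
        by (simp only: ennreal_mult abs_ge_zero zero_le_divide_1_iff mult.assoc)
    qed
  next
    fix A :: "real^'n^'n" and i assume "row i A = 0"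
    then show "?P A" using det_zero_row by blast
  next
    fix A :: "real^'n^'n" assume 0: "\<And>i j. i \<noteq> j \<Longrightarrow> A $ i $ j = 0"
    have det: "det A = (\<Prod>i\<in>UNIV. A $ i $ i)" by (rule det_diagonal) (use 0 in auto)
    show "?P A"
    proof (intro impI ballI)
      fix g :: "real^'n \<Rightarrow> ennreal" assume g [measurable]: "g \<in> borel_measurable borel"
      assume d: "det A \<noteq> 0"
      \<comment> \<open>\<open>lborel_affine_euclidean\<close> takes its stretching factors as a
        function of the basis vector; c reads the diagonal entry off
        \<open>axis i 1\<close>.\<close>
      define c where "c b = (\<Sum>i\<in>UNIV. A $ i $ i * b $ i)" for b :: "real^'n"
      have c: "c (axis i 1) = A $ i $ i" for i
        by (simp add: c_def axis_def if_distrib cong: if_cong)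
      have Ax: "A *v x = 0 + (\<Sum>j\<in>Basis. (c j * (x \<bullet> j)) *\<^sub>R j)" for x
      proof -
        have "(A *v x) $ i = A $ i $ i * x $ i" for i
          using 0 by (simp add: matrix_vector_mult_def sum.remove[of _ i])
        moreover have "(\<Sum>j\<in>Basis. (c j * (x \<bullet> j)) *\<^sub>R j) $ i = A $ i $ i * x $ i" for i
          by (simp add: sum_Basis_cart c inner_axis) (simp add: axis_def if_distrib cong: if_cong)
        ultimately show ?thesis by (simp add: vec_eq_iff)
      qed
      have "lborel = density (distr lborel borel (\<lambda>x. A *v x)) (\<lambda>_. (\<Prod>j\<in>Basis. \<bar>c j\<bar>))"
        unfolding Ax by (rule lborel_affine_euclidean) (use d in \<open>auto simp: Basis_vec_def c det\<close>)
      also have "(\<Prod>j\<in>Basis. \<bar>c j\<bar>) = \<bar>det A\<bar>"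
        by (simp add: prod_Basis_cart c det abs_prod)
      finally have D: "lborel = density (distr lborel borel (\<lambda>x. A *v x)) (\<lambda>_. ennreal \<bar>det A\<bar>)" .
      have "(\<integral>\<^sup>+x. g x \<partial>lborel) = ennreal \<bar>det A\<bar> * (\<integral>\<^sup>+x. g (A *v x) \<partial>lborel)"
        by (subst D) (simp add: nn_integral_density nn_integral_distr nn_integral_cmult)
      then show "(\<integral>\<^sup>+x. g (A *v x) \<partial>lborel) = ennreal (1 / \<bar>det A\<bar>) * (\<integral>\<^sup>+x. g x \<partial>lborel)"
        using d by (simp add: mult.assoc[symmetric] ennreal_mult[symmetric])
    qed
  next
    fix m n :: 'n assume mn: "m \<noteq> n"
    let ?T = "(\<chi> i j. mat 1 $ i $ Transposition.transpose m n j) :: real^'n^'n"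
    have "?T *v x = (\<chi> i. x $ Transposition.transpose m n i)" for x
    proof -
      have "(\<Sum>j\<in>UNIV. (if i = Transposition.transpose m n j then 1 else 0) * x $ j)
          = (\<Sum>j\<in>UNIV. if j = Transposition.transpose m n i then x $ j else 0)" for i
        by (rule sum.cong) (auto simp: transpose_eq_iff)
      then show ?thesis
        by (simp add: vec_eq_iff matrix_vector_mult_def mat_def)
    qed
    moreover have "\<bar>det ?T\<bar> = 1"
      using mn by (subst det_permute_columns) (auto simp: permutes_swap_id sign_swap_id)
    ultimately show "?P ?T"
      by (intro distr) (auto simp: distr_lborel_transpose)
  next
    fix m n :: 'n assume mn: "m \<noteq> n"
    let ?T = "(\<chi> i j. of_bool (i = m \<and> j = n \<or> i = j)) :: real^'n^'n"
    have "?T *v x = (\<chi> i. if i = m then x $ m + x $ n else x $ i)" for x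
    proof -
      have "x $ m + x $ n = (\<Sum>j\<in>UNIV. of_bool (j = n \<or> m = j) * x $ j)"
        using mn by (auto simp: of_bool_def if_distrib [of "\<lambda>x. x * y" for y] sum.remove cong: if_cong)
      then show ?thesis
        unfolding matrix_vector_mult_def of_bool_def
        by (auto simp: vec_eq_iff if_distrib [of "\<lambda>x. x * y" for y] cong: if_cong)
    qed
    moreover have "det ?T = 1"
    proof -
      have "?T = (\<chi> k. if k = m then row m (mat 1) + 1 *s row n (mat 1) else row k (mat 1))"
        using mn by (auto simp: vec_eq_iff row_def mat_def)
      then show ?thesis
        using det_row_operation[OF mn, of "mat 1 :: real^'n^'n" 1] by simp
    qed
    ultimately show "?P ?T"
      by (intro distr) (auto simp: distr_lborel_shear[OF mn])
  qed
  then show ?thesis using A g by blast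
qed

lemma nn_integral_lebesgue_linear:
  fixes A :: "real^'n^'n"
  assumes A: "det A \<noteq> 0" and g [measurable]: "g \<in> borel_measurable borel"
  shows "(\<integral>\<^sup>+x. g (A *v x) \<partial>lebesgue) = ennreal (1 / \<bar>det A\<bar>) * (\<integral>\<^sup>+x. g x \<partial>lebesgue)"
  using nn_integral_lborel_linear[OF assms] by (simp add: nn_integral_completion)

text \<open>Cauchy-Schwarz in each row; the matrix norm is the Euclidean norm of the row
  norms.\<close>

lemma norm_matrix_vector_mult_le:
  fixes A :: "real^'n^'m"
  shows "norm (A *v x) \<le> norm A * norm x"
proof -
  have "\<bar>(A *v x) $ i\<bar> \<le> norm (A $ i) * norm x" for i
    using Cauchy_Schwarz_ineq2[of "A $ i" x] by (simp add: matrix_vector_mult_def inner_vec_def)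
  then have "norm (A *v x) \<le> L2_set (\<lambda>i. norm x * norm (A $ i)) UNIV"
    unfolding norm_vec_def by (intro L2_set_mono) (auto simp: mult.commute norm_vec_def)
  also have "\<dots> = norm A * norm x"
    by (simp add: L2_set_right_distrib[symmetric] norm_vec_def mult.commute)
  finally show ?thesis .
qed

text \<open>The change of variables for the indicator of N multiplies its integral, which is 0, by 1
  / |det A|.\<close>

lemma AE_nonsingular_linear:
  fixes A :: "real^'n^'n"
  assumes A: "det A \<noteq> 0" and N: "N \<in> null_sets lborel"
  shows "AE x in lebesgue. A *v x \<notin> N"
proof -
  have [measurable]: "N \<in> sets borel" using N by auto
  have [measurable]: "(\<lambda>x. A *v x) \<in> lebesgue \<rightarrow>\<^sub>M borel"
    by (rule measurable_completion) measurable
  have "(\<integral>\<^sup>+x. indicator N (A *v x) \<partial>lebesgue) = 0"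
    using N by (subst nn_integral_lebesgue_linear[OF A]) (auto simp: null_sets_def)
  then have "AE x in lebesgue. (indicator N (A *v x) :: ennreal) = 0"
    by (subst (asm) nn_integral_0_iff_AE) measurable
  then show ?thesis
    by eventually_elim (auto split: split_indicator_asm)
qed

section \<open>Weights on dyadic balls\<close>

lemma AE_not_sphere:
  fixes z :: "'a::euclidean_space"
  shows "AE x in lebesgue. x \<notin> sphere z r"
  by (rule AE_not_in) (use negligible_sphere negligible_iff_null_sets in blast)

text \<open>Reconciles the open balls in the weight classes with the closed dyadic balls: spheres
  are null sets.\<close>

lemma set_nn_integral_ball_eq_cball:
  fixes z :: "'a::euclidean_space"
  shows "(\<integral>\<^sup>+x\<in>ball z r. f x \<partial>lebesgue) = (\<integral>\<^sup>+x\<in>cball z r. f x \<partial>lebesgue)"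
  using AE_not_sphere[of z r]
  by (intro nn_integral_cong_AE; eventually_elim) (auto split: split_indicator)

text \<open>Volume of the ball of radius 2^k, kept in the reals because quotients and real powers of
  it are formed. The \<open>itself\<close> argument carries the dimension.\<close>

definition dyadic_vol :: "'n::finite itself \<Rightarrow> int \<Rightarrow> real" where
  "dyadic_vol _ k = unit_ball_vol (real CARD('n)) * 2 powr (real CARD('n) * real_of_int k)"

lemma dyadic_vol_pos [simp]: "0 < dyadic_vol TYPE('n::finite) k"
  by (simp add: dyadic_vol_def)

lemma dyadic_vol_neq_0 [simp]: "dyadic_vol TYPE('n::finite) k \<noteq> 0"
  using dyadic_vol_pos[where 'n='n, of k] by linarith

lemma dyadic_vol_nonneg [simp]: "0 \<le> dyadic_vol TYPE('n::finite) k"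
  by (simp add: less_imp_le)

lemma emeasure_dyadic_ball:
  "emeasure lebesgue (dyadic_ball k :: (real^'n) set) = ennreal (dyadic_vol TYPE('n) k)"
proof -
  have "(2 powi k) ^ CARD('n) = (2::real) powr (real CARD('n) * real_of_int k)"
    by (simp add: powr_real_of_int'[symmetric] powr_powr powr_realpow[symmetric] mult.commute)
  then show ?thesis
    by (simp add: dyadic_ball_def emeasure_cball dyadic_vol_def)
qed

lemma dyadic_vol_divide:
  "dyadic_vol TYPE('n::finite) j / dyadic_vol TYPE('n) k = 2 powr (real CARD('n) * real_of_int (j - k))"
proof -
  have "unit_ball_vol (real CARD('n)) \<noteq> 0"
    using unit_ball_vol_pos[of "real CARD('n)"] by linarith
  then show ?thesis
    by (simp add: dyadic_vol_def powr_diff right_diff_distrib)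
qed

lemma average_dyadic:
  "average (ball (0::real^'n) (2 powi k)) f
     = (\<integral>\<^sup>+x\<in>dyadic_ball k. f x \<partial>lebesgue) / ennreal (dyadic_vol TYPE('n) k)"
proof -
  have "emeasure lebesgue (ball (0::real^'n) (2 powi k)) = emeasure lebesgue (dyadic_ball k :: (real^'n) set)"
    using set_nn_integral_ball_eq_cball[of "\<lambda>_. 1" "0::real^'n" "2 powi k"] by (simp add: dyadic_ball_def)
  then show ?thesis
    by (simp add: average_def emeasure_dyadic_ball set_nn_integral_ball_eq_cball) (simp add: dyadic_ball_def)
qed

lemma dyadic_ball_mono: "j \<le> k \<Longrightarrow> dyadic_ball j \<subseteq> dyadic_ball k"
  by (simp add: dyadic_ball_def subset_cball power_int_increasing)

lemma dyadic_ball_borel [measurable, simp]: "dyadic_ball k \<in> sets borel" "dyadic_ball k \<in> sets lebesgue"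
  by (simp_all add: dyadic_ball_def)

lemma dyadic_shell_borel [measurable, simp]: "dyadic_shell k \<in> sets borel" "dyadic_shell k \<in> sets lebesgue"
  by (simp_all add: dyadic_shell_def sets.Diff)

lemma ennreal_le_mult_of_divide_le:
  assumes "0 < v" "x / ennreal v \<le> y"
  shows "x \<le> y * ennreal v"
proof -
  have "x = x / ennreal v * ennreal v"
    using assms(1) by (simp add: ennreal_divide_times mult_divide_eq_ennreal)
  also have "\<dots> \<le> y * ennreal v"
    using assms(2) by (rule mult_right_mono) simp
  finally show ?thesis .
qed

text \<open>The truncations to balls are integrable and converge pointwise.\<close>

lemma locally_integrable_imp_measurable:
  fixes f :: "'a::euclidean_space \<Rightarrow> 'b::{banach, second_countable_topology}"
  assumes "locally_integrable f"
  shows "f \<in> borel_measurable lebesgue"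
proof (rule borel_measurable_LIMSEQ_metric)
  fix j :: nat
  show "(\<lambda>x. indicator (cball 0 (real j)) x *\<^sub>R f x) \<in> borel_measurable lebesgue"
  proof (rule borel_measurable_integrable)
    show "integrable lebesgue (\<lambda>x. indicator (cball 0 (real j)) x *\<^sub>R f x)"
      using assms by (simp add: locally_integrable_def set_integrable_def)
  qed
next
  fix x :: 'a
  obtain j where j: "norm x \<le> real j" using real_arch_simple by blast
  have "\<forall>\<^sub>F i in sequentially. indicator (cball 0 (real i)) x *\<^sub>R f x = f x"
    using eventually_ge_at_top[of j] by eventually_elim (use j in auto)
  then show "(\<lambda>i. indicator (cball 0 (real i)) x *\<^sub>R f x) \<longlonglongrightarrow> f x"
    by (rule tendsto_eventually)
qed

text \<open>The zero weight satisfies the A_\<xi> inequality in extended arithmetic, since 0 *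
  \<infinity> = 0. Excluding it makes all masses of balls positive.\<close>

locale muckenhoupt_weight =
  fixes \<omega> :: "real^'n \<Rightarrow> real" and \<xi> :: real
  assumes muckenhoupt: "\<omega> \<in> muckenhoupt \<xi>" and \<xi>: "1 \<le> \<xi>"
    and nonzero: "\<not> (AE x in lebesgue. \<omega> x = 0)"
begin

lemma nonneg: "0 \<le> \<omega> x"
  using muckenhoupt by (simp add: muckenhoupt_def weight_def)

lemma measurable_weight [measurable]: "\<omega> \<in> borel_measurable lebesgue"
  using muckenhoupt by (simp add: muckenhoupt_def weight_def locally_integrable_imp_measurable)

abbreviation w :: "int \<Rightarrow> ennreal" where
  "w k \<equiv> wmeas \<omega> (dyadic_ball k)"

lemma w_finite: "w k < top"
proof -
  have "set_integrable lebesgue (dyadic_ball k) \<omega>"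
    using muckenhoupt by (simp add: muckenhoupt_def weight_def locally_integrable_def dyadic_ball_def)
  then have "integrable lebesgue (\<lambda>x. indicator (dyadic_ball k) x * \<omega> x)"
    by (simp add: set_integrable_def)
  then have "(\<integral>\<^sup>+x. ennreal (norm (indicator (dyadic_ball k) x * \<omega> x)) \<partial>lebesgue) < \<infinity>"
    by (simp add: integrable_iff_bounded)
  also have "(\<integral>\<^sup>+x. ennreal (norm (indicator (dyadic_ball k) x * \<omega> x)) \<partial>lebesgue) = w k"
    unfolding wmeas_def by (intro nn_integral_cong) (auto simp: nonneg split: split_indicator)
  finally show ?thesis by simp
qed

lemma w_mono: "j \<le> k \<Longrightarrow> w j \<le> w k"
  unfolding wmeas_def using dyadic_ball_mono[of j k]
  by (intro nn_integral_mono) (auto split: split_indicator)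

text \<open>If the mean of \<omega> is positive, A_\<xi> forces a positive essential infimum when
  \<xi> = 1, and a finite integral of \<omega>^(-1/(\<xi>-1)) otherwise. Either way \<omega> cannot
  vanish on a set of positive measure in the ball.\<close>

lemma AE_pos_dyadic:
  assumes "w k \<noteq> 0"
  shows "AE x in lebesgue. x \<in> dyadic_ball k \<longrightarrow> 0 < \<omega> x"
proof -
  have AE_ball: "AE x in lebesgue. x \<in> dyadic_ball k \<longrightarrow> x \<in> ball (0::real^'n) (2 powi k)"
    using AE_not_sphere[of 0 "2 powi k"] by eventually_elim (auto simp: dyadic_ball_def)
  obtain C :: real where C: "0 < C" "\<And>z r. 0 < r \<Longrightarrow>
      (if \<xi> = 1
       then average (ball z r) (\<lambda>x. ennreal (\<omega> x))
              \<le> ennreal C * ess_inf (ball z r) (\<lambda>x. ennreal (\<omega> x))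
       else average (ball z r) (\<lambda>x. ennreal (\<omega> x)) *
            average (ball z r) (\<lambda>x. ennreal (\<omega> x) epowr (- 1 / (\<xi> - 1))) epowr (\<xi> - 1)
              \<le> ennreal C)"
    using muckenhoupt by (auto simp: muckenhoupt_def)
  have avg: "average (ball 0 (2 powi k)) (\<lambda>x. ennreal (\<omega> x)) \<noteq> 0"
    using assms by (simp add: average_dyadic wmeas_def ennreal_divide_eq_0_iff)
  show ?thesis
  proof (cases "\<xi> = 1")
    case True
    have "ess_inf (ball 0 (2 powi k)) (\<lambda>x. ennreal (\<omega> x)) \<noteq> 0"
      using C(2)[of "2 powi k" 0] avg True by auto
    then obtain c where "c \<noteq> 0" and c: "AE x\<in>ball 0 (2 powi k) in lebesgue. c \<le> ennreal (\<omega> x)"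
      unfolding ess_inf_def by (metis (no_types, lifting) SUP_bot_conv(2) Sup_bot_conv(1) bot_ennreal mem_Collect_eq)
    from c AE_ball show ?thesis
    proof eventually_elim
      case (elim x)
      show ?case
      proof
        assume "x \<in> dyadic_ball k"
        with elim have "c \<le> ennreal (\<omega> x)" by blast
        with \<open>c \<noteq> 0\<close> have "0 < ennreal (\<omega> x)"
          using zero_less_iff_neq_zero order.strict_trans2 by metis
        then show "0 < \<omega> x" by simp
      qed
    qed
  next
    case False
    then have \<xi>: "1 < \<xi>" using \<xi> by simp
    let ?I = "\<integral>\<^sup>+x\<in>dyadic_ball k. ennreal (\<omega> x) epowr (- 1 / (\<xi> - 1)) \<partial>lebesgue"
    \<comment> \<open>A positive mean times \<infinity> would exceed the constant of the
      class.\<close>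
    have "?I \<noteq> top"
    proof
      assume "?I = top"
      then have "average (ball 0 (2 powi k)) (\<lambda>x. ennreal (\<omega> x) epowr (- 1 / (\<xi> - 1))) = top"
        by (simp add: average_dyadic ennreal_divide_eq_top_iff)
      then show False
        using C(2)[of "2 powi k" 0] avg False \<xi> by (simp add: top_epowr ennreal_mult_top top_unique)
    qed
    then have "AE x in lebesgue. ennreal (\<omega> x) epowr (- 1 / (\<xi> - 1)) * indicator (dyadic_ball k) x \<noteq> \<infinity>"
      by (intro nn_integral_PInf_AE) simp_all
    then show ?thesis
    proof eventually_elim
      case (elim x)
      show ?case
        using elim nonneg[of x] \<xi>
        by (cases "\<omega> x = 0") (auto simp: zero_epowr less_le)
    qed
  qed
qed

lemma ex_w_nonzero: "\<exists>k. w k \<noteq> 0"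
proof (rule ccontr)
  assume "\<not> ?thesis"
  then have "AE x in lebesgue. ennreal (\<omega> x) * indicator (dyadic_ball k) x = 0" for k
    by (subst nn_integral_0_iff_AE[symmetric]) (auto simp: wmeas_def)
  then have "AE x in lebesgue. \<forall>j. ennreal (\<omega> x) * indicator (dyadic_ball (int j)) x = 0"
    by (subst AE_all_countable) auto
  then have "AE x in lebesgue. \<omega> x = 0"
  proof eventually_elim
    case (elim x)
    obtain j where "norm x < 2 ^ j"
      using real_arch_pow[of 2 "norm x"] by auto
    then have "x \<in> dyadic_ball (int j)"
      by (simp add: dyadic_ball_def)
    then show ?case
      using elim[rule_format, of j] nonneg[of x] by simp
  qed
  with nonzero show False by simp
qed

text \<open>Positivity is known on balls of positive mass. The index \<open>max k (int j)\<close>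
  keeps the mass positive by monotonicity, while the balls still exhaust the space.\<close>

lemma AE_pos: "AE x in lebesgue. 0 < \<omega> x"
proof -
  obtain k where k: "w k \<noteq> 0" using ex_w_nonzero by blast
  have "AE x in lebesgue. x \<in> dyadic_ball (max k (int j)) \<longrightarrow> 0 < \<omega> x" for j
    by (rule AE_pos_dyadic) (use k w_mono[of k "max k (int j)"] in auto)
  then have "AE x in lebesgue. \<forall>j. x \<in> dyadic_ball (max k (int j)) \<longrightarrow> 0 < \<omega> x"
    by (subst AE_all_countable) auto
  then show ?thesis
  proof eventually_elim
    case (elim x)
    obtain j where "norm x < 2 ^ j"
      using real_arch_pow[of 2 "norm x"] by auto
    then have "x \<in> dyadic_ball (int j)"
      by (simp add: dyadic_ball_def)
    then have "x \<in> dyadic_ball (max k (int j))"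
      using dyadic_ball_mono[of "int j" "max k (int j)"] by auto
    with elim show ?case by blast
  qed
qed

text \<open>This permits division by masses of balls and negative powers of them.\<close>

lemma w_pos: "0 < w k"
proof -
  have "w k \<noteq> 0"
  proof
    assume "w k = 0"
    then have "AE x in lebesgue. ennreal (\<omega> x) * indicator (dyadic_ball k) x = 0"
      by (subst nn_integral_0_iff_AE[symmetric]) (auto simp: wmeas_def)
    then have "AE x::real^'n in lebesgue. x \<notin> dyadic_ball k"
      using AE_pos by eventually_elim (auto simp: indicator_def)
    then have "emeasure lebesgue (dyadic_ball k :: (real^'n) set) = 0"
      by (subst (asm) AE_iff_measurable[OF _ refl]) auto
    then show False
      by (simp add: emeasure_dyadic_ball)
  qed
  then show ?thesis by (simp add: zero_less_iff_neq_zero)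
qed

text \<open>In averaged form: the mean of F over a ball is at most a constant times its mean of
  exponent \<xi> with respect to \<omega>. For \<xi> > 1 it is Hoelder for F = (F
  \<omega>^(1/\<xi>)) \<omega>^(-1/\<xi>), where A_\<xi> controls the second factor; for \<xi> = 1
  the essential infimum bounds \<omega> from below.\<close>

lemma muckenhoupt_Hoelder:
  obtains C :: real where "0 < C"
    "\<And>k F. F \<in> borel_measurable lebesgue \<Longrightarrow>
       w k epowr (1 / \<xi>) * (\<integral>\<^sup>+x\<in>dyadic_ball k. F x \<partial>lebesgue)
         \<le> ennreal (C * dyadic_vol TYPE('n) k) * (\<integral>\<^sup>+x\<in>dyadic_ball k. F x epowr \<xi> * ennreal (\<omega> x) \<partial>lebesgue) epowr (1 / \<xi>)"
proof -
  obtain C :: real where C: "0 < C" "\<And>z r. 0 < r \<Longrightarrow>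
      (if \<xi> = 1
       then average (ball z r) (\<lambda>x. ennreal (\<omega> x))
              \<le> ennreal C * ess_inf (ball z r) (\<lambda>x. ennreal (\<omega> x))
       else average (ball z r) (\<lambda>x. ennreal (\<omega> x)) *
            average (ball z r) (\<lambda>x. ennreal (\<omega> x) epowr (- 1 / (\<xi> - 1))) epowr (\<xi> - 1)
              \<le> ennreal C)"
    using muckenhoupt by (auto simp: muckenhoupt_def)
  show ?thesis
  proof (rule that)
    show "0 < C powr (1 / \<xi>)" using C by simp
    fix k :: int and F :: "real^'n \<Rightarrow> ennreal" assume F [measurable]: "F \<in> borel_measurable lebesgue"
    let ?I = "\<integral>\<^sup>+x\<in>dyadic_ball k. F x \<partial>lebesgue"
    show "w k epowr (1 / \<xi>) * ?I
        \<le> ennreal (C powr (1 / \<xi>) * dyadic_vol TYPE('n) k) * (\<integral>\<^sup>+x\<in>dyadic_ball k. F x epowr \<xi> * ennreal (\<omega> x) \<partial>lebesgue) epowr (1 / \<xi>)"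
    proof (cases "\<xi> = 1")
      case True
      let ?S = "{c. AE x\<in>ball 0 (2 powi k) in lebesgue. c \<le> ennreal (\<omega> x)}"
      have "w k / ennreal (dyadic_vol TYPE('n) k) \<le> ennreal C * Sup ?S"
        using C(2)[of "2 powi k" 0] True by (simp add: average_dyadic wmeas_def ess_inf_def)
      from ennreal_le_mult_of_divide_le[OF dyadic_vol_pos this]
      have "w k \<le> ennreal (C * dyadic_vol TYPE('n) k) * Sup ?S"
        using C by (simp add: ennreal_mult mult_ac)
      then have "w k * ?I \<le> ennreal (C * dyadic_vol TYPE('n) k) * (Sup ?S * ?I)"
        by (simp add: mult_right_mono flip: mult.assoc)
      \<comment> \<open>\<open>ess_inf\<close> is a supremum of almost everywhere lower bounds c, so
        it suffices to insert a single c under the integral.\<close>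
      also have "Sup ?S * ?I = (SUP c\<in>?S. c * ?I)"
        using SUP_mult_right_ennreal[where I="?S" and f="\<lambda>c. c" and c="?I"] by (auto intro!: exI[of _ 0])
      also have "\<dots> \<le> (\<integral>\<^sup>+x\<in>dyadic_ball k. F x * ennreal (\<omega> x) \<partial>lebesgue)"
      proof (rule SUP_least)
        fix c assume c: "c \<in> ?S"
        have "c * ?I = (\<integral>\<^sup>+x\<in>ball 0 (2 powi k). c * F x \<partial>lebesgue)"
          unfolding set_nn_integral_ball_eq_cball dyadic_ball_def[symmetric]
          by (simp add: nn_integral_cmult[symmetric] mult.assoc)
        also have "\<dots> \<le> (\<integral>\<^sup>+x\<in>ball 0 (2 powi k). F x * ennreal (\<omega> x) \<partial>lebesgue)"
          by (rule nn_integral_mono_AE)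
            (use c in \<open>auto simp: mult.commute[of c] elim!: eventually_mono intro: mult_left_mono split: split_indicator\<close>)
        finally show "c * ?I \<le> (\<integral>\<^sup>+x\<in>dyadic_ball k. F x * ennreal (\<omega> x) \<partial>lebesgue)"
          by (simp add: set_nn_integral_ball_eq_cball dyadic_ball_def)
      qed
      finally show ?thesis
        using True C by (simp add: mult_left_mono)
    next
      case False
      then have \<xi>: "1 < \<xi>" using \<xi> by simp
      let ?J = "\<integral>\<^sup>+x\<in>dyadic_ball k. F x epowr \<xi> * ennreal (\<omega> x) \<partial>lebesgue"
      let ?S = "\<integral>\<^sup>+x\<in>dyadic_ball k. ennreal (\<omega> x) epowr (- 1 / (\<xi> - 1)) \<partial>lebesgue"
      let ?\<chi> = "indicator (dyadic_ball k) :: real^'n \<Rightarrow> ennreal"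
      have "?I \<le> (\<integral>\<^sup>+x. (F x epowr \<xi> * ennreal (\<omega> x) * ?\<chi> x) epowr (1 / \<xi>)
           * (ennreal (\<omega> x) epowr (- 1 / (\<xi> - 1)) * ?\<chi> x) epowr (1 - 1 / \<xi>) \<partial>lebesgue)"
      proof (rule nn_integral_mono_AE)
        show "AE x in lebesgue. F x * ?\<chi> x \<le> (F x epowr \<xi> * ennreal (\<omega> x) * ?\<chi> x) epowr (1 / \<xi>)
           * (ennreal (\<omega> x) epowr (- 1 / (\<xi> - 1)) * ?\<chi> x) epowr (1 - 1 / \<xi>)"
          \<comment> \<open>Positivity of \<omega> lets \<omega>^(1/\<xi>) and \<omega>^(-1/\<xi>)
            cancel.\<close>
          using AE_pos
        proof eventually_elim
          case (elim x)
          have e: "(1 - 1 / \<xi>) / (\<xi> - 1) = 1 / \<xi>"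
            using \<xi> by (simp add: field_simps)
          have "ennreal (\<omega> x) epowr (1 / \<xi>) * ennreal (\<omega> x) epowr (- 1 / \<xi>) = 1"
            using epowr_add[of "ennreal (\<omega> x)" "1 / \<xi>" "- 1 / \<xi>"] elim by simp
          then show ?case
            using \<xi> elim e by (auto simp: epowr_mult epowr_epowr mult.assoc split: split_indicator)
        qed
      qed
      also have "\<dots> \<le> ?J epowr (1 / \<xi>) * ?S epowr (1 - 1 / \<xi>)"
        by (rule nn_integral_Hoelder2) (use \<xi> in auto)
      finally have 1: "w k epowr (1 / \<xi>) * ?I \<le> w k epowr (1 / \<xi>) * ?S epowr (1 - 1 / \<xi>) * ?J epowr (1 / \<xi>)"
        by (simp add: mult_left_mono mult_ac)
      have "w k / ennreal (dyadic_vol TYPE('n) k) * (?S / ennreal (dyadic_vol TYPE('n) k)) epowr (\<xi> - 1) \<le> ennreal C"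
        using C(2)[of "2 powi k" 0] False by (simp add: average_dyadic wmeas_def)
      then have "(w k / ennreal (dyadic_vol TYPE('n) k) * (?S / ennreal (dyadic_vol TYPE('n) k)) epowr (\<xi> - 1)) epowr (1 / \<xi>) \<le> ennreal C epowr (1 / \<xi>)"
        using \<xi> by (intro epowr_mono) auto
      then have "ennreal (dyadic_vol TYPE('n) k) * (w k / ennreal (dyadic_vol TYPE('n) k) * (?S / ennreal (dyadic_vol TYPE('n) k)) epowr (\<xi> - 1)) epowr (1 / \<xi>)
          \<le> ennreal (C powr (1 / \<xi>) * dyadic_vol TYPE('n) k)"
        using C by (simp add: ennreal_epowr ennreal_mult mult.commute[of "ennreal (dyadic_vol TYPE('n) k)"] mult_right_mono)
      \<comment> \<open>The volume is distributed over the two averages of the A_\<xi> condition in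
        the proportion 1/\<xi> to 1 - 1/\<xi>, which clears both denominators.\<close>
      moreover have "ennreal (dyadic_vol TYPE('n) k) = ennreal (dyadic_vol TYPE('n) k) epowr (1 / \<xi>) * ennreal (dyadic_vol TYPE('n) k) epowr (1 - 1 / \<xi>)"
        by (subst epowr_add[symmetric]) auto
      moreover have "ennreal (dyadic_vol TYPE('n) k) epowr (1 / \<xi>) * ennreal (dyadic_vol TYPE('n) k) epowr (1 - 1 / \<xi>)
           * (w k / ennreal (dyadic_vol TYPE('n) k) * (?S / ennreal (dyadic_vol TYPE('n) k)) epowr (\<xi> - 1)) epowr (1 / \<xi>)
         = (ennreal (dyadic_vol TYPE('n) k) * (w k / ennreal (dyadic_vol TYPE('n) k))) epowr (1 / \<xi>) * (ennreal (dyadic_vol TYPE('n) k) * (?S / ennreal (dyadic_vol TYPE('n) k))) epowr (1 - 1 / \<xi>)"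
      proof -
        have "(\<xi> - 1) * (1 / \<xi>) = 1 - 1 / \<xi>" using \<xi> by (simp add: field_simps)
        then show ?thesis
          using \<xi> by (simp add: epowr_mult epowr_epowr mult_ac)
      qed
      ultimately have 2: "w k epowr (1 / \<xi>) * ?S epowr (1 - 1 / \<xi>) \<le> ennreal (C powr (1 / \<xi>) * dyadic_vol TYPE('n) k)"
        by (simp add: ennreal_times_divide mult_divide_eq_ennreal mult.commute[of "ennreal (dyadic_vol TYPE('n) k)"])
      show ?thesis
        by (rule order.trans[OF 1 mult_right_mono[OF 2]]) simp
    qed
  qed
qed

text \<open>Dual to \<open>muckenhoupt_Hoelder\<close>: the mean of F with respect to \<omega> is at
  most a constant times its unweighted mean of exponent 1/\<theta>. For \<theta> = 1 - 1/s this is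
  Hoelder with the conjugate pair of s; smaller \<theta> follows since power means increase with the
  exponent. The values 1 - 1/s, (\<delta> - 1)/\<delta> and qstar \<xi> / q of \<theta> all occur
  later.\<close>

lemma reverse_Hoelder:
  assumes s: "1 < s" and rh: "\<omega> \<in> reverse_hoelder s" and \<theta>: "0 < \<theta>" "\<theta> \<le> 1 - 1 / s"
  obtains C :: real where "0 < C"
    "\<And>k F. F \<in> borel_measurable lebesgue \<Longrightarrow>
       ennreal (dyadic_vol TYPE('n) k) epowr \<theta> * (\<integral>\<^sup>+x\<in>dyadic_ball k. F x * ennreal (\<omega> x) \<partial>lebesgue)
         \<le> ennreal C * w k * (\<integral>\<^sup>+x\<in>dyadic_ball k. F x epowr (1 / \<theta>) \<partial>lebesgue) epowr \<theta>"
proof -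
  obtain C :: real where C: "0 < C" "\<And>z r. 0 < r \<Longrightarrow>
      average (ball z r) (\<lambda>x. ennreal (\<omega> x) epowr s) epowr (1 / s)
        \<le> ennreal C * average (ball z r) (\<lambda>x. ennreal (\<omega> x))"
    using rh by (auto simp: reverse_hoelder_def)
  define \<sigma> where "\<sigma> = 1 - 1 / s"
  have \<sigma>: "0 < \<sigma>" "\<sigma> < 1" "\<theta> \<le> \<sigma>" "1 - \<sigma> = 1 / s" using s \<theta> by (auto simp: \<sigma>_def)
  show ?thesis
  proof (rule that)
    show "0 < C" by fact
    fix k :: int and F :: "real^'n \<Rightarrow> ennreal" assume F [measurable]: "F \<in> borel_measurable lebesgue"
    let ?\<chi> = "indicator (dyadic_ball k) :: real^'n \<Rightarrow> ennreal"
    let ?v = "ennreal (dyadic_vol TYPE('n) k)"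
    let ?I = "\<integral>\<^sup>+x\<in>dyadic_ball k. F x * ennreal (\<omega> x) \<partial>lebesgue"
    let ?S = "\<integral>\<^sup>+x\<in>dyadic_ball k. ennreal (\<omega> x) epowr s \<partial>lebesgue"
    let ?J = "\<integral>\<^sup>+x\<in>dyadic_ball k. F x epowr (1 / \<sigma>) \<partial>lebesgue"
    let ?K = "\<integral>\<^sup>+x\<in>dyadic_ball k. F x epowr (1 / \<theta>) \<partial>lebesgue"
    have "?I = (\<integral>\<^sup>+x. (F x epowr (1 / \<sigma>) * ?\<chi> x) epowr \<sigma> * (ennreal (\<omega> x) epowr s * ?\<chi> x) epowr (1 - \<sigma>) \<partial>lebesgue)"
      using \<sigma> s by (intro nn_integral_cong)
        (auto simp: epowr_mult epowr_epowr mult_ac zero_epowr split: split_indicator)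
    also have "\<dots> \<le> ?J epowr \<sigma> * ?S epowr (1 - \<sigma>)"
      by (rule nn_integral_Hoelder2) (use \<sigma> in auto)
    finally have 1: "?I \<le> ?J epowr \<sigma> * ?S epowr (1 / s)"
      using \<sigma> by simp
    have "(?S / ?v) epowr (1 / s) \<le> ennreal C * (w k / ?v)"
      using C(2)[of "2 powi k" 0] by (simp add: average_dyadic wmeas_def)
    then have "?v * (?S / ?v) epowr (1 / s) \<le> ?v * (ennreal C * (w k / ?v))"
      by (rule mult_left_mono) simp
    also have "\<dots> = ennreal C * (w k * ?v / ?v)"
      by (simp add: ennreal_times_divide mult_ac)
    also have "w k * ?v / ?v = w k"
      by (simp add: mult_divide_eq_ennreal)
    finally have "?v * (?S / ?v) epowr (1 / s) \<le> ennreal C * w k" .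
    moreover have "?v * (?S / ?v) epowr (1 / s) = ?v epowr \<sigma> * ?S epowr (1 / s)"
    proof -
      have "?v = ?v epowr \<sigma> * ?v epowr (1 / s)"
        using \<sigma> by (subst epowr_add[symmetric]) (auto simp: \<sigma>_def)
      then have "?v * (?S / ?v) epowr (1 / s) = ?v epowr \<sigma> * ?v epowr (1 / s) * (?S / ?v) epowr (1 / s)"
        by (rule arg_cong)
      also have "\<dots> = ?v epowr \<sigma> * (?v epowr (1 / s) * (?S / ?v) epowr (1 / s))"
        by (rule mult.assoc)
      also have "?v epowr (1 / s) * (?S / ?v) epowr (1 / s) = (?v * (?S / ?v)) epowr (1 / s)"
        using s by (simp add: epowr_mult)
      also have "?v * (?S / ?v) = ?S"
        by (simp add: ennreal_times_divide mult_divide_eq_ennreal mult.commute[of ?v])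
      finally show ?thesis .
    qed
    ultimately have 2: "?v epowr \<sigma> * ?S epowr (1 / s) \<le> ennreal C * w k"
      by simp
    \<comment> \<open>Hoelder against the constant 1 on the ball raises the exponent from 1/\<sigma>
      to 1/\<theta>, at the price of a power of the volume.\<close>
    have "?J = (\<integral>\<^sup>+x. (F x epowr (1 / \<theta>) * ?\<chi> x) epowr (\<theta> / \<sigma>) * ?\<chi> x epowr (1 - \<theta> / \<sigma>) \<partial>lebesgue)"
      using \<sigma> \<theta> by (intro nn_integral_cong)
        (auto simp: epowr_mult epowr_epowr zero_epowr split: split_indicator)
    also have "\<dots> \<le> ?K epowr (\<theta> / \<sigma>) * (\<integral>\<^sup>+x. ?\<chi> x \<partial>lebesgue) epowr (1 - \<theta> / \<sigma>)"
      by (rule nn_integral_Hoelder2) (use \<sigma> \<theta> in auto)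
    finally have "?J \<le> ?K epowr (\<theta> / \<sigma>) * ?v epowr (1 - \<theta> / \<sigma>)"
      by (simp add: emeasure_dyadic_ball)
    then have "?J epowr \<sigma> \<le> (?K epowr (\<theta> / \<sigma>) * ?v epowr (1 - \<theta> / \<sigma>)) epowr \<sigma>"
      using \<sigma> by (intro epowr_mono) auto
    also have "\<dots> = ?K epowr \<theta> * ?v epowr (\<sigma> - \<theta>)"
    proof -
      have "(1 - \<theta> / \<sigma>) * \<sigma> = \<sigma> - \<theta>" using \<sigma> by (simp add: field_simps)
      then show ?thesis using \<sigma> by (simp add: epowr_mult epowr_epowr)
    qed
    finally have 3: "?J epowr \<sigma> \<le> ?K epowr \<theta> * ?v epowr (\<sigma> - \<theta>)" .
    have "?v epowr \<theta> * ?I \<le> ?v epowr \<theta> * ((?K epowr \<theta> * ?v epowr (\<sigma> - \<theta>)) * ?S epowr (1 / s))"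
      by (intro mult_left_mono order.trans[OF 1] mult_right_mono 3) auto
    also have "\<dots> = ?K epowr \<theta> * ((?v epowr \<theta> * ?v epowr (\<sigma> - \<theta>)) * ?S epowr (1 / s))"
      by (simp add: mult_ac)
    also have "?v epowr \<theta> * ?v epowr (\<sigma> - \<theta>) = ?v epowr \<sigma>"
      by (subst epowr_add[symmetric]) auto
    also have "?K epowr \<theta> * (?v epowr \<sigma> * ?S epowr (1 / s)) \<le> ?K epowr \<theta> * (ennreal C * w k)"
      by (rule mult_left_mono[OF 2]) simp
    finally show "?v epowr \<theta> * ?I \<le> ennreal C * w k * ?K epowr \<theta>"
      by (simp add: mult_ac)
  qed
qed

section \<open>Growth of the mass of concentric balls\<close>

definition W :: "int \<Rightarrow> real" where
  "W k = enn2real (w k)"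

lemma W_pos [simp]: "0 < W k"
  using w_pos w_finite by (simp add: W_def enn2real_positive_iff)

lemma W_simps [simp]: "0 \<le> W k" "W k \<noteq> 0" "\<bar>W k\<bar> = W k"
  using W_pos[of k] by linarith+

lemma w_eq: "w k = ennreal (W k)"
  using w_finite by (simp add: W_def)

lemma w_epowr: "w k epowr a = ennreal (W k powr a)"
  by (simp add: w_eq ennreal_epowr)

lemma W_mono: "j \<le> k \<Longrightarrow> W j \<le> W k"
  using w_mono[of j k] W_pos[of k] by (simp add: w_eq)

text \<open>The indicator of the smaller ball in \<open>muckenhoupt_Hoelder\<close> on the larger
  one bounds the ratio of volumes by the 1/\<xi>-th power of the ratio of masses, up to a
  constant.\<close>

lemma W_upper:
  obtains C where "1 \<le> C" "\<And>k K. k \<le> K \<Longrightarrow> W K \<le> C * 2 powr (real CARD('n) * \<xi> * real_of_int (K - k)) * W k"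
proof -
  obtain C :: real where C: "0 < C"
    "\<And>k F. F \<in> borel_measurable lebesgue \<Longrightarrow>
       w k epowr (1 / \<xi>) * (\<integral>\<^sup>+x\<in>dyadic_ball k. F x \<partial>lebesgue)
         \<le> ennreal (C * dyadic_vol TYPE('n) k) * (\<integral>\<^sup>+x\<in>dyadic_ball k. F x epowr \<xi> * ennreal (\<omega> x) \<partial>lebesgue) epowr (1 / \<xi>)"
    using muckenhoupt_Hoelder by blast
  show ?thesis
  proof (rule that)
    show "1 \<le> max 1 (C powr \<xi>)" by simp
    fix k K :: int assume kK: "k \<le> K"
    have "w K epowr (1 / \<xi>) * (\<integral>\<^sup>+x\<in>dyadic_ball K. indicator (dyadic_ball k) (x::real^'n) \<partial>lebesgue)
         \<le> ennreal (C * dyadic_vol TYPE('n) K) * (\<integral>\<^sup>+x\<in>dyadic_ball K. indicator (dyadic_ball k) x epowr \<xi> * ennreal (\<omega> x) \<partial>lebesgue) epowr (1 / \<xi>)"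
      by (rule C(2)[of "indicator (dyadic_ball k)" K]) measurable
    also have "(\<integral>\<^sup>+x\<in>dyadic_ball K. indicator (dyadic_ball k) (x::real^'n) \<partial>lebesgue)
        = (\<integral>\<^sup>+x. indicator (dyadic_ball k) (x::real^'n) \<partial>lebesgue)"
      using dyadic_ball_mono[OF kK] by (intro nn_integral_cong) (auto split: split_indicator)
    also have "\<dots> = ennreal (dyadic_vol TYPE('n) k)" by (simp add: emeasure_dyadic_ball)
    also have "(\<integral>\<^sup>+x\<in>dyadic_ball K. indicator (dyadic_ball k) x epowr \<xi> * ennreal (\<omega> x) \<partial>lebesgue) = w k"
      unfolding wmeas_def using dyadic_ball_mono[OF kK] \<xi>
      by (intro nn_integral_cong) (auto simp: zero_epowr split: split_indicator)
    finally have "W K powr (1 / \<xi>) * dyadic_vol TYPE('n) k \<le> C * dyadic_vol TYPE('n) K * W k powr (1 / \<xi>)"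
      using C by (simp add: w_epowr flip: ennreal_mult)
    then have "W K powr (1 / \<xi>) \<le> C * (dyadic_vol TYPE('n) K / dyadic_vol TYPE('n) k) * W k powr (1 / \<xi>)"
      by (simp add: field_simps)
    then have "(W K powr (1 / \<xi>)) powr \<xi> \<le> (C * (dyadic_vol TYPE('n) K / dyadic_vol TYPE('n) k) * W k powr (1 / \<xi>)) powr \<xi>"
      using \<xi> by (intro powr_mono2) auto
    also have "\<dots> = C powr \<xi> * 2 powr (real CARD('n) * \<xi> * real_of_int (K - k)) * W k"
      using C \<xi> by (simp add: dyadic_vol_divide powr_mult powr_powr mult_ac)
    also have "\<dots> \<le> max 1 (C powr \<xi>) * 2 powr (real CARD('n) * \<xi> * real_of_int (K - k)) * W k"
      by (intro mult_right_mono) (auto simp: less_imp_le)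
    finally show "W K \<le> max 1 (C powr \<xi>) * 2 powr (real CARD('n) * \<xi> * real_of_int (K - k)) * W k"
      using \<xi> by (simp add: powr_powr)
  qed
qed

text \<open>The same test function in \<open>reverse_Hoelder\<close> bounds the ratio of masses by
  the \<theta>-th power of the ratio of volumes, up to a constant.\<close>

lemma W_lower:
  assumes s: "1 < s" and rh: "\<omega> \<in> reverse_hoelder s" and \<theta>: "0 < \<theta>" "\<theta> \<le> 1 - 1 / s"
  obtains C where "1 \<le> C" "\<And>k K. k \<le> K \<Longrightarrow> W k \<le> C * 2 powr (real CARD('n) * \<theta> * real_of_int (k - K)) * W K"
proof -
  obtain C :: real where C: "0 < C"
    "\<And>k F. F \<in> borel_measurable lebesgue \<Longrightarrow>
       ennreal (dyadic_vol TYPE('n) k) epowr \<theta> * (\<integral>\<^sup>+x\<in>dyadic_ball k. F x * ennreal (\<omega> x) \<partial>lebesgue)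
         \<le> ennreal C * w k * (\<integral>\<^sup>+x\<in>dyadic_ball k. F x epowr (1 / \<theta>) \<partial>lebesgue) epowr \<theta>"
    using reverse_Hoelder[OF assms] by blast
  show ?thesis
  proof (rule that)
    show "1 \<le> max 1 C" by simp
    fix k K :: int assume kK: "k \<le> K"
    have "ennreal (dyadic_vol TYPE('n) K) epowr \<theta> * (\<integral>\<^sup>+x\<in>dyadic_ball K. indicator (dyadic_ball k) x * ennreal (\<omega> x) \<partial>lebesgue)
         \<le> ennreal C * w K * (\<integral>\<^sup>+x\<in>dyadic_ball K. indicator (dyadic_ball k) (x::real^'n) epowr (1 / \<theta>) \<partial>lebesgue) epowr \<theta>"
      by (rule C(2)[of "indicator (dyadic_ball k)" K]) measurable
    also have "(\<integral>\<^sup>+x\<in>dyadic_ball K. indicator (dyadic_ball k) (x::real^'n) epowr (1 / \<theta>) \<partial>lebesgue)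
        = (\<integral>\<^sup>+x. indicator (dyadic_ball k) (x::real^'n) \<partial>lebesgue)"
      using dyadic_ball_mono[OF kK] \<theta> by (intro nn_integral_cong) (auto simp: zero_epowr split: split_indicator)
    also have "\<dots> = ennreal (dyadic_vol TYPE('n) k)" by (simp add: emeasure_dyadic_ball)
    also have "(\<integral>\<^sup>+x\<in>dyadic_ball K. indicator (dyadic_ball k) x * ennreal (\<omega> x) \<partial>lebesgue) = w k"
      unfolding wmeas_def using dyadic_ball_mono[OF kK]
      by (intro nn_integral_cong) (auto split: split_indicator)
    finally have "dyadic_vol TYPE('n) K powr \<theta> * W k \<le> C * W K * dyadic_vol TYPE('n) k powr \<theta>"
      using C by (simp add: w_eq ennreal_epowr less_imp_le flip: ennreal_mult)
    then have "W k \<le> C * (dyadic_vol TYPE('n) k powr \<theta> / dyadic_vol TYPE('n) K powr \<theta>) * W K"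
      by (simp add: field_simps)
    also have "dyadic_vol TYPE('n) k powr \<theta> / dyadic_vol TYPE('n) K powr \<theta> = 2 powr (real CARD('n) * \<theta> * real_of_int (k - K))"
      by (simp add: powr_divide[symmetric] dyadic_vol_divide powr_powr mult_ac)
    also have "C * 2 powr (real CARD('n) * \<theta> * real_of_int (k - K)) * W K \<le> max 1 C * 2 powr (real CARD('n) * \<theta> * real_of_int (k - K)) * W K"
      by (intro mult_right_mono) (auto simp: less_imp_le)
    finally show "W k \<le> max 1 C * 2 powr (real CARD('n) * \<theta> * real_of_int (k - K)) * W K" .
  qed
qed

end

section \<open>Morrey-Herz norms\<close>

text \<open>The argument is extended nonnegative, so that the norm can be taken of the y-integral of
  the absolute value of the integrand before that integral is known to be finite.\<close>

definition wLq :: "(real^'n \<Rightarrow> real) \<Rightarrow> real \<Rightarrow> (real^'n) set \<Rightarrow> (real^'n \<Rightarrow> ennreal) \<Rightarrow> ennreal" where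
  "wLq \<omega> q E F = (\<integral>\<^sup>+x\<in>E. F x epowr q * ennreal (\<omega> x) \<partial>lebesgue) epowr (1 / q)"

text \<open>The mass factor stands inside the p-th power. This makes the expression an \<ell>^p norm
  for counting measure, to which Hoelder and Minkowski apply directly.\<close>

definition mh_partial ::
    "(real^'n \<Rightarrow> real) \<Rightarrow> real \<Rightarrow> real \<Rightarrow> real \<Rightarrow> (real^'n \<Rightarrow> ennreal) \<Rightarrow> int \<Rightarrow> ennreal" where
  "mh_partial \<omega> \<alpha> p q F k0 =
     (\<integral>\<^sup>+k. (wmeas \<omega> (dyadic_ball k) epowr (\<alpha> / real CARD('n)) * wLq \<omega> q (dyadic_shell k) F) epowr p
        \<partial>count_space {..k0}) epowr (1 / p)"

definition mh_norm ::
    "(real^'n \<Rightarrow> real) \<Rightarrow> real \<Rightarrow> real \<Rightarrow> real \<Rightarrow> real \<Rightarrow> (real^'n \<Rightarrow> ennreal) \<Rightarrow> ennreal" where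
  "mh_norm \<omega> \<alpha> l p q F =
     (SUP k0. wmeas \<omega> (dyadic_ball k0) epowr (- l / real CARD('n)) * mh_partial \<omega> \<alpha> p q F k0)"

section \<open>Dyadic decomposition and weighted norms on sets\<close>

lemma ex_dyadic:
  assumes "0 < r"
  obtains k :: int where "2 powr (real_of_int k - 1) < r" "r \<le> 2 powr real_of_int k"
proof
  have "log 2 r \<le> real_of_int \<lceil>log 2 r\<rceil>" "real_of_int \<lceil>log 2 r\<rceil> - 1 < log 2 r"
    by linarith+
  then show "2 powr (real_of_int \<lceil>log 2 r\<rceil> - 1) < r" "r \<le> 2 powr real_of_int \<lceil>log 2 r\<rceil>"
    using assms log_le_iff[of 2 r "real_of_int \<lceil>log 2 r\<rceil>"] less_log_iff[of 2 r "real_of_int \<lceil>log 2 r\<rceil> - 1"]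
    by auto
qed

lemma in_dyadic_ball_iff: "x \<in> dyadic_ball k \<longleftrightarrow> norm x \<le> 2 powr real_of_int k"
  by (simp add: dyadic_ball_def powr_real_of_int')

lemma ex_dyadic_shell:
  assumes "x \<noteq> (0 :: real^'n)"
  obtains k where "x \<in> dyadic_shell k"
proof -
  obtain k :: int where "2 powr (real_of_int k - 1) < norm x" "norm x \<le> 2 powr real_of_int k"
    using ex_dyadic[of "norm x"] assms by auto
  then show ?thesis
    by (intro that[of k]) (auto simp: dyadic_shell_def in_dyadic_ball_iff)
qed

lemma dyadic_shell_le:
  assumes "x \<in> dyadic_shell k" "x \<in> dyadic_ball K"
  shows "k \<le> K"
  using assms dyadic_ball_mono[of K "k - 1"] by (force simp: dyadic_shell_def)

lemma wLq_mono_AE: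
  assumes "0 < q" "AE x in lebesgue. x \<in> E \<longrightarrow> F x \<le> G x"
  shows "wLq \<omega> q E F \<le> wLq \<omega> q E G"
  unfolding wLq_def using assms
  by (intro epowr_mono nn_integral_mono_AE)
    (auto elim!: eventually_mono intro!: mult_right_mono epowr_mono split: split_indicator)

lemma wLq_cmult:
  assumes "0 < q" and [measurable]: "F \<in> borel_measurable lebesgue" "\<omega> \<in> borel_measurable lebesgue" "E \<in> sets lebesgue"
  shows "wLq \<omega> q E (\<lambda>x. c * F x) = c * wLq \<omega> q E F"
proof -
  have "(\<integral>\<^sup>+x\<in>E. (c * F x) epowr q * ennreal (\<omega> x) \<partial>lebesgue)
      = (\<integral>\<^sup>+x. c epowr q * (F x epowr q * ennreal (\<omega> x) * indicator E x) \<partial>lebesgue)"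
    using assms(1) by (simp add: epowr_mult mult.assoc)
  also have "\<dots> = c epowr q * (\<integral>\<^sup>+x\<in>E. F x epowr q * ennreal (\<omega> x) \<partial>lebesgue)"
    by (rule nn_integral_cmult) measurable
  finally show ?thesis
    using assms(1) by (simp add: wLq_def epowr_mult epowr_epowr)
qed

lemma wLq_Minkowski:
  assumes N: "sigma_finite_measure N" and q: "1 \<le> q"
    and [measurable]: "(\<lambda>(x, y). F x y) \<in> borel_measurable (lebesgue \<Otimes>\<^sub>M N)"
      "\<omega> \<in> borel_measurable lebesgue" "E \<in> sets lebesgue"
  shows "wLq \<omega> q E (\<lambda>x. \<integral>\<^sup>+y. F x y \<partial>N) \<le> (\<integral>\<^sup>+y. wLq \<omega> q E (\<lambda>x. F x y) \<partial>N)"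
proof -
  interpret N: sigma_finite_measure N by fact
  \<comment> \<open>Absorbing the weight and the set into the integrand turns the weighted norm into
    a plain Lebesgue norm, as Minkowski's inequality requires.\<close>
  have eq: "wLq \<omega> q E G = (\<integral>\<^sup>+x. (ennreal (\<omega> x) epowr (1 / q) * indicator E x * G x) epowr q \<partial>lebesgue) epowr (1 / q)" for G
    unfolding wLq_def using q
    by (intro arg_cong[where f="\<lambda>t. t epowr (1 / q)"] nn_integral_cong)
      (auto simp: epowr_mult epowr_epowr mult_ac zero_epowr split: split_indicator)
  have "wLq \<omega> q E (\<lambda>x. \<integral>\<^sup>+y. F x y \<partial>N)
      = (\<integral>\<^sup>+x. (\<integral>\<^sup>+y. ennreal (\<omega> x) epowr (1 / q) * indicator E x * F x y \<partial>N) epowr q \<partial>lebesgue) epowr (1 / q)"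
    unfolding eq
  proof (intro arg_cong[where f="\<lambda>t. t epowr (1 / q)"] nn_integral_cong)
    fix x
    have [measurable]: "(\<lambda>y. F x y) \<in> borel_measurable N"
      using measurable_compose[OF measurable_Pair1' assms(3), of x] by simp
    show "(ennreal (\<omega> x) epowr (1 / q) * indicator E x * (\<integral>\<^sup>+y. F x y \<partial>N)) epowr q
        = (\<integral>\<^sup>+y. ennreal (\<omega> x) epowr (1 / q) * indicator E x * F x y \<partial>N) epowr q"
      by (simp add: nn_integral_cmult)
  qed
  also have "\<dots> \<le> (\<integral>\<^sup>+y. wLq \<omega> q E (\<lambda>x. F x y) \<partial>N)"
    unfolding eq by (rule nn_integral_Minkowski) (use sigma_finite_lebesgue N q in auto)
  finally show ?thesis .
qed

lemma borel_measurable_pair_count_space: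
  assumes "\<And>j :: 'b::countable. (\<lambda>x. f x j) \<in> borel_measurable M"
  shows "(\<lambda>(x, j). f x j) \<in> borel_measurable (M \<Otimes>\<^sub>M count_space UNIV)"
proof -
  have "(\<lambda>z. f (fst z) j) \<in> borel_measurable (M \<Otimes>\<^sub>M count_space UNIV)" for j
    by (rule measurable_compose[OF measurable_fst assms])
  then have "(\<lambda>z. f (fst z) (snd z)) \<in> borel_measurable (M \<Otimes>\<^sub>M count_space UNIV)"
    by (rule measurable_compose_countable) measurable
  then show ?thesis
    by (simp add: split_beta')
qed

lemma sigma_finite_count_space_countable_type:
  "sigma_finite_measure (count_space (A :: 'a::countable set))"
  by (rule sigma_finite_measure_count_space_countable) auto

lemma nn_integral_count_space_shift:
  "(\<integral>\<^sup>+k. f (k + j) \<partial>count_space {..k0}) = (\<integral>\<^sup>+k. f k \<partial>count_space {..k0 + j :: int})"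
  by (rule nn_integral_bij_count_space)
    (auto intro!: bij_betwI[where g="\<lambda>k. k - j"])

lemma nn_integral_count_space_geometric:
  assumes "0 \<le> r" "r < 1"
  shows "(\<integral>\<^sup>+j. ennreal (r ^ j) \<partial>count_space UNIV) = ennreal (1 / (1 - r))"
  using assms
  by (simp add: nn_integral_count_space_nat suminf_ennreal2 summable_geometric suminf_geometric)

section \<open>Sums over balls and ratios of masses under a reverse Hoelder inequality\<close>

locale rh_weight = muckenhoupt_weight \<omega> \<xi> for \<omega> :: "real^'n \<Rightarrow> real" and \<xi> +
  fixes s :: real
  assumes s: "1 < s" and rh: "\<omega> \<in> reverse_hoelder s"
begin

lemma mh_partial_le_mh_norm: "mh_partial \<omega> \<alpha> p q F k \<le> ennreal (W k powr (l / real CARD('n))) * mh_norm \<omega> \<alpha> l p q F"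
proof -
  have "w k epowr (- l / real CARD('n)) * mh_partial \<omega> \<alpha> p q F k \<le> mh_norm \<omega> \<alpha> l p q F"
    unfolding mh_norm_def by (rule SUP_upper) simp
  then have "ennreal (W k powr (l / real CARD('n))) * (w k epowr (- l / real CARD('n)) * mh_partial \<omega> \<alpha> p q F k)
      \<le> ennreal (W k powr (l / real CARD('n))) * mh_norm \<omega> \<alpha> l p q F"
    by (rule mult_left_mono) simp
  then show ?thesis
    by (simp add: w_epowr mult.assoc[symmetric] powr_add[symmetric] flip: ennreal_mult)
qed

text \<open>Negativity of \<open>\<alpha>\<close> enters here: it turns the sum over the shells inside a ball into
  a convergent geometric series.\<close>

lemma ball_sum_le_mh_norm:
  assumes \<alpha>: "\<alpha> < 0" and l: "0 \<le> l" and p: "1 \<le> p" and q: "1 \<le> q"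
  obtains C :: real where "0 \<le> C" "\<And>F k0. F \<in> borel_measurable lebesgue \<Longrightarrow>
    (\<integral>\<^sup>+k. (w k epowr (\<alpha> / real CARD('n)) * wLq \<omega> q (dyadic_ball k) F) epowr p \<partial>count_space {..k0}) epowr (1 / p)
      \<le> ennreal (C * W k0 powr (l / real CARD('n))) * mh_norm \<omega> \<alpha> l p q F"
proof -
  define \<theta> where "\<theta> = 1 - 1 / s"
  define n where "n = real CARD('n)"
  have n: "0 < n" by (simp add: n_def)
  have \<theta>: "0 < \<theta>" using s by (simp add: \<theta>_def)
  obtain C where C: "1 \<le> C" "\<And>k K. k \<le> K \<Longrightarrow> W k \<le> C * 2 powr (n * \<theta> * real_of_int (k - K)) * W K"
    using W_lower[OF s rh \<theta>] unfolding \<theta>_def n_def by auto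
  \<comment> \<open>Raising \<open>W_lower\<close> to the negative power \<alpha>/n reverses it: D
    comes from its constant, and \<rho> = 2^(\<theta> \<alpha>) < 1 from the gain 2^(-n \<theta>)
    per dyadic step.\<close>
  define D where "D = C powr (- \<alpha> / n)"
  define \<rho> where "\<rho> = 2 powr (\<theta> * \<alpha>)"
  have D: "0 < D" using C by (simp add: D_def)
  have \<rho>: "0 < \<rho>" "\<rho> < 1"
    using \<alpha> \<theta> by (auto simp: \<rho>_def mult_less_0_iff powr_less_one)
  have Wj: "W K powr (\<alpha> / n) \<le> D * \<rho> ^ j * W (K - int j) powr (\<alpha> / n)" for K j
  proof -
    have "W (K - int j) \<le> C * 2 powr (n * \<theta> * real_of_int (K - int j - K)) * W K"
      by (rule C) simp
    then have "W (K - int j) / (C * 2 powr (- n * \<theta> * real j)) \<le> W K"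
      using C by (simp add: field_simps)
    then have "W K powr (\<alpha> / n) \<le> (W (K - int j) / (C * 2 powr (- n * \<theta> * real j))) powr (\<alpha> / n)"
      using \<alpha> n C by (intro powr_mono2') (auto simp: divide_nonpos_pos)
    also have "\<dots> = W (K - int j) powr (\<alpha> / n) / (C powr (\<alpha> / n) * (2 powr (- n * \<theta> * real j)) powr (\<alpha> / n))"
      using C by (simp add: powr_divide powr_mult)
    also have "\<dots> = D * (1 / (2 powr (- n * \<theta> * real j)) powr (\<alpha> / n)) * W (K - int j) powr (\<alpha> / n)"
      by (simp add: D_def powr_minus field_simps)
    also have "1 / (2 powr (- n * \<theta> * real j)) powr (\<alpha> / n) = \<rho> ^ j"
      using n by (simp add: \<rho>_def powr_powr powr_minus_divide[symmetric] powr_realpow[symmetric] mult_ac)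
    finally show ?thesis .
  qed
  show ?thesis
  proof (rule that)
    show "0 \<le> D * (1 / (1 - \<rho>))" using D \<rho> by simp
    fix F :: "real^'n \<Rightarrow> ennreal" and k0 assume F [measurable]: "F \<in> borel_measurable lebesgue"
    let ?s = "\<lambda>k. w k epowr (\<alpha> / n) * wLq \<omega> q (dyadic_shell k) F"
    let ?S = "\<lambda>k. w k epowr (\<alpha> / n) * wLq \<omega> q (dyadic_ball k) F"
    let ?M = "mh_norm \<omega> \<alpha> l p q F"
    \<comment> \<open>A ball is, up to the origin, the union of the shells K - j; Minkowski with
      counting measure serves as the countable triangle inequality.\<close>
    have ball: "wLq \<omega> q (dyadic_ball K) F \<le> (\<integral>\<^sup>+j. wLq \<omega> q (dyadic_shell (K - int j)) F \<partial>count_space UNIV)" for K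
    proof -
      let ?G = "\<lambda>(x::real^'n) j. indicator (dyadic_shell (K - int j)) x * F x"
      have [measurable]: "(\<lambda>(x, j). ?G x j) \<in> borel_measurable (lebesgue \<Otimes>\<^sub>M count_space UNIV)"
        by (rule borel_measurable_pair_count_space) measurable
      have "AE x::real^'n in lebesgue. x \<noteq> 0"
        by (rule AE_lebesgue_neq_0)
      then have "AE x in lebesgue. x \<in> dyadic_ball K \<longrightarrow> F x \<le> (\<integral>\<^sup>+j. ?G x j \<partial>count_space UNIV)"
      proof eventually_elim
        case (elim x)
        show ?case
        proof
          assume x: "x \<in> dyadic_ball K"
          obtain k where k: "x \<in> dyadic_shell k" using ex_dyadic_shell[OF elim] .
          then have "k \<le> K" using dyadic_shell_le x by blast
          then have "k = K - int (nat (K - k))" by simp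
          then have "F x = ?G x (nat (K - k))" using k by simp
          also have "\<dots> = (\<integral>\<^sup>+j. ?G x j * indicator {nat (K - k)} j \<partial>count_space UNIV)"
            by (subst nn_integral_count_space'[of "{nat (K - k)}"]) auto
          also have "\<dots> \<le> (\<integral>\<^sup>+j. ?G x j \<partial>count_space UNIV)"
            by (rule nn_integral_mono) (auto split: split_indicator)
          finally show "F x \<le> (\<integral>\<^sup>+j. ?G x j \<partial>count_space UNIV)" .
        qed
      qed
      then have "wLq \<omega> q (dyadic_ball K) F \<le> wLq \<omega> q (dyadic_ball K) (\<lambda>x. \<integral>\<^sup>+j. ?G x j \<partial>count_space UNIV)"
        using q by (intro wLq_mono_AE) auto
      also have "\<dots> \<le> (\<integral>\<^sup>+j. wLq \<omega> q (dyadic_ball K) (\<lambda>x. ?G x j) \<partial>count_space UNIV)"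
        by (rule wLq_Minkowski) (use q sigma_finite_count_space_countable_type in auto)
      also have "\<dots> \<le> (\<integral>\<^sup>+j. wLq \<omega> q (dyadic_shell (K - int j)) F \<partial>count_space UNIV)"
        unfolding wLq_def using q
        by (intro nn_integral_mono epowr_mono) (auto simp: zero_epowr split: split_indicator)
      finally show ?thesis .
    qed
    have S: "?S K \<le> (\<integral>\<^sup>+j. ennreal (D * \<rho> ^ j) * ?s (K - int j) \<partial>count_space UNIV)" for K
    proof -
      have "?S K \<le> w K epowr (\<alpha> / n) * (\<integral>\<^sup>+j. wLq \<omega> q (dyadic_shell (K - int j)) F \<partial>count_space UNIV)"
        by (rule mult_left_mono[OF ball]) simp
      also have "\<dots> = (\<integral>\<^sup>+j. w K epowr (\<alpha> / n) * wLq \<omega> q (dyadic_shell (K - int j)) F \<partial>count_space UNIV)"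
        by (rule nn_integral_cmult[symmetric]) simp
      also have "\<dots> \<le> (\<integral>\<^sup>+j. ennreal (D * \<rho> ^ j) * ?s (K - int j) \<partial>count_space UNIV)"
      proof (rule nn_integral_mono)
        fix j
        have "w K epowr (\<alpha> / n) \<le> ennreal (D * \<rho> ^ j) * w (K - int j) epowr (\<alpha> / n)"
          using Wj[of K j] D \<rho> by (simp add: w_epowr flip: ennreal_mult)
        then show "w K epowr (\<alpha> / n) * wLq \<omega> q (dyadic_shell (K - int j)) F \<le> ennreal (D * \<rho> ^ j) * ?s (K - int j)"
          by (simp add: mult_right_mono flip: mult.assoc)
      qed
      finally show ?thesis .
    qed
    have "(\<integral>\<^sup>+k. ?S k epowr p \<partial>count_space {..k0}) epowr (1 / p)
        \<le> (\<integral>\<^sup>+k. (\<integral>\<^sup>+j. ennreal (D * \<rho> ^ j) * ?s (k - int j) \<partial>count_space UNIV) epowr p \<partial>count_space {..k0}) epowr (1 / p)"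
      using p by (intro epowr_mono nn_integral_mono S) auto
    also have "\<dots> \<le> (\<integral>\<^sup>+j. (\<integral>\<^sup>+k. (ennreal (D * \<rho> ^ j) * ?s (k - int j)) epowr p \<partial>count_space {..k0}) epowr (1 / p) \<partial>count_space UNIV)"
      by (rule nn_integral_Minkowski)
        (use p sigma_finite_count_space_countable_type in \<open>auto simp: pair_measure_countable\<close>)
    also have "\<dots> \<le> (\<integral>\<^sup>+j. ennreal (\<rho> ^ j) * (ennreal (D * W k0 powr (l / n)) * ?M) \<partial>count_space UNIV)"
    proof (rule nn_integral_mono)
      fix j :: nat
      have "(\<integral>\<^sup>+k. (ennreal (D * \<rho> ^ j) * ?s (k - int j)) epowr p \<partial>count_space {..k0}) epowr (1 / p)
          = ennreal (D * \<rho> ^ j) * (\<integral>\<^sup>+k. ?s (k + - int j) epowr p \<partial>count_space {..k0}) epowr (1 / p)"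
        using p by (simp add: epowr_mult epowr_epowr nn_integral_cmult)
      \<comment> \<open>The shifted sum is a partial sum that ends at k0 - j; its Morrey factor is
        at most that of k0 because l is nonnegative.\<close>
      also have "(\<integral>\<^sup>+k. ?s (k + - int j) epowr p \<partial>count_space {..k0}) epowr (1 / p) = mh_partial \<omega> \<alpha> p q F (k0 + - int j)"
        unfolding mh_partial_def n_def by (subst nn_integral_count_space_shift) simp
      also have "\<dots> \<le> ennreal (W (k0 + - int j) powr (l / n)) * ?M"
        unfolding n_def by (rule mh_partial_le_mh_norm)
      also have "\<dots> \<le> ennreal (W k0 powr (l / n)) * ?M"
        using l n W_mono[of "k0 + - int j" k0] by (intro mult_right_mono ennreal_leI powr_mono2) auto
      finally have "(\<integral>\<^sup>+k. (ennreal (D * \<rho> ^ j) * ?s (k - int j)) epowr p \<partial>count_space {..k0}) epowr (1 / p)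
         \<le> ennreal (D * \<rho> ^ j) * (ennreal (W k0 powr (l / n)) * ?M)"
        by (simp add: mult_left_mono)
      then show "(\<integral>\<^sup>+k. (ennreal (D * \<rho> ^ j) * ?s (k - int j)) epowr p \<partial>count_space {..k0}) epowr (1 / p)
         \<le> ennreal (\<rho> ^ j) * (ennreal (D * W k0 powr (l / n)) * ?M)"
        using D \<rho> by (simp add: ennreal_mult mult_ac)
    qed
    also have "\<dots> = ennreal (1 / (1 - \<rho>)) * (ennreal (D * W k0 powr (l / n)) * ?M)"
      using \<rho> by (simp add: nn_integral_multc nn_integral_count_space_geometric)
    also have "\<dots> = ennreal (D * (1 / (1 - \<rho>)) * W k0 powr (l / n)) * ?M"
    proof -
      have "ennreal (1 / (1 - \<rho>)) * ennreal (D * W k0 powr (l / n)) = ennreal (D * (1 / (1 - \<rho>)) * W k0 powr (l / n))"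
        using D \<rho> by (subst ennreal_mult[symmetric]) (auto simp: mult_ac)
      then show ?thesis by (simp flip: mult.assoc)
    qed
    finally show "(\<integral>\<^sup>+k. (w k epowr (\<alpha> / real CARD('n)) * wLq \<omega> q (dyadic_ball k) F) epowr p \<partial>count_space {..k0}) epowr (1 / p)
      \<le> ennreal (D * (1 / (1 - \<rho>)) * W k0 powr (l / real CARD('n))) * ?M"
      by (simp add: n_def)
  qed
qed

text \<open>Up to constants, the ratio of masses lies between 2^(n \<xi> \<kappa>) and 2^(n \<theta>
  \<kappa>) for \<kappa> \<le> 0, and between 2^(n \<theta> \<kappa>) and 2^(n \<xi> \<kappa>) for
  \<kappa> \<ge> 0. A nonnegative e needs the upper bound and a negative e the lower one, which
  explains the test \<open>(b < 1) = (0 \<le> e)\<close>.\<close>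

lemma W_ratio_powr:
  assumes \<theta>: "0 < \<theta>" "\<theta> \<le> 1 - 1 / s"
  obtains C :: real where "0 < C" "\<And>k \<kappa> b. 0 < b \<Longrightarrow> 2 powr (real_of_int \<kappa> - 1) < b \<Longrightarrow> b \<le> 2 powr real_of_int \<kappa> \<Longrightarrow>
    (W (k + \<kappa>) / W k) powr e \<le> C * b powr (real CARD('n) * e * (if (b < 1) = (0 \<le> e) then \<theta> else \<xi>))"
proof -
  define n where "n = real CARD('n)"
  obtain C1 where C1: "1 \<le> C1" "\<And>k K. k \<le> K \<Longrightarrow> W K \<le> C1 * 2 powr (n * \<xi> * real_of_int (K - k)) * W k"
    using W_upper unfolding n_def by metis
  obtain C2 where C2: "1 \<le> C2" "\<And>k K. k \<le> K \<Longrightarrow> W k \<le> C2 * 2 powr (n * \<theta> * real_of_int (k - K)) * W K"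
    using W_lower[OF s rh \<theta>] unfolding n_def by metis
  define C where "C = max C1 C2"
  have C: "1 \<le> C" "C1 \<le> C" "C2 \<le> C" using C1 by (auto simp: C_def)
  define R where "R k \<kappa> = W (k + \<kappa>) / W k" for k \<kappa>
  have R: "0 < R k \<kappa>" for k \<kappa> by (simp add: R_def)
  have up: "R k \<kappa> \<le> C * 2 powr (n * (if \<kappa> \<le> 0 then \<theta> else \<xi>) * real_of_int \<kappa>)" for k \<kappa>
  proof (cases "\<kappa> \<le> 0")
    case True
    have "W (k + \<kappa>) \<le> C2 * 2 powr (n * \<theta> * real_of_int \<kappa>) * W k"
      using C2(2)[of "k + \<kappa>" k] True by simp
    also have "\<dots> \<le> C * 2 powr (n * \<theta> * real_of_int \<kappa>) * W k"
      using C by (intro mult_right_mono) auto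
    finally show ?thesis using True by (simp add: R_def divide_le_eq)
  next
    case False
    have "W (k + \<kappa>) \<le> C1 * 2 powr (n * \<xi> * real_of_int \<kappa>) * W k"
      using C1(2)[of k "k + \<kappa>"] False by simp
    also have "\<dots> \<le> C * 2 powr (n * \<xi> * real_of_int \<kappa>) * W k"
      using C by (intro mult_right_mono) auto
    finally show ?thesis using False by (simp add: R_def divide_le_eq)
  qed
  \<comment> \<open>The lower bound is the upper bound for the reciprocal ratio, that is, for the
    step -\<kappa> from k + \<kappa>.\<close>
  have lo: "1 / (C * 2 powr (- (n * (if \<kappa> \<le> 0 then \<xi> else \<theta>) * real_of_int \<kappa>))) \<le> R k \<kappa>" for k \<kappa>
  proof -
    have "R (k + \<kappa>) (- \<kappa>) \<le> C * 2 powr (n * (if - \<kappa> \<le> 0 then \<theta> else \<xi>) * real_of_int (- \<kappa>))"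
      by (rule up)
    then have "R (k + \<kappa>) (- \<kappa>) \<le> C * 2 powr (- (n * (if \<kappa> \<le> 0 then \<xi> else \<theta>) * real_of_int \<kappa>))"
      by (cases "\<kappa> = 0") (auto split: if_splits)
    moreover have "R k \<kappa> = 1 / R (k + \<kappa>) (- \<kappa>)" by (simp add: R_def)
    ultimately show ?thesis
      using R[of "k + \<kappa>" "- \<kappa>"] by (simp add: frac_le)
  qed
  \<comment> \<open>Since b \<le> 2^\<kappa> < 2 b, replacing 2^\<kappa> by b costs at most the
    factor 2^|t|.\<close>
  have pow: "2 powr (t * real_of_int \<kappa>) \<le> 2 powr \<bar>t\<bar> * b powr t"
    if "0 < b" "2 powr (real_of_int \<kappa> - 1) < b" "b \<le> 2 powr real_of_int \<kappa>" for t b :: real and \<kappa> :: int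
  proof (cases "0 \<le> t")
    case True
    have "2 powr real_of_int \<kappa> \<le> 2 * b"
      using that(2) by (simp add: powr_diff)
    then have "(2 powr real_of_int \<kappa>) powr t \<le> (2 * b) powr t"
      using True by (intro powr_mono2) auto
    then show ?thesis
      using True that by (simp add: powr_powr powr_mult mult.commute)
  next
    case False
    have "(2 powr real_of_int \<kappa>) powr t \<le> b powr t"
      using False that by (intro powr_mono2') auto
    also have "\<dots> \<le> 2 powr \<bar>t\<bar> * b powr t"
      using mult_right_mono[of 1 "2 powr \<bar>t\<bar>" "b powr t"] by (simp add: ge_one_powr_ge_zero)
    finally show ?thesis
      by (simp add: powr_powr mult.commute)
  qed
  \<comment> \<open>\<theta> + \<xi> dominates whichever of the two exponents is selected, so E does
    not depend on b or \<kappa>.\<close>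
  define E where "E = n * \<bar>e\<bar> * (\<theta> + \<xi>)"
  have n: "0 < n" by (simp add: n_def)
  have main: "R k \<kappa> powr e \<le> C powr \<bar>e\<bar> * 2 powr (n * e * (if (\<kappa> \<le> 0) = (0 \<le> e) then \<theta> else \<xi>) * real_of_int \<kappa>)" for k \<kappa>
  proof (cases "0 \<le> e")
    case True
    have "R k \<kappa> powr e \<le> (C * 2 powr (n * (if \<kappa> \<le> 0 then \<theta> else \<xi>) * real_of_int \<kappa>)) powr e"
      using True R[of k \<kappa>] up[of k \<kappa>] by (intro powr_mono2) auto
    then show ?thesis
      using True C by (auto simp: powr_mult powr_powr mult_ac)
  next
    case False
    have "R k \<kappa> powr e \<le> (1 / (C * 2 powr (- (n * (if \<kappa> \<le> 0 then \<xi> else \<theta>) * real_of_int \<kappa>)))) powr e"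
      using False C lo[of \<kappa> k] by (intro powr_mono2') auto
    also have "\<dots> = C powr (- e) * 2 powr (n * e * (if (\<kappa> \<le> 0) = (0 \<le> e) then \<theta> else \<xi>) * real_of_int \<kappa>)"
      using False C by (auto simp: powr_mult powr_divide powr_powr powr_minus divide_simps mult_ac)
    finally show ?thesis
      using False by simp
  qed
  show ?thesis
  proof (rule that)
    show "0 < C powr \<bar>e\<bar> * 2 powr E" using C by simp
    fix k \<kappa> :: int and b :: real
    assume b: "0 < b" "2 powr (real_of_int \<kappa> - 1) < b" "b \<le> 2 powr real_of_int \<kappa>"
    let ?\<rho> = "if (b < 1) = (0 \<le> e) then \<theta> else \<xi>"
    \<comment> \<open>The tests \<kappa> \<le> 0 and b < 1 can disagree only at \<kappa> = 0, where
      both powers of 2 are 1.\<close>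
    have "2 powr (n * e * (if (\<kappa> \<le> 0) = (0 \<le> e) then \<theta> else \<xi>) * real_of_int \<kappa>) = 2 powr ((n * e * ?\<rho>) * real_of_int \<kappa>)"
    proof (cases "b < 1")
      case True
      then have "2 powr (real_of_int \<kappa> - 1) < 2 powr 0" using b by simp
      then have "real_of_int \<kappa> < 1" by (subst (asm) powr_less_cancel_iff) auto
      then have "\<kappa> \<le> 0" by linarith
      with True show ?thesis by simp
    next
      case False
      then have "2 powr 0 \<le> 2 powr real_of_int \<kappa>" using b by simp
      then have "0 \<le> real_of_int \<kappa>" by (subst (asm) powr_le_cancel_iff) auto
      then have "\<kappa> = 0 \<or> \<not> \<kappa> \<le> 0" by linarith
      with False show ?thesis by auto
    qed
    also have "\<dots> \<le> 2 powr \<bar>n * e * ?\<rho>\<bar> * b powr (n * e * ?\<rho>)"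
      by (rule pow) (use b in auto)
    also have "\<dots> \<le> 2 powr E * b powr (n * e * ?\<rho>)"
      using n \<theta> \<xi> by (intro mult_right_mono powr_mono) (auto simp: E_def abs_mult intro!: mult_left_mono)
    finally have "C powr \<bar>e\<bar> * 2 powr (n * e * (if (\<kappa> \<le> 0) = (0 \<le> e) then \<theta> else \<xi>) * real_of_int \<kappa>)
        \<le> C powr \<bar>e\<bar> * (2 powr E * b powr (n * e * ?\<rho>))"
      by (rule mult_left_mono) simp
    then show "(W (k + \<kappa>) / W k) powr e \<le> C powr \<bar>e\<bar> * 2 powr E * b powr (real CARD('n) * e * ?\<rho>)"
      using main[of k \<kappa>] by (simp add: R_def n_def mult.assoc)
  qed
qed

end

section \<open>Products of dilated functions\<close>

context rh_weight
begin

text \<open>B maps the shell k into the ball k + \<kappa>, and the change of variables contributes 1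
  / |det B|. On that ball \<open>muckenhoupt_Hoelder\<close> is used for g^(q/\<xi>), the power for
  which its weighted side becomes the L^q norm of g.\<close>

lemma muckenhoupt_Hoelder_dilated:
  obtains C :: real where "0 < C"
    "\<And>k \<kappa> q B g. 0 < q \<Longrightarrow> g \<in> borel_measurable borel \<Longrightarrow> det B \<noteq> 0 \<Longrightarrow> norm B \<le> 2 powr real_of_int \<kappa> \<Longrightarrow>
       (\<integral>\<^sup>+x\<in>dyadic_shell k. g (B *v x) epowr (q / \<xi>) \<partial>lebesgue)
         \<le> ennreal (1 / \<bar>det B\<bar> * C * dyadic_vol TYPE('n) (k + \<kappa>) * W (k + \<kappa>) powr (- 1 / \<xi>))
           * wLq \<omega> q (dyadic_ball (k + \<kappa>)) g epowr (q / \<xi>)"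
proof -
  obtain C :: real where C: "0 < C"
    "\<And>k F. F \<in> borel_measurable lebesgue \<Longrightarrow>
       w k epowr (1 / \<xi>) * (\<integral>\<^sup>+x\<in>dyadic_ball k. F x \<partial>lebesgue)
         \<le> ennreal (C * dyadic_vol TYPE('n) k) * (\<integral>\<^sup>+x\<in>dyadic_ball k. F x epowr \<xi> * ennreal (\<omega> x) \<partial>lebesgue) epowr (1 / \<xi>)"
    using muckenhoupt_Hoelder by blast
  show ?thesis
  proof (rule that)
    show "0 < C" by fact
    fix k \<kappa> :: int and q :: real and B :: "real^'n^'n" and g :: "real^'n \<Rightarrow> ennreal"
    assume q: "0 < q" and g [measurable]: "g \<in> borel_measurable borel" and B: "det B \<noteq> 0"
      and \<kappa>: "norm B \<le> 2 powr real_of_int \<kappa>"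
    let ?K = "k + \<kappa>"
    let ?J = "\<integral>\<^sup>+x\<in>dyadic_ball ?K. g x epowr (q / \<xi>) \<partial>lebesgue"
    have [measurable]: "g \<in> borel_measurable lebesgue"
      by (rule measurable_completion) simp
    have "(\<integral>\<^sup>+x\<in>dyadic_shell k. g (B *v x) epowr (q / \<xi>) \<partial>lebesgue)
        \<le> (\<integral>\<^sup>+x. g (B *v x) epowr (q / \<xi>) * indicator (dyadic_ball ?K) (B *v x) \<partial>lebesgue)"
    proof (rule nn_integral_mono)
      fix x
      have "B *v x \<in> dyadic_ball ?K" if "x \<in> dyadic_shell k"
      proof -
        have "norm (B *v x) \<le> norm B * norm x" by (rule norm_matrix_vector_mult_le)
        also have "\<dots> \<le> 2 powr real_of_int \<kappa> * 2 powr real_of_int k"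
          using that \<kappa> by (intro mult_mono) (auto simp: dyadic_shell_def in_dyadic_ball_iff)
        finally show ?thesis by (simp add: in_dyadic_ball_iff powr_add mult.commute)
      qed
      then show "g (B *v x) epowr (q / \<xi>) * indicator (dyadic_shell k) x
          \<le> g (B *v x) epowr (q / \<xi>) * indicator (dyadic_ball ?K) (B *v x)"
        by (auto split: split_indicator)
    qed
    also have "\<dots> = ennreal (1 / \<bar>det B\<bar>) * ?J"
      by (rule nn_integral_lebesgue_linear[OF B]) measurable
    \<comment> \<open>The inserted factor 1 = W^(-1/\<xi>) W^(1/\<xi>) produces the left side of
      \<open>muckenhoupt_Hoelder\<close>.\<close>
    also have "?J = ennreal (W ?K powr (- 1 / \<xi>)) * (w ?K epowr (1 / \<xi>) * ?J)"
      by (simp add: w_epowr powr_add[symmetric] flip: mult.assoc ennreal_mult)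
    also have "w ?K epowr (1 / \<xi>) * ?J \<le> ennreal (C * dyadic_vol TYPE('n) ?K)
        * (\<integral>\<^sup>+x\<in>dyadic_ball ?K. (g x epowr (q / \<xi>)) epowr \<xi> * ennreal (\<omega> x) \<partial>lebesgue) epowr (1 / \<xi>)"
      by (rule C(2)) measurable
    also have "(\<integral>\<^sup>+x\<in>dyadic_ball ?K. (g x epowr (q / \<xi>)) epowr \<xi> * ennreal (\<omega> x) \<partial>lebesgue) epowr (1 / \<xi>)
        = wLq \<omega> q (dyadic_ball ?K) g epowr (q / \<xi>)"
      using q \<xi> by (simp add: wLq_def epowr_epowr)
    finally have "(\<integral>\<^sup>+x\<in>dyadic_shell k. g (B *v x) epowr (q / \<xi>) \<partial>lebesgue)
       \<le> ennreal (1 / \<bar>det B\<bar>) * (ennreal (W ?K powr (- 1 / \<xi>)) * (ennreal (C * dyadic_vol TYPE('n) ?K)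
           * wLq \<omega> q (dyadic_ball ?K) g epowr (q / \<xi>)))"
      by (simp add: mult_left_mono)
    also have "\<dots> = ennreal (1 / \<bar>det B\<bar> * C * dyadic_vol TYPE('n) ?K * W ?K powr (- 1 / \<xi>))
           * wLq \<omega> q (dyadic_ball ?K) g epowr (q / \<xi>)"
    proof -
      have "ennreal (1 / \<bar>det B\<bar>) * ennreal (W ?K powr (- 1 / \<xi>)) * ennreal (C * dyadic_vol TYPE('n) ?K)
          = ennreal (1 / \<bar>det B\<bar> * C * dyadic_vol TYPE('n) ?K * W ?K powr (- 1 / \<xi>))"
        using C(1) by (simp add: mult_ac flip: ennreal_mult)
      then show ?thesis by (simp flip: mult.assoc)
    qed
    finally show "(\<integral>\<^sup>+x\<in>dyadic_shell k. g (B *v x) epowr (q / \<xi>) \<partial>lebesgue)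
         \<le> ennreal (1 / \<bar>det B\<bar> * C * dyadic_vol TYPE('n) ?K * W ?K powr (- 1 / \<xi>))
           * wLq \<omega> q (dyadic_ball ?K) g epowr (q / \<xi>)" .
  qed
qed

text \<open>With \<theta> = qstar \<xi> / q, \<open>reverse_Hoelder\<close> takes the qstar-th power
  of the product to the unweighted power qstar / \<theta> = q / \<xi>. Hoelder with the exponents q
  / Q i then separates the factors into unweighted powers Q i / \<xi>, the form that
  \<open>muckenhoupt_Hoelder_dilated\<close> treats. The volumes produced at both ends
  cancel.\<close>

lemma wLq_prod_linear:
  fixes Q :: "'i \<Rightarrow> real" and q qstar :: real
  assumes I: "finite I" and Q: "\<And>i. i \<in> I \<Longrightarrow> 0 < Q i" "(\<Sum>i\<in>I. 1 / Q i) = 1 / q"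
    and q: "0 < q" "0 < qstar" "qstar * \<xi> / q \<le> 1 - 1 / s"
  obtains C :: real where "0 < C"
    "\<And>k g B \<kappa>. (\<And>i. i \<in> I \<Longrightarrow> g i \<in> borel_measurable borel) \<Longrightarrow>
      (\<And>i. i \<in> I \<Longrightarrow> det (B i) \<noteq> 0) \<Longrightarrow> (\<And>i. i \<in> I \<Longrightarrow> norm (B i) \<le> 2 powr real_of_int (\<kappa> i)) \<Longrightarrow>
      wLq \<omega> qstar (dyadic_shell k) (\<lambda>x. \<Prod>i\<in>I. g i (B i *v x))
        \<le> ennreal (C * W k powr (1 / qstar)) *
          (\<Prod>i\<in>I. ennreal ((1 / \<bar>det (B i)\<bar>) powr (\<xi> / Q i) * 2 powr (real CARD('n) * real_of_int (\<kappa> i) * (\<xi> / Q i))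
               * W (k + \<kappa> i) powr (- 1 / Q i))
             * wLq \<omega> (Q i) (dyadic_ball (k + \<kappa> i)) (g i))"
proof -
  define \<theta> where "\<theta> = qstar * \<xi> / q"
  have \<theta>: "0 < \<theta>" "\<theta> \<le> 1 - 1 / s" using q \<xi> by (auto simp: \<theta>_def)
  obtain C1 :: real where C1: "0 < C1"
    "\<And>k F. F \<in> borel_measurable lebesgue \<Longrightarrow>
       ennreal (dyadic_vol TYPE('n) k) epowr \<theta> * (\<integral>\<^sup>+x\<in>dyadic_ball k. F x * ennreal (\<omega> x) \<partial>lebesgue)
         \<le> ennreal C1 * w k * (\<integral>\<^sup>+x\<in>dyadic_ball k. F x epowr (1 / \<theta>) \<partial>lebesgue) epowr \<theta>"
    using reverse_Hoelder[OF s rh \<theta>] by blast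
  obtain C2 :: real where C2: "0 < C2"
    "\<And>k \<kappa> q B g. 0 < q \<Longrightarrow> g \<in> borel_measurable borel \<Longrightarrow> det B \<noteq> 0 \<Longrightarrow> norm B \<le> 2 powr real_of_int \<kappa> \<Longrightarrow>
       (\<integral>\<^sup>+x\<in>dyadic_shell k. g (B *v x) epowr (q / \<xi>) \<partial>lebesgue)
         \<le> ennreal (1 / \<bar>det B\<bar> * C2 * dyadic_vol TYPE('n) (k + \<kappa>) * W (k + \<kappa>) powr (- 1 / \<xi>))
           * wLq \<omega> q (dyadic_ball (k + \<kappa>)) g epowr (q / \<xi>)"
    using muckenhoupt_Hoelder_dilated by blast
  show ?thesis
  proof (rule that)
    show "0 < C1 powr (1 / qstar) * (\<Prod>i\<in>I. C2 powr (\<xi> / Q i))"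
      using C1 C2 by (simp add: prod_pos)
    fix k and g :: "'i \<Rightarrow> real^'n \<Rightarrow> ennreal" and B :: "'i \<Rightarrow> real^'n^'n" and \<kappa> :: "'i \<Rightarrow> int"
    assume g: "\<And>i. i \<in> I \<Longrightarrow> g i \<in> borel_measurable borel"
      and B: "\<And>i. i \<in> I \<Longrightarrow> det (B i) \<noteq> 0" "\<And>i. i \<in> I \<Longrightarrow> norm (B i) \<le> 2 powr real_of_int (\<kappa> i)"
    let ?v = "\<lambda>k. dyadic_vol TYPE('n) k"
    let ?G = "\<lambda>x. \<Prod>i\<in>I. g i (B i *v x)"
    let ?L = "\<lambda>i. \<integral>\<^sup>+x\<in>dyadic_shell k. g i (B i *v x) epowr (Q i / \<xi>) \<partial>lebesgue"
    let ?J = "\<integral>\<^sup>+x\<in>dyadic_shell k. ?G x epowr (q / \<xi>) \<partial>lebesgue"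
    let ?N = "\<lambda>i. wLq \<omega> (Q i) (dyadic_ball (k + \<kappa> i)) (g i)"
    have gB [measurable]: "(\<lambda>x. g i (B i *v x)) \<in> borel_measurable lebesgue" if "i \<in> I" for i
      using measurable_compose[OF borel_measurable_matrix_vector_mult g[OF that]]
      by (intro measurable_completion) simp
    have G [measurable]: "?G \<in> borel_measurable lebesgue"
      by (rule borel_measurable_prod_ennreal) (rule gB)
    have I0: "I \<noteq> {}" using Q q by auto
    have "ennreal (?v k) epowr \<theta> * (\<integral>\<^sup>+x\<in>dyadic_ball k. (indicator (dyadic_shell k) x * ?G x epowr qstar) * ennreal (\<omega> x) \<partial>lebesgue)
         \<le> ennreal C1 * w k * (\<integral>\<^sup>+x\<in>dyadic_ball k. (indicator (dyadic_shell k) x * ?G x epowr qstar) epowr (1 / \<theta>) \<partial>lebesgue) epowr \<theta>"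
      by (rule C1(2)) measurable
    also have "(\<integral>\<^sup>+x\<in>dyadic_ball k. (indicator (dyadic_shell k) x * ?G x epowr qstar) epowr (1 / \<theta>) \<partial>lebesgue) = ?J"
    proof (rule nn_integral_cong)
      fix x
      have "qstar / \<theta> = q / \<xi>" using q \<xi> by (simp add: \<theta>_def)
      then show "(indicator (dyadic_shell k) x * ?G x epowr qstar) epowr (1 / \<theta>) * indicator (dyadic_ball k) x
          = ?G x epowr (q / \<xi>) * indicator (dyadic_shell k) x"
        using \<theta>(1) by (auto simp: zero_epowr epowr_epowr dyadic_shell_def split: split_indicator)
    qed
    also have "(\<integral>\<^sup>+x\<in>dyadic_ball k. (indicator (dyadic_shell k) x * ?G x epowr qstar) * ennreal (\<omega> x) \<partial>lebesgue)
        = (\<integral>\<^sup>+x\<in>dyadic_shell k. ?G x epowr qstar * ennreal (\<omega> x) \<partial>lebesgue)"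
      by (intro nn_integral_cong) (auto simp: dyadic_shell_def split: split_indicator)
    finally have "(ennreal (?v k) epowr \<theta> * (\<integral>\<^sup>+x\<in>dyadic_shell k. ?G x epowr qstar * ennreal (\<omega> x) \<partial>lebesgue)) epowr (1 / qstar)
        \<le> (ennreal C1 * w k * ?J epowr \<theta>) epowr (1 / qstar)"
      using q by (intro epowr_mono) auto
    then have 1: "ennreal (?v k) epowr (\<xi> / q) * wLq \<omega> qstar (dyadic_shell k) ?G
        \<le> ennreal (C1 powr (1 / qstar) * W k powr (1 / qstar)) * ?J epowr (\<xi> / q)"
      using q C1(1) by (simp add: wLq_def epowr_mult epowr_epowr \<theta>_def w_epowr ennreal_epowr powr_powr flip: ennreal_mult)
    have "?J \<le> (\<integral>\<^sup>+x. (\<Prod>i\<in>I. (g i (B i *v x) epowr (Q i / \<xi>) * indicator (dyadic_shell k) x) epowr (q / Q i)) \<partial>lebesgue)"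
    proof (rule nn_integral_mono)
      fix x
      have "?G x epowr (q / \<xi>) = (\<Prod>i\<in>I. (g i (B i *v x) epowr (Q i / \<xi>)) epowr (q / Q i))"
      proof (subst epowr_prod)
        show "(\<Prod>i\<in>I. g i (B i *v x) epowr (q / \<xi>)) = (\<Prod>i\<in>I. (g i (B i *v x) epowr (Q i / \<xi>)) epowr (q / Q i))"
        proof (rule prod.cong[OF refl])
          fix i assume "i \<in> I"
          then have "Q i / \<xi> * (q / Q i) = q / \<xi>" using Q(1)[of i] by simp
          then show "g i (B i *v x) epowr (q / \<xi>) = (g i (B i *v x) epowr (Q i / \<xi>)) epowr (q / Q i)"
            by (simp add: epowr_epowr)
        qed
      qed (use q \<xi> in simp)
      then show "?G x epowr (q / \<xi>) * indicator (dyadic_shell k) x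
          \<le> (\<Prod>i\<in>I. (g i (B i *v x) epowr (Q i / \<xi>) * indicator (dyadic_shell k) x) epowr (q / Q i))"
        by (auto split: split_indicator)
    qed
    also have "\<dots> \<le> (\<Prod>i\<in>I. ?L i epowr (q / Q i))"
    proof (rule nn_integral_Hoelder[OF I])
      show "0 \<le> q / Q i" if "i \<in> I" for i using Q(1)[OF that] q by simp
      have "(\<Sum>i\<in>I. q / Q i) = q * (\<Sum>i\<in>I. 1 / Q i)" by (simp add: sum_distrib_left)
      then show "(\<Sum>i\<in>I. q / Q i) = 1" using Q q by simp
    qed (use gB in measurable)
    finally have "?J epowr (\<xi> / q) \<le> (\<Prod>i\<in>I. ?L i epowr (q / Q i)) epowr (\<xi> / q)"
      using q \<xi> by (intro epowr_mono) auto
    also have "\<dots> = (\<Prod>i\<in>I. ?L i epowr (\<xi> / Q i))"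
      using q \<xi> Q by (subst epowr_prod) (auto simp: epowr_epowr intro!: prod.cong)
    also have "\<dots> \<le> (\<Prod>i\<in>I. ennreal ((1 / \<bar>det (B i)\<bar>) powr (\<xi> / Q i) * C2 powr (\<xi> / Q i) *
        ?v (k + \<kappa> i) powr (\<xi> / Q i) * W (k + \<kappa> i) powr (- 1 / Q i)) * ?N i)"
    proof (rule prod_mono_ennreal)
      fix i assume i: "i \<in> I"
      have "?L i epowr (\<xi> / Q i) \<le> (ennreal (1 / \<bar>det (B i)\<bar> * C2 * ?v (k + \<kappa> i) * W (k + \<kappa> i) powr (- 1 / \<xi>))
           * ?N i epowr (Q i / \<xi>)) epowr (\<xi> / Q i)"
        using Q(1)[OF i] \<xi> i g B by (intro epowr_mono C2(2)) auto
      also have "\<dots> = ennreal ((1 / \<bar>det (B i)\<bar> * C2 * ?v (k + \<kappa> i) * W (k + \<kappa> i) powr (- 1 / \<xi>)) powr (\<xi> / Q i)) * ?N i"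
        using Q(1)[OF i] \<xi> C2(1) B(1)[OF i] by (simp add: epowr_mult epowr_epowr ennreal_epowr)
      also have "(1 / \<bar>det (B i)\<bar> * C2 * ?v (k + \<kappa> i) * W (k + \<kappa> i) powr (- 1 / \<xi>)) powr (\<xi> / Q i)
          = (1 / \<bar>det (B i)\<bar>) powr (\<xi> / Q i) * C2 powr (\<xi> / Q i) * ?v (k + \<kappa> i) powr (\<xi> / Q i) * W (k + \<kappa> i) powr (- 1 / Q i)"
        using \<xi> C2(1) by (simp add: powr_mult powr_divide powr_powr)
      finally show "?L i epowr (\<xi> / Q i) \<le> ennreal ((1 / \<bar>det (B i)\<bar>) powr (\<xi> / Q i) * C2 powr (\<xi> / Q i) *
        ?v (k + \<kappa> i) powr (\<xi> / Q i) * W (k + \<kappa> i) powr (- 1 / Q i)) * ?N i" .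
    qed
    \<comment> \<open>The volume of the ball k + \<kappa> i is that of the ball k times 2^(n
      \<kappa> i). As the 1 / Q i sum to 1 / q, the volumes of the ball k multiply to its power
      \<xi> / q, the power that the reverse Hoelder estimate has on its left.\<close>
    also have "\<dots> = (\<Prod>i\<in>I. ennreal (C2 powr (\<xi> / Q i)) * (ennreal (?v k powr (\<xi> / Q i)) *
        (ennreal ((1 / \<bar>det (B i)\<bar>) powr (\<xi> / Q i) * 2 powr (real CARD('n) * real_of_int (\<kappa> i) * (\<xi> / Q i))
               * W (k + \<kappa> i) powr (- 1 / Q i)) * ?N i)))"
    proof (rule prod.cong)
      fix i
      have "?v (k + \<kappa> i) = ?v k * 2 powr (real CARD('n) * real_of_int (\<kappa> i))"
        by (simp add: dyadic_vol_def powr_add ring_distribs)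
      then have "?v (k + \<kappa> i) powr (\<xi> / Q i) = ?v k powr (\<xi> / Q i) * 2 powr (real CARD('n) * real_of_int (\<kappa> i) * (\<xi> / Q i))"
        by (simp add: powr_mult powr_powr)
      then show "ennreal ((1 / \<bar>det (B i)\<bar>) powr (\<xi> / Q i) * C2 powr (\<xi> / Q i) *
        ?v (k + \<kappa> i) powr (\<xi> / Q i) * W (k + \<kappa> i) powr (- 1 / Q i)) * ?N i
       = ennreal (C2 powr (\<xi> / Q i)) * (ennreal (?v k powr (\<xi> / Q i)) *
        (ennreal ((1 / \<bar>det (B i)\<bar>) powr (\<xi> / Q i) * 2 powr (real CARD('n) * real_of_int (\<kappa> i) * (\<xi> / Q i))
               * W (k + \<kappa> i) powr (- 1 / Q i)) * ?N i))"
        by (simp add: ennreal_mult mult_ac)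
    qed simp
    also have "\<dots> = ennreal (\<Prod>i\<in>I. C2 powr (\<xi> / Q i)) * (ennreal (?v k) epowr (\<xi> / q) *
       (\<Prod>i\<in>I. ennreal ((1 / \<bar>det (B i)\<bar>) powr (\<xi> / Q i) * 2 powr (real CARD('n) * real_of_int (\<kappa> i) * (\<xi> / Q i))
               * W (k + \<kappa> i) powr (- 1 / Q i)) * ?N i))"
    proof -
      have "(\<Sum>i\<in>I. \<xi> / Q i) = \<xi> / q"
        using Q(2) by (metis (no_types, lifting) mult.right_neutral sum.cong sum_distrib_left times_divide_eq_right)
      then have "(\<Prod>i\<in>I. ?v k powr (\<xi> / Q i)) = ?v k powr (\<xi> / q)"
        using I by (simp add: powr_sum[symmetric])
      then show ?thesis
        by (simp add: prod.distrib prod_ennreal ennreal_epowr)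
    qed
    finally have 2: "?J epowr (\<xi> / q) \<le> ennreal (\<Prod>i\<in>I. C2 powr (\<xi> / Q i)) * (ennreal (?v k) epowr (\<xi> / q) *
       (\<Prod>i\<in>I. ennreal ((1 / \<bar>det (B i)\<bar>) powr (\<xi> / Q i) * 2 powr (real CARD('n) * real_of_int (\<kappa> i) * (\<xi> / Q i))
               * W (k + \<kappa> i) powr (- 1 / Q i)) * ?N i))" (is "_ \<le> ?c * (_ * ?P)") .
    have "ennreal (?v k) epowr (\<xi> / q) * wLq \<omega> qstar (dyadic_shell k) ?G
        \<le> ennreal (C1 powr (1 / qstar) * W k powr (1 / qstar)) * (?c * (ennreal (?v k) epowr (\<xi> / q) * ?P))"
      by (rule order.trans[OF 1 mult_left_mono[OF 2]]) simp
    also have "\<dots> = ennreal (?v k) epowr (\<xi> / q) * (ennreal (C1 powr (1 / qstar) * W k powr (1 / qstar)) * ?c * ?P)"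
      by (simp add: mult_ac)
    also have "ennreal (C1 powr (1 / qstar) * W k powr (1 / qstar)) * ?c = ennreal (C1 powr (1 / qstar) * (\<Prod>i\<in>I. C2 powr (\<xi> / Q i)) * W k powr (1 / qstar))"
      by (simp add: prod_nonneg mult_ac flip: ennreal_mult)
    finally show "wLq \<omega> qstar (dyadic_shell k) ?G
        \<le> ennreal (C1 powr (1 / qstar) * (\<Prod>i\<in>I. C2 powr (\<xi> / Q i)) * W k powr (1 / qstar)) * ?P"
      by (subst (asm) ennreal_mult_le_mult_iff) (auto simp: ennreal_epowr)
  qed
qed

text \<open>With \<open>\<gamma> = \<alpha> / n + 1 / q\<close> and \<open>\<theta> = (\<delta> - 1) / \<delta>\<close>, the \<open>m\<close>-th power of this factor is \<^const>\<open>Psi1\<close> if \<open>\<gamma> \<le> 0\<close> and \<^const>\<open>Psi2\<close> if \<open>\<gamma> > 0\<close>.\<close>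

definition dil_factor :: "real \<Rightarrow> real \<Rightarrow> real \<Rightarrow> real \<Rightarrow> real" where
  "dil_factor \<theta> \<gamma> l b =
     b powr (- real CARD('n) * \<gamma> * (if (b < 1) = (\<gamma> \<le> 0) then \<theta> else \<xi>)) * b powr (l * (if b < 1 then \<theta> else \<xi>))"

text \<open>The exponents are arranged around \<gamma> i = \<alpha> i / n + 1 / Q i. The relation
  between \<open>\<alpha>star\<close> and \<open>qstar\<close> makes the total power of W k the sum
  of the \<gamma> i, which pairs with the powers -\<gamma> i of W (k + \<kappa> i) into ratios of
  masses. What remains, W (k + \<kappa> i)^(\<alpha> i / n), is the coefficient in
  \<open>ball_sum_le_mh_norm\<close>. The Morrey factors give ratios with exponent l i / n. C is
  chosen before g, B and k0, hence is uniform in y later.\<close>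

lemma mh_partial_prod_linear:
  fixes P Q \<alpha> l :: "'i \<Rightarrow> real" and p q qstar \<alpha>star \<theta> :: real
  defines "n \<equiv> real CARD('n)"
  assumes I: "finite I" and Q: "\<And>i. i \<in> I \<Longrightarrow> 1 \<le> Q i" "(\<Sum>i\<in>I. 1 / Q i) = 1 / q"
    and P: "\<And>i. i \<in> I \<Longrightarrow> 1 \<le> P i" "(\<Sum>i\<in>I. 1 / P i) = 1 / p"
    and p: "1 \<le> p" and q: "0 < q" "0 < qstar" "qstar * \<xi> / q \<le> 1 - 1 / s"
    and \<alpha>: "\<And>i. i \<in> I \<Longrightarrow> \<alpha> i < 0" and l: "\<And>i. i \<in> I \<Longrightarrow> 0 \<le> l i"
    and \<theta>: "0 < \<theta>" "\<theta> \<le> 1 - 1 / s"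
    and star: "\<alpha>star / n + 1 / qstar = (\<Sum>i\<in>I. \<alpha> i) / n + 1 / q"
  obtains C :: real where "0 \<le> C"
    "\<And>g B k0. (\<And>i. i \<in> I \<Longrightarrow> g i \<in> borel_measurable borel) \<Longrightarrow> (\<And>i. i \<in> I \<Longrightarrow> det (B i) \<noteq> 0) \<Longrightarrow>
      w k0 epowr (- (\<Sum>i\<in>I. l i) / n) * mh_partial \<omega> \<alpha>star p qstar (\<lambda>x. \<Prod>i\<in>I. g i (B i *v x)) k0
        \<le> ennreal C * (\<Prod>i\<in>I. ennreal ((1 / \<bar>det (B i)\<bar>) powr (\<xi> / Q i) * norm (B i) powr (n * \<xi> / Q i)
             * dil_factor \<theta> (\<alpha> i / n + 1 / Q i) (l i) (norm (B i))) * mh_norm \<omega> (\<alpha> i) (l i) (P i) (Q i) (g i))"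
proof -
  have n: "0 < n" by (simp add: n_def)
  define \<gamma> where "\<gamma> i = \<alpha> i / n + 1 / Q i" for i
  obtain C1 :: real where C1: "0 < C1"
    "\<And>k g B \<kappa>. (\<And>i. i \<in> I \<Longrightarrow> g i \<in> borel_measurable borel) \<Longrightarrow>
      (\<And>i. i \<in> I \<Longrightarrow> det (B i) \<noteq> 0) \<Longrightarrow> (\<And>i. i \<in> I \<Longrightarrow> norm (B i) \<le> 2 powr real_of_int (\<kappa> i)) \<Longrightarrow>
      wLq \<omega> qstar (dyadic_shell k) (\<lambda>x. \<Prod>i\<in>I. g i (B i *v x))
        \<le> ennreal (C1 * W k powr (1 / qstar)) *
          (\<Prod>i\<in>I. ennreal ((1 / \<bar>det (B i)\<bar>) powr (\<xi> / Q i) * 2 powr (n * real_of_int (\<kappa> i) * (\<xi> / Q i))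
               * W (k + \<kappa> i) powr (- 1 / Q i))
             * wLq \<omega> (Q i) (dyadic_ball (k + \<kappa> i)) (g i))"
    unfolding n_def
  proof (rule wLq_prod_linear[OF I _ Q(2) q])
    show "0 < Q i" if "i \<in> I" for i using Q(1)[OF that] by simp
  qed blast
  \<comment> \<open>\<open>?X\<close> and \<open>?Y\<close> restate the two estimates inside the
    logic, so that choice can select one constant per index and one per exponent.\<close>
  let ?X = "\<lambda>i C::real. 0 \<le> C \<and> (\<forall>F k0. F \<in> borel_measurable lebesgue \<longrightarrow>
    (\<integral>\<^sup>+k. (w k epowr (\<alpha> i / n) * wLq \<omega> (Q i) (dyadic_ball k) F) epowr P i \<partial>count_space {..k0}) epowr (1 / P i)
      \<le> ennreal (C * W k0 powr (l i / n)) * mh_norm \<omega> (\<alpha> i) (l i) (P i) (Q i) F)"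
  have "\<forall>i\<in>I. \<exists>C. ?X i C"
  proof
    fix i assume i: "i \<in> I"
    show "\<exists>C. ?X i C"
      unfolding n_def by (rule ball_sum_le_mh_norm[OF \<alpha>[OF i] l[OF i] P(1)[OF i] Q(1)[OF i]]) blast
  qed
  from bchoice[OF this] obtain Cb where "\<forall>i\<in>I. ?X i (Cb i)" ..
  then have Cb: "\<And>i. i \<in> I \<Longrightarrow> 0 \<le> Cb i" "\<And>i F k0. i \<in> I \<Longrightarrow> F \<in> borel_measurable lebesgue \<Longrightarrow>
    (\<integral>\<^sup>+k. (w k epowr (\<alpha> i / n) * wLq \<omega> (Q i) (dyadic_ball k) F) epowr P i \<partial>count_space {..k0}) epowr (1 / P i)
      \<le> ennreal (Cb i * W k0 powr (l i / n)) * mh_norm \<omega> (\<alpha> i) (l i) (P i) (Q i) F"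
    by blast+
  let ?Y = "\<lambda>e C::real. 0 < C \<and> (\<forall>k \<kappa> b. 0 < b \<longrightarrow> 2 powr (real_of_int \<kappa> - 1) < b \<longrightarrow> b \<le> 2 powr real_of_int \<kappa> \<longrightarrow>
    (W (k + \<kappa>) / W k) powr e \<le> C * b powr (n * e * (if (b < 1) = (0 \<le> e) then \<theta> else \<xi>)))"
  have "\<forall>e. \<exists>C. ?Y e C"
  proof
    fix e
    show "\<exists>C. ?Y e C"
      unfolding n_def by (rule W_ratio_powr[OF \<theta>, of e]) blast
  qed
  from choice[OF this] obtain Cr where "\<forall>e. ?Y e (Cr e)" ..
  then have Cr: "\<And>e. 0 < Cr e" "\<And>e k \<kappa> b. 0 < b \<Longrightarrow> 2 powr (real_of_int \<kappa> - 1) < b \<Longrightarrow> b \<le> 2 powr real_of_int \<kappa> \<Longrightarrow>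
    (W (k + \<kappa>) / W k) powr e \<le> Cr e * b powr (n * e * (if (b < 1) = (0 \<le> e) then \<theta> else \<xi>))"
    by blast+
  \<comment> \<open>In this order: the mass ratio on the shells, the sum over balls, the mass ratio
    of the Morrey factors, and the replacement of 2^(\<kappa> i) by the norm of B i.\<close>
  define c where "c i = Cr (- \<gamma> i) * Cb i * Cr (l i / n) * 2 powr (n * \<xi> / Q i)" for i
  show ?thesis
  proof (rule that)
    show "0 \<le> C1 * (\<Prod>i\<in>I. c i)"
      using C1(1) Cb(1) Cr(1) by (auto simp: c_def less_imp_le intro!: mult_nonneg_nonneg prod_nonneg)
    fix g :: "'i \<Rightarrow> real^'n \<Rightarrow> ennreal" and B :: "'i \<Rightarrow> real^'n^'n" and k0
    assume g: "\<And>i. i \<in> I \<Longrightarrow> g i \<in> borel_measurable borel" and B: "\<And>i. i \<in> I \<Longrightarrow> det (B i) \<noteq> 0"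
    let ?G = "\<lambda>x. \<Prod>i\<in>I. g i (B i *v x)"
    let ?M = "\<lambda>i. mh_norm \<omega> (\<alpha> i) (l i) (P i) (Q i) (g i)"
    define b where "b i = norm (B i)" for i
    have b: "0 < b i" if "i \<in> I" for i
      using B[OF that] by (auto simp: b_def det_zero_matrix)
    have "\<forall>i\<in>I. \<exists>k::int. 2 powr (real_of_int k - 1) < b i \<and> b i \<le> 2 powr real_of_int k"
      using b ex_dyadic by metis
    then obtain \<kappa> :: "'i \<Rightarrow> int" where \<kappa>: "\<And>i. i \<in> I \<Longrightarrow> 2 powr (real_of_int (\<kappa> i) - 1) < b i"
        "\<And>i. i \<in> I \<Longrightarrow> b i \<le> 2 powr real_of_int (\<kappa> i)"
      by metis
    define d where "d i = (1 / \<bar>det (B i)\<bar>) powr (\<xi> / Q i) * 2 powr (n * real_of_int (\<kappa> i) * (\<xi> / Q i))" for i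
    define r where "r e i = (if (b i < 1) = (0 \<le> e) then \<theta> else \<xi>)" for e :: real and i
    define T where "T i = Cr (- \<gamma> i) * b i powr (n * (- \<gamma> i) * r (- \<gamma> i) i)" for i
    define U where "U i = Cr (l i / n) * b i powr (n * (l i / n) * r (l i / n) i)" for i
    have T: "(W (k + \<kappa> i) / W k) powr (- \<gamma> i) \<le> T i" if "i \<in> I" for i k
      unfolding T_def r_def by (rule Cr(2)[OF b[OF that] \<kappa>(1)[OF that] \<kappa>(2)[OF that]])
    have U: "(W (k + \<kappa> i) / W k) powr (l i / n) \<le> U i" if "i \<in> I" for i k
      unfolding U_def r_def by (rule Cr(2)[OF b[OF that] \<kappa>(1)[OF that] \<kappa>(2)[OF that]])
    have T0: "0 \<le> T i" for i
      using Cr(1)[of "- \<gamma> i"] by (simp add: T_def)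
    have d: "0 \<le> d i" for i by (simp add: d_def)
    let ?S = "\<lambda>i K. w K epowr (\<alpha> i / n) * wLq \<omega> (Q i) (dyadic_ball K) (g i)"
    have step: "w k epowr (\<alpha>star / n) * wLq \<omega> qstar (dyadic_shell k) ?G
        \<le> ennreal (C1 * (\<Prod>i\<in>I. d i * T i)) * (\<Prod>i\<in>I. ?S i (k + \<kappa> i))" for k
    proof -
      let ?N = "\<lambda>i. wLq \<omega> (Q i) (dyadic_ball (k + \<kappa> i)) (g i)"
      have "w k epowr (\<alpha>star / n) * wLq \<omega> qstar (dyadic_shell k) ?G
        \<le> w k epowr (\<alpha>star / n) * (ennreal (C1 * W k powr (1 / qstar)) *
          (\<Prod>i\<in>I. ennreal ((1 / \<bar>det (B i)\<bar>) powr (\<xi> / Q i) * 2 powr (n * real_of_int (\<kappa> i) * (\<xi> / Q i))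
               * W (k + \<kappa> i) powr (- 1 / Q i)) * ?N i))"
        using \<kappa>(2) by (intro mult_left_mono C1(2) g B) (auto simp: b_def)
      also have "\<dots> = ennreal C1 * (ennreal (W k powr (\<alpha>star / n + 1 / qstar)) * (\<Prod>i\<in>I. ennreal (d i * W (k + \<kappa> i) powr (- 1 / Q i)) * ?N i))"
      proof -
        have "w k epowr (\<alpha>star / n) * ennreal (C1 * W k powr (1 / qstar)) = ennreal C1 * ennreal (W k powr (\<alpha>star / n + 1 / qstar))"
          using C1(1) by (simp add: w_epowr powr_add mult_ac flip: ennreal_mult)
        then show ?thesis by (simp add: d_def flip: mult.assoc)
      qed
      also have "\<alpha>star / n + 1 / qstar = (\<Sum>i\<in>I. \<gamma> i)"
        unfolding star by (simp add: \<gamma>_def sum.distrib Q(2) sum_divide_distrib)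
      also have "ennreal (W k powr (\<Sum>i\<in>I. \<gamma> i)) * (\<Prod>i\<in>I. ennreal (d i * W (k + \<kappa> i) powr (- 1 / Q i)) * ?N i)
          = (\<Prod>i\<in>I. ennreal (W k powr \<gamma> i) * (ennreal (d i * W (k + \<kappa> i) powr (- 1 / Q i)) * ?N i))"
        using I by (simp add: powr_sum prod.distrib prod_ennreal)
      also have "\<dots> \<le> (\<Prod>i\<in>I. ennreal (d i * T i) * ?S i (k + \<kappa> i))"
      proof (rule prod_mono_ennreal)
        fix i assume i: "i \<in> I"
        have "W k powr \<gamma> i * (d i * W (k + \<kappa> i) powr (- 1 / Q i))
            = d i * (W (k + \<kappa> i) / W k) powr (- \<gamma> i) * W (k + \<kappa> i) powr (\<alpha> i / n)"
        proof -
          have "- 1 / Q i = - \<gamma> i + \<alpha> i / n" by (simp add: \<gamma>_def)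
          then have "W (k + \<kappa> i) powr (- 1 / Q i) = W (k + \<kappa> i) powr (- \<gamma> i) * W (k + \<kappa> i) powr (\<alpha> i / n)"
            by (simp only: powr_add)
          moreover have "(W (k + \<kappa> i) / W k) powr (- \<gamma> i) = W (k + \<kappa> i) powr (- \<gamma> i) * W k powr \<gamma> i"
            by (simp add: powr_divide powr_minus field_simps)
          ultimately show ?thesis by (simp add: mult_ac)
        qed
        also have "\<dots> \<le> d i * T i * W (k + \<kappa> i) powr (\<alpha> i / n)"
          using T[OF i] d by (intro mult_right_mono mult_left_mono) auto
        finally have "ennreal (W k powr \<gamma> i * (d i * W (k + \<kappa> i) powr (- 1 / Q i))) * ?N i
            \<le> ennreal (d i * T i * W (k + \<kappa> i) powr (\<alpha> i / n)) * ?N i"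
          by (intro mult_right_mono ennreal_leI) auto
        then show "ennreal (W k powr \<gamma> i) * (ennreal (d i * W (k + \<kappa> i) powr (- 1 / Q i)) * ?N i)
            \<le> ennreal (d i * T i) * ?S i (k + \<kappa> i)"
          using d T0[of i] by (simp add: w_epowr ennreal_mult mult.assoc)
      qed
      also have "\<dots> = ennreal (\<Prod>i\<in>I. d i * T i) * (\<Prod>i\<in>I. ?S i (k + \<kappa> i))"
        using d T0 by (simp add: prod.distrib prod_ennreal ennreal_mult prod_nonneg)
      finally show ?thesis
        using C1(1) d T0 by (simp add: ennreal_mult prod_nonneg mult_left_mono mult.assoc)
    qed
    have "mh_partial \<omega> \<alpha>star p qstar ?G k0
        \<le> (\<integral>\<^sup>+k. (ennreal (C1 * (\<Prod>i\<in>I. d i * T i)) * (\<Prod>i\<in>I. ?S i (k + \<kappa> i))) epowr p \<partial>count_space {..k0}) epowr (1 / p)"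
      unfolding mh_partial_def n_def[symmetric]
      using p by (intro epowr_mono nn_integral_mono step) auto
    also have "\<dots> = ennreal (C1 * (\<Prod>i\<in>I. d i * T i)) * (\<integral>\<^sup>+k. (\<Prod>i\<in>I. ?S i (k + \<kappa> i)) epowr p \<partial>count_space {..k0}) epowr (1 / p)"
      using p by (simp add: epowr_mult epowr_epowr nn_integral_cmult)
    \<comment> \<open>Hoelder over k with the exponents p / P i. Each factor has its own shift, so
      its sum is reindexed to end at k0 + \<kappa> i.\<close>
    also have "(\<integral>\<^sup>+k. (\<Prod>i\<in>I. ?S i (k + \<kappa> i)) epowr p \<partial>count_space {..k0}) epowr (1 / p)
        \<le> (\<Prod>i\<in>I. (\<integral>\<^sup>+k. ?S i k epowr P i \<partial>count_space {..k0 + \<kappa> i}) epowr (1 / P i))"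
    proof -
      have "(\<integral>\<^sup>+k. (\<Prod>i\<in>I. ?S i (k + \<kappa> i)) epowr p \<partial>count_space {..k0})
          = (\<integral>\<^sup>+k. (\<Prod>i\<in>I. (?S i (k + \<kappa> i) epowr P i) epowr (p / P i)) \<partial>count_space {..k0})"
      proof (rule nn_integral_cong)
        fix k
        show "(\<Prod>i\<in>I. ?S i (k + \<kappa> i)) epowr p = (\<Prod>i\<in>I. (?S i (k + \<kappa> i) epowr P i) epowr (p / P i))"
        proof (subst epowr_prod)
          show "(\<Prod>i\<in>I. ?S i (k + \<kappa> i) epowr p) = (\<Prod>i\<in>I. (?S i (k + \<kappa> i) epowr P i) epowr (p / P i))"
          proof (rule prod.cong[OF refl])
            fix i assume "i \<in> I"
            then have "P i * (p / P i) = p" using P(1)[of i] by simp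
            then show "?S i (k + \<kappa> i) epowr p = (?S i (k + \<kappa> i) epowr P i) epowr (p / P i)"
              by (simp only: epowr_epowr)
          qed
        qed (use p in simp)
      qed
      also have "\<dots> \<le> (\<Prod>i\<in>I. (\<integral>\<^sup>+k. ?S i (k + \<kappa> i) epowr P i \<partial>count_space {..k0}) epowr (p / P i))"
      proof (rule nn_integral_Hoelder[OF I])
        show "0 \<le> p / P i" if "i \<in> I" for i using P(1)[OF that] p by simp
        have "(\<Sum>i\<in>I. p / P i) = p * (\<Sum>i\<in>I. 1 / P i)" by (simp add: sum_distrib_left)
        then show "(\<Sum>i\<in>I. p / P i) = 1" using P p by simp
      qed simp
      finally have "(\<integral>\<^sup>+k. (\<Prod>i\<in>I. ?S i (k + \<kappa> i)) epowr p \<partial>count_space {..k0}) epowr (1 / p)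
          \<le> (\<Prod>i\<in>I. (\<integral>\<^sup>+k. ?S i (k + \<kappa> i) epowr P i \<partial>count_space {..k0}) epowr (p / P i)) epowr (1 / p)"
        using p by (intro epowr_mono) auto
      also have "\<dots> = (\<Prod>i\<in>I. (\<integral>\<^sup>+k. ?S i (k + \<kappa> i) epowr P i \<partial>count_space {..k0}) epowr (1 / P i))"
        using p by (subst epowr_prod) (auto simp: epowr_epowr)
      also have "\<dots> = (\<Prod>i\<in>I. (\<integral>\<^sup>+k. ?S i k epowr P i \<partial>count_space {..k0 + \<kappa> i}) epowr (1 / P i))"
        by (rule prod.cong[OF refl], subst nn_integral_count_space_shift[symmetric]) simp
      finally show ?thesis .
    qed
    also have "\<dots> \<le> (\<Prod>i\<in>I. ennreal (Cb i * W (k0 + \<kappa> i) powr (l i / n)) * ?M i)"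
    proof (rule prod_mono_ennreal)
      fix i assume i: "i \<in> I"
      show "(\<integral>\<^sup>+k. ?S i k epowr P i \<partial>count_space {..k0 + \<kappa> i}) epowr (1 / P i)
          \<le> ennreal (Cb i * W (k0 + \<kappa> i) powr (l i / n)) * ?M i"
        by (rule Cb(2)[OF i measurable_completion]) (use g[OF i] in simp)
    qed
    finally have "w k0 epowr (- (\<Sum>i\<in>I. l i) / n) * mh_partial \<omega> \<alpha>star p qstar ?G k0
       \<le> w k0 epowr (- (\<Sum>i\<in>I. l i) / n) * (ennreal (C1 * (\<Prod>i\<in>I. d i * T i)) * (\<Prod>i\<in>I. ennreal (Cb i * W (k0 + \<kappa> i) powr (l i / n)) * ?M i))"
      by (simp add: mult_left_mono)
    also have "\<dots> = ennreal C1 * (\<Prod>i\<in>I. ennreal (W k0 powr (- l i / n)) * (ennreal (d i * T i) * (ennreal (Cb i * W (k0 + \<kappa> i) powr (l i / n)) * ?M i)))"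
    proof -
      have "W k0 powr (- (\<Sum>i\<in>I. l i) / n) = (\<Prod>i\<in>I. W k0 powr (- l i / n))"
        using I by (subst powr_sum[symmetric]) (auto simp: sum_divide_distrib sum_negf)
      then have "w k0 epowr (- (\<Sum>i\<in>I. l i) / n) = (\<Prod>i\<in>I. ennreal (W k0 powr (- l i / n)))"
        by (simp add: w_epowr prod_ennreal)
      moreover have "ennreal (C1 * (\<Prod>i\<in>I. d i * T i)) = ennreal C1 * (\<Prod>i\<in>I. ennreal (d i * T i))"
        using C1(1) d T0 by (subst prod_ennreal) (auto simp: ennreal_mult prod_nonneg)
      ultimately show ?thesis by (simp add: prod.distrib mult_ac)
    qed
    also have "(\<Prod>i\<in>I. ennreal (W k0 powr (- l i / n)) * (ennreal (d i * T i) * (ennreal (Cb i * W (k0 + \<kappa> i) powr (l i / n)) * ?M i)))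
       \<le> (\<Prod>i\<in>I. ennreal (c i) * (ennreal ((1 / \<bar>det (B i)\<bar>) powr (\<xi> / Q i) * b i powr (n * \<xi> / Q i)
             * dil_factor \<theta> (\<gamma> i) (l i) (b i)) * ?M i))"
    proof (rule prod_mono_ennreal)
      fix i assume i: "i \<in> I"
      have "W k0 powr (- l i / n) * (d i * T i * (Cb i * W (k0 + \<kappa> i) powr (l i / n)))
          = d i * T i * Cb i * (W (k0 + \<kappa> i) / W k0) powr (l i / n)"
        by (simp add: powr_divide powr_minus field_simps)
      also have "\<dots> \<le> d i * T i * Cb i * U i"
        using U[OF i] d T0[of i] Cb(1)[OF i] by (intro mult_left_mono) auto
      also have "\<dots> \<le> ((1 / \<bar>det (B i)\<bar>) powr (\<xi> / Q i) * (2 powr (n * \<xi> / Q i) * b i powr (n * \<xi> / Q i))) * T i * Cb i * U i"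
      proof -
        \<comment> \<open>The factor 2 lost in rounding the norm up to a power of 2 is the origin of
          2^(n \<xi> / Q i) in c i.\<close>
        have "2 powr real_of_int (\<kappa> i) \<le> 2 * b i"
          using \<kappa>(1)[OF i] by (simp add: powr_diff)
        then have "(2 powr real_of_int (\<kappa> i)) powr (n * \<xi> / Q i) \<le> (2 * b i) powr (n * \<xi> / Q i)"
          using n \<xi> Q(1)[OF i] by (intro powr_mono2) auto
        then have "d i \<le> (1 / \<bar>det (B i)\<bar>) powr (\<xi> / Q i) * (2 powr (n * \<xi> / Q i) * b i powr (n * \<xi> / Q i))"
          using b[OF i] unfolding d_def by (intro mult_left_mono) (auto simp: powr_powr powr_mult mult_ac)
        moreover have "0 \<le> U i" unfolding U_def using Cr(1)[of "l i / n"] by simp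
        ultimately show ?thesis
          using T0[of i] Cb(1)[OF i] by (intro mult_right_mono) auto
      qed
      also have "\<dots> = c i * ((1 / \<bar>det (B i)\<bar>) powr (\<xi> / Q i) * b i powr (n * \<xi> / Q i) * dil_factor \<theta> (\<gamma> i) (l i) (b i))"
      proof -
        have r1: "n * (- \<gamma> i) * r (- \<gamma> i) i = - n * \<gamma> i * (if (b i < 1) = (\<gamma> i \<le> 0) then \<theta> else \<xi>)"
          by (simp add: r_def)
        have r2: "n * (l i / n) * r (l i / n) i = l i * (if b i < 1 then \<theta> else \<xi>)"
          using n l[OF i] by (simp add: r_def)
        show ?thesis
          unfolding c_def T_def U_def dil_factor_def n_def[symmetric] r1 r2 by (simp only: mult_ac)
      qed
      finally have "ennreal (W k0 powr (- l i / n) * (d i * T i * (Cb i * W (k0 + \<kappa> i) powr (l i / n)))) * ?M i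
          \<le> ennreal (c i * ((1 / \<bar>det (B i)\<bar>) powr (\<xi> / Q i) * b i powr (n * \<xi> / Q i) * dil_factor \<theta> (\<gamma> i) (l i) (b i))) * ?M i"
        by (intro mult_right_mono ennreal_leI) auto
      moreover have "0 \<le> c i" using Cb(1)[OF i] Cr(1) by (simp add: c_def less_imp_le)
      ultimately show "ennreal (W k0 powr (- l i / n)) * (ennreal (d i * T i) * (ennreal (Cb i * W (k0 + \<kappa> i) powr (l i / n)) * ?M i))
         \<le> ennreal (c i) * (ennreal ((1 / \<bar>det (B i)\<bar>) powr (\<xi> / Q i) * b i powr (n * \<xi> / Q i)
             * dil_factor \<theta> (\<gamma> i) (l i) (b i)) * ?M i)"
        using d T0[of i] Cb(1)[OF i] by (simp add: ennreal_mult dil_factor_def mult.assoc)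
    qed
    also have "\<dots> = ennreal (\<Prod>i\<in>I. c i) * (\<Prod>i\<in>I. ennreal ((1 / \<bar>det (B i)\<bar>) powr (\<xi> / Q i) * norm (B i) powr (n * \<xi> / Q i)
             * dil_factor \<theta> (\<alpha> i / n + 1 / Q i) (l i) (norm (B i))) * ?M i)"
      using Cb(1) Cr(1) by (simp add: prod.distrib b_def \<gamma>_def prod_ennreal c_def less_imp_le)
    finally show "w k0 epowr (- (\<Sum>i\<in>I. l i) / n) * mh_partial \<omega> \<alpha>star p qstar ?G k0
       \<le> ennreal (C1 * (\<Prod>i\<in>I. c i)) * (\<Prod>i\<in>I. ennreal ((1 / \<bar>det (B i)\<bar>) powr (\<xi> / Q i) * norm (B i) powr (n * \<xi> / Q i)
             * dil_factor \<theta> (\<alpha> i / n + 1 / Q i) (l i) (norm (B i))) * ?M i)"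
      using C1(1) Cb(1) Cr(1) by (simp add: ennreal_mult prod_nonneg c_def less_imp_le mult_left_mono mult.assoc)
  qed
qed

end

section \<open>Morrey-Herz norms of extended nonnegative functions\<close>

lemma morrey_herz_norm_eq:
  assumes "\<And>x. 0 \<le> \<omega> x" "1 \<le> p" "1 \<le> q"
  shows "morrey_herz_norm \<omega> \<alpha> l p q f = mh_norm \<omega> \<alpha> l p q (\<lambda>x. ennreal (norm (f x)))"
proof -
  have "wLq_norm \<omega> q (\<lambda>x. indicator (dyadic_shell k) x * f x) = wLq \<omega> q (dyadic_shell k) (\<lambda>x. ennreal (norm (f x)))" for k
    unfolding wLq_norm_def wLq_def using assms
    by (intro arg_cong[where f="\<lambda>t. t epowr (1 / q)"] nn_integral_cong)
      (auto simp: ennreal_epowr_nonneg ennreal_mult split: split_indicator)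
  moreover have "wmeas \<omega> (dyadic_ball k) epowr (\<alpha> * p / real CARD('a)) = (wmeas \<omega> (dyadic_ball k) epowr (\<alpha> / real CARD('a))) epowr p" for k
    by (simp add: epowr_epowr)
  ultimately show ?thesis
    using assms by (simp add: morrey_herz_norm_def mh_norm_def mh_partial_def
        infsum_eq_nn_integral_count_space epowr_mult)
qed

lemma mh_norm_mono_AE:
  assumes "1 \<le> p" "1 \<le> q" "AE x in lebesgue. F x \<le> G x"
  shows "mh_norm \<omega> \<alpha> l p q F \<le> mh_norm \<omega> \<alpha> l p q G"
  unfolding mh_norm_def mh_partial_def using assms
  by (intro SUP_mono' mult_left_mono epowr_mono nn_integral_mono wLq_mono_AE) auto

lemma mh_norm_cong_AE:
  assumes "1 \<le> p" "1 \<le> q" "AE x in lebesgue. F x = G x"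
  shows "mh_norm \<omega> \<alpha> l p q F = mh_norm \<omega> \<alpha> l p q G"
  by (intro antisym mh_norm_mono_AE assms) (use assms(3) in auto)

text \<open>Stated for one cutoff k0: the supremum over k0 is taken only after y has been integrated
  out.\<close>

lemma mh_partial_Minkowski:
  fixes T :: "real^'n \<Rightarrow> real^'n \<Rightarrow> ennreal"
  assumes p: "1 \<le> p" and q: "1 \<le> q"
    and T [measurable]: "(\<lambda>(x, y). T x y) \<in> borel_measurable (lebesgue \<Otimes>\<^sub>M lebesgue)"
    and [measurable]: "\<omega> \<in> borel_measurable lebesgue"
  shows "mh_partial \<omega> \<alpha> p q (\<lambda>x. \<integral>\<^sup>+y. T x y \<partial>lebesgue) k0 \<le> (\<integral>\<^sup>+y. mh_partial \<omega> \<alpha> p q (\<lambda>x. T x y) k0 \<partial>lebesgue)"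
proof -
  interpret sigma_finite_measure "lebesgue :: (real^'n) measure" by (rule sigma_finite_lebesgue)
  let ?c = "\<lambda>k. wmeas \<omega> (dyadic_ball k) epowr (\<alpha> / real CARD('n))"
  have T' [measurable]: "(\<lambda>(y, x). T x y) \<in> borel_measurable (lebesgue \<Otimes>\<^sub>M lebesgue)"
    using measurable_pair_swap[OF T] by (simp add: split_beta')
  have N [measurable]: "(\<lambda>y. wLq \<omega> q (dyadic_shell k) (\<lambda>x. T x y)) \<in> borel_measurable lebesgue" for k
    unfolding wLq_def by measurable
  have "mh_partial \<omega> \<alpha> p q (\<lambda>x. \<integral>\<^sup>+y. T x y \<partial>lebesgue) k0
     \<le> (\<integral>\<^sup>+k. (\<integral>\<^sup>+y. ?c k * wLq \<omega> q (dyadic_shell k) (\<lambda>x. T x y) \<partial>lebesgue) epowr p \<partial>count_space {..k0}) epowr (1 / p)"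
    unfolding mh_partial_def
  proof (intro epowr_mono nn_integral_mono)
    fix k
    have "wLq \<omega> q (dyadic_shell k) (\<lambda>x. \<integral>\<^sup>+y. T x y \<partial>lebesgue) \<le> (\<integral>\<^sup>+y. wLq \<omega> q (dyadic_shell k) (\<lambda>x. T x y) \<partial>lebesgue)"
      by (rule wLq_Minkowski) (use q sigma_finite_lebesgue in auto)
    then show "?c k * wLq \<omega> q (dyadic_shell k) (\<lambda>x. \<integral>\<^sup>+y. T x y \<partial>lebesgue)
        \<le> (\<integral>\<^sup>+y. ?c k * wLq \<omega> q (dyadic_shell k) (\<lambda>x. T x y) \<partial>lebesgue)"
      by (simp add: nn_integral_cmult mult_left_mono)
  qed (use p in auto)
  also have "\<dots> \<le> (\<integral>\<^sup>+y. mh_partial \<omega> \<alpha> p q (\<lambda>x. T x y) k0 \<partial>lebesgue)"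
    unfolding mh_partial_def
  proof (rule nn_integral_Minkowski)
    show "(\<lambda>(k, y). ?c k * wLq \<omega> q (dyadic_shell k) (\<lambda>x. T x y)) \<in> borel_measurable (count_space {..k0} \<Otimes>\<^sub>M lebesgue)"
      by (rule measurable_pair_measure_countable1) auto
  qed (use p sigma_finite_lebesgue sigma_finite_count_space_countable_type in auto)
  finally show ?thesis .
qed

lemma mh_partial_cmult:
  assumes "1 \<le> p" "1 \<le> q" and [measurable]: "F \<in> borel_measurable lebesgue" "\<omega> \<in> borel_measurable lebesgue"
  shows "mh_partial \<omega> \<alpha> p q (\<lambda>x. c * F x) k0 = c * mh_partial \<omega> \<alpha> p q F k0"
proof -
  have "mh_partial \<omega> \<alpha> p q (\<lambda>x. c * F x) k0
    = (c epowr p * (\<integral>\<^sup>+k. (wmeas \<omega> (dyadic_ball k) epowr (\<alpha> / real CARD('a)) * wLq \<omega> q (dyadic_shell k) F) epowr p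
        \<partial>count_space {..k0})) epowr (1 / p)"
    unfolding mh_partial_def using assms
    by (subst nn_integral_cmult[symmetric]) (auto simp: wLq_cmult epowr_mult mult_ac)
  then show ?thesis
    using assms(1) by (simp add: mh_partial_def epowr_mult epowr_epowr)
qed

text \<open>K is bounded and has positive distance from 0, so only finitely many shells meet
  it.\<close>

lemma compact_subset_dyadic_shells:
  fixes K :: "(real^'n) set"
  assumes "compact K" "0 \<notin> K"
  obtains j k where "K \<subseteq> (\<Union>i\<in>{j..k}. dyadic_shell i)"
proof -
  obtain R where R: "0 < R" "\<And>x. x \<in> K \<Longrightarrow> norm x \<le> R"
    using compact_imp_bounded[OF assms(1)] bounded_pos by blast
  obtain \<epsilon> where \<epsilon>: "0 < \<epsilon>" "\<And>x. x \<in> K \<Longrightarrow> \<epsilon> \<le> norm x"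
    using separate_point_closed[OF compact_imp_closed[OF assms(1)] assms(2)] by auto
  obtain k :: int where k: "R \<le> 2 powr real_of_int k" using ex_dyadic[OF R(1)] .
  obtain j :: int where j: "2 powr (real_of_int j - 1) < \<epsilon>" using ex_dyadic[OF \<epsilon>(1)] .
  show ?thesis
  proof (rule that, rule subsetI)
    fix x assume x: "x \<in> K"
    then have "x \<noteq> 0" using assms(2) by auto
    then obtain i where i: "x \<in> dyadic_shell i" by (rule ex_dyadic_shell)
    have "x \<in> dyadic_ball k" using k R(2)[OF x] by (simp add: in_dyadic_ball_iff)
    then have "i \<le> k" using i dyadic_shell_le by blast
    moreover have "j \<le> i"
    proof -
      have "2 powr (real_of_int j - 1) < 2 powr real_of_int i"
      proof -
        have "norm x \<le> 2 powr real_of_int i"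
          using i by (simp add: dyadic_shell_def in_dyadic_ball_iff)
        with j \<epsilon>(2)[OF x] show ?thesis by linarith
      qed
      then have "real_of_int j - 1 < real_of_int i"
        by (subst (asm) powr_less_cancel_iff) auto
      then show ?thesis by linarith
    qed
    ultimately show "x \<in> (\<Union>i\<in>{j..k}. dyadic_shell i)" using i by auto
  qed
qed

context rh_weight
begin

text \<open>A single shell is one term of the partial sum, with a positive finite
  coefficient.\<close>

lemma wLq_finite:
  assumes p: "1 \<le> p" and fin: "mh_norm \<omega> \<alpha> l p q F < top"
  shows "wLq \<omega> q (dyadic_shell k) F < top"
proof -
  let ?h = "\<lambda>k. (w k epowr (\<alpha> / real CARD('n)) * wLq \<omega> q (dyadic_shell k) F) epowr p"
  have "mh_partial \<omega> \<alpha> p q F k < top"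
    using mh_partial_le_mh_norm[of \<alpha> p q F k l] fin
    by (auto simp: ennreal_mult_less_top intro: order.strict_trans1)
  then have "(\<integral>\<^sup>+k. ?h k \<partial>count_space {..k}) \<noteq> top"
    using p by (auto simp: mh_partial_def epowr_less_top_iff)
  moreover have "?h k = (\<integral>\<^sup>+j. ?h j * indicator {k} j \<partial>count_space {..k})"
    by (subst nn_integral_count_space'[of "{k}"]) auto
  moreover have "\<dots> \<le> (\<integral>\<^sup>+k. ?h k \<partial>count_space {..k})"
    by (rule nn_integral_mono) (auto split: split_indicator)
  ultimately have "?h k \<noteq> top" by (metis top_unique)
  then have "w k epowr (\<alpha> / real CARD('n)) * wLq \<omega> q (dyadic_shell k) F \<noteq> top"
    using p epowr_eq_top_iff[of p] by fastforce
  then show ?thesis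
    by (auto simp: w_epowr ennreal_mult_eq_top_iff less_top)
qed

text \<open>A finite norm on every shell makes F finite almost everywhere for the weighted measure,
  and positivity of \<omega> makes this Lebesgue almost everywhere. Applied to the y-integral of the
  absolute value, it shows that the operator is well defined.\<close>

lemma mh_norm_finite_imp_AE_finite:
  assumes p: "1 \<le> p" and q: "1 \<le> q" and fin: "mh_norm \<omega> \<alpha> l p q F < top"
    and [measurable]: "F \<in> borel_measurable lebesgue"
  shows "AE x in lebesgue. F x < top"
proof -
  have "AE x in lebesgue. F x epowr q * ennreal (\<omega> x) * indicator (dyadic_shell k) x \<noteq> \<infinity>" for k
  proof (rule nn_integral_PInf_AE)
    show "(\<integral>\<^sup>+x\<in>dyadic_shell k. F x epowr q * ennreal (\<omega> x) \<partial>lebesgue) \<noteq> \<infinity>"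
      using wLq_finite[OF p fin, of k] q by (auto simp: wLq_def epowr_less_top_iff)
  qed measurable
  then have "AE x in lebesgue. \<forall>k. F x epowr q * ennreal (\<omega> x) * indicator (dyadic_shell k) x \<noteq> \<infinity>"
    by (simp add: AE_all_countable)
  moreover have "AE x::real^'n in lebesgue. x \<noteq> 0"
    by (rule AE_lebesgue_neq_0)
  ultimately show ?thesis
    using AE_pos
  proof eventually_elim
    case (elim x)
    obtain k where "x \<in> dyadic_shell k" using ex_dyadic_shell[OF elim(2)] .
    with elim(1) have "F x epowr q * ennreal (\<omega> x) \<noteq> top"
      by (auto dest!: spec[of _ k])
    with elim(3) have "F x epowr q \<noteq> top"
      by (auto simp: ennreal_mult_eq_top_iff)
    then show ?case
      using q epowr_eq_top_iff[of q "F x"] by (simp flip: less_top)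
  qed
qed

text \<open>Finitely many shells cover a compact set away from 0, so the local integrability in the
  definition of the space follows from the norm.\<close>

lemma morrey_herzI:
  assumes p: "1 \<le> p" and q: "1 \<le> q" and fin: "morrey_herz_norm \<omega> \<alpha> l p q f < top"
    and f: "f \<in> borel_measurable lebesgue"
  shows "f \<in> morrey_herz \<omega> \<alpha> l p q"
proof -
  have "(\<integral>\<^sup>+x\<in>K. ennreal (norm (f x) powr q * \<omega> x) \<partial>lebesgue) < \<infinity>"
    if K: "compact K" "K \<subseteq> UNIV - {0}" for K :: "(real^'n) set"
  proof -
    have [measurable]: "(\<lambda>x. ennreal (norm (f x) powr q * \<omega> x)) \<in> borel_measurable lebesgue"
      using f by measurable
    obtain j k where jk: "K \<subseteq> (\<Union>i\<in>{j..k}. dyadic_shell i)"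
      using compact_subset_dyadic_shells[OF K(1)] K(2) by blast
    have shell: "(\<integral>\<^sup>+x\<in>dyadic_shell i. ennreal (norm (f x) powr q * \<omega> x) \<partial>lebesgue) < top" for i
    proof -
      have "(\<integral>\<^sup>+x\<in>dyadic_shell i. ennreal (norm (f x) powr q * \<omega> x) \<partial>lebesgue) epowr (1 / q)
          = wLq \<omega> q (dyadic_shell i) (\<lambda>x. ennreal (norm (f x)))"
        using q by (simp add: wLq_def ennreal_epowr_nonneg ennreal_mult nonneg)
      also have "\<dots> < top"
        using fin p q by (intro wLq_finite[of p \<alpha> l]) (auto simp: morrey_herz_norm_eq[OF nonneg])
      finally show ?thesis
        using q by (simp add: epowr_less_top_iff)
    qed
    have "(\<integral>\<^sup>+x\<in>K. ennreal (norm (f x) powr q * \<omega> x) \<partial>lebesgue)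
        \<le> (\<integral>\<^sup>+x. (\<Sum>i\<in>{j..k}. ennreal (norm (f x) powr q * \<omega> x) * indicator (dyadic_shell i) x) \<partial>lebesgue)"
    proof (rule nn_integral_mono)
      fix x
      show "ennreal (norm (f x) powr q * \<omega> x) * indicator K x
          \<le> (\<Sum>i\<in>{j..k}. ennreal (norm (f x) powr q * \<omega> x) * indicator (dyadic_shell i) x)"
      proof (cases "x \<in> K")
        case True
        then obtain i where i: "i \<in> {j..k}" "x \<in> dyadic_shell i" using jk by blast
        have "ennreal (norm (f x) powr q * \<omega> x) * indicator (dyadic_shell i) x
            \<le> (\<Sum>i\<in>{j..k}. ennreal (norm (f x) powr q * \<omega> x) * indicator (dyadic_shell i) x)"
          by (rule member_le_sum) (use i in auto)
        with True i show ?thesis by simp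
      qed simp
    qed
    also have "\<dots> = (\<Sum>i\<in>{j..k}. \<integral>\<^sup>+x\<in>dyadic_shell i. ennreal (norm (f x) powr q * \<omega> x) \<partial>lebesgue)"
      by (rule nn_integral_sum) measurable
    also have "\<dots> < top"
      using shell by (simp add: less_top)
    finally show ?thesis by simp
  qed
  then show ?thesis
    using fin f by (simp add: morrey_herz_def)
qed

end

section \<open>The Hausdorff operator\<close>

text \<open>Distributes the common factor c evenly over the Hoelder factors, so that each integral
  in \<open>hausdorff_const\<close> carries its own copy of the kernel.\<close>

lemma prod_epowr_inverse_card:
  assumes "finite I" "I \<noteq> {}"
  shows "(\<Prod>i\<in>I. (c * E i ^ card I) epowr (1 / real (card I))) = c * (\<Prod>i\<in>I. E i)"
proof -
  have m: "0 < card I" using assms by (simp add: card_gt_0_iff)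
  have "(c * E i ^ card I) epowr (1 / real (card I)) = c epowr (1 / real (card I)) * E i" for i
    using m epowr_power[of 1 "E i" "card I"] by (simp add: epowr_mult epowr_epowr)
  then have "(\<Prod>i\<in>I. (c * E i ^ card I) epowr (1 / real (card I))) = (c epowr (1 / real (card I))) ^ card I * (\<Prod>i\<in>I. E i)"
    by (simp add: prod.distrib)
  then show ?thesis
    using m by (simp add: epowr_power)
qed

text \<open>(x, y) \<mapsto> A i y *v x is shown to be measurable for the Borel sets of the target;
  composition with it is possible because the g i are Borel and not merely Lebesgue
  measurable.\<close>

lemma borel_measurable_hausdorff_integrand:
  fixes A :: "nat \<Rightarrow> real^'n \<Rightarrow> real^'n^'n"
  assumes [measurable]: "\<Phi> \<in> borel_measurable lebesgue"
    and A: "\<And>i. i \<in> {1..m} \<Longrightarrow> A i \<in> borel_measurable lebesgue"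
    and g: "\<And>i. i \<in> {1..m} \<Longrightarrow> g i \<in> borel_measurable borel"
  shows "(\<lambda>(x, y). hausdorff_integrand m \<Phi> A g x y) \<in> borel_measurable (lebesgue \<Otimes>\<^sub>M lebesgue)"
proof -
  note id [measurable] = borel_measurable_ident_lebesgue[where 'a="real^'n"]
  have [measurable]: "(\<lambda>z. g i (A i (snd z) *v fst z)) \<in> borel_measurable (lebesgue \<Otimes>\<^sub>M lebesgue)" if "i \<in> {1..m}" for i
  proof (rule measurable_compose[OF _ g[OF that]], rule borel_measurable_matrix_vector_mult2)
    show "(\<lambda>z. A i (snd z)) \<in> borel_measurable (lebesgue \<Otimes>\<^sub>M lebesgue)"
      by (rule measurable_compose[OF measurable_snd A[OF that]])
    show "fst \<in> borel_measurable ((lebesgue :: (real^'n) measure) \<Otimes>\<^sub>M (lebesgue :: (real^'n) measure))"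
      by (rule measurable_compose[OF measurable_fst id])
  qed
  have c: "(\<lambda>y :: real^'n. complex_of_real (norm y ^ CARD('n))) \<in> borel_measurable lebesgue"
    by (rule measurable_compose[OF id]) measurable
  have [measurable]: "(\<lambda>z. complex_of_real (norm (snd z) ^ CARD('n)))
      \<in> borel_measurable ((lebesgue :: (real^'n) measure) \<Otimes>\<^sub>M (lebesgue :: (real^'n) measure))"
    by (rule measurable_compose[OF measurable_snd c])
  show ?thesis
    unfolding hausdorff_integrand_def split_beta'
    by (intro borel_measurable_times borel_measurable_divide borel_measurable_prod) measurable
qed

context rh_weight
begin

text \<open>Absolute values go inside the y-integral, and the estimate of
  \<open>mh_partial_prod_linear\<close> for a single y is integrated. The m-th powers under the
  integrals come from Hoelder with all exponents equal to 1 / m.\<close>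

lemma hausdorff_mh_norm_bound:
  fixes A :: "nat \<Rightarrow> real^'n \<Rightarrow> real^'n^'n" and \<Phi> :: "real^'n \<Rightarrow> complex"
    and P Q \<alpha> l :: "nat \<Rightarrow> real" and p q qstar \<alpha>star \<theta> :: real
  defines "n \<equiv> real CARD('n)"
  assumes m: "1 \<le> m" and \<Phi> [measurable]: "\<Phi> \<in> borel_measurable lebesgue"
    and A: "\<And>i. i \<in> {1..m} \<Longrightarrow> A i \<in> borel_measurable lebesgue"
    and det: "AE y in lebesgue. \<Phi> y \<noteq> 0 \<longrightarrow> (\<forall>i\<in>{1..m}. det (A i y) \<noteq> 0)"
    and Q: "\<And>i. i \<in> {1..m} \<Longrightarrow> 1 \<le> Q i" "(\<Sum>i=1..m. 1 / Q i) = 1 / q"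
    and P: "\<And>i. i \<in> {1..m} \<Longrightarrow> 1 \<le> P i" "(\<Sum>i=1..m. 1 / P i) = 1 / p"
    and p: "1 \<le> p" and q: "0 < q" "1 \<le> qstar" "qstar * \<xi> / q \<le> 1 - 1 / s"
    and \<alpha>: "\<And>i. i \<in> {1..m} \<Longrightarrow> \<alpha> i < 0" and l: "\<And>i. i \<in> {1..m} \<Longrightarrow> 0 \<le> l i"
    and \<theta>: "0 < \<theta>" "\<theta> \<le> 1 - 1 / s"
    and star: "\<alpha>star / n + 1 / qstar = (\<Sum>i=1..m. \<alpha> i) / n + 1 / q"
  obtains C :: real where "0 \<le> C"
    "\<And>g. (\<And>i. i \<in> {1..m} \<Longrightarrow> g i \<in> borel_measurable borel) \<Longrightarrow>
      mh_norm \<omega> \<alpha>star (\<Sum>i=1..m. l i) p qstar (\<lambda>x. \<integral>\<^sup>+y. ennreal (norm (hausdorff_integrand m \<Phi> A g x y)) \<partial>lebesgue)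
        \<le> ennreal C *
          (\<Prod>i=1..m. (\<integral>\<^sup>+y. ennreal (norm (\<Phi> y) / norm y ^ CARD('n) *
              ((1 / \<bar>det (A i y)\<bar>) powr (\<xi> / Q i) * norm (A i y) powr (n * \<xi> / Q i)
                * dil_factor \<theta> (\<alpha> i / n + 1 / Q i) (l i) (norm (A i y))) ^ m) \<partial>lebesgue) epowr (1 / real m)) *
          (\<Prod>i=1..m. mh_norm \<omega> (\<alpha> i) (l i) (P i) (Q i) (\<lambda>x. ennreal (norm (g i x))))"
proof -
  define E where "E i y = (1 / \<bar>det (A i y)\<bar>) powr (\<xi> / Q i) * norm (A i y) powr (n * \<xi> / Q i)
                * dil_factor \<theta> (\<alpha> i / n + 1 / Q i) (l i) (norm (A i y))" for i y
  have E0: "0 \<le> E i y" for i y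
    by (simp add: E_def dil_factor_def)
  have E_meas [measurable]: "E i \<in> borel_measurable lebesgue" if "i \<in> {1..m}" for i
    using A[OF that] unfolding E_def dil_factor_def by measurable
  note id [measurable] = borel_measurable_ident_lebesgue[where 'a="real^'n"]
  define c where "c y = norm (\<Phi> y) / norm y ^ CARD('n)" for y
  have c0: "0 \<le> c y" for y by (simp add: c_def)
  have c_meas [measurable]: "c \<in> borel_measurable lebesgue"
    unfolding c_def by measurable
  have Psum: "(\<Sum>i\<in>{1..m}. 1 / P i) = 1 / p" and Qsum: "(\<Sum>i\<in>{1..m}. 1 / Q i) = 1 / q"
    using P(2) Q(2) by simp_all
  have q': "0 < qstar" using q by simp
  obtain C :: real where C: "0 \<le> C"
    "\<And>g B k0. (\<And>i. i \<in> {1..m} \<Longrightarrow> g i \<in> borel_measurable borel) \<Longrightarrow> (\<And>i. i \<in> {1..m} \<Longrightarrow> det (B i) \<noteq> 0) \<Longrightarrow>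
      w k0 epowr (- (\<Sum>i\<in>{1..m}. l i) / n) * mh_partial \<omega> \<alpha>star p qstar (\<lambda>x. \<Prod>i\<in>{1..m}. g i (B i *v x)) k0
        \<le> ennreal C * (\<Prod>i\<in>{1..m}. ennreal ((1 / \<bar>det (B i)\<bar>) powr (\<xi> / Q i) * norm (B i) powr (n * \<xi> / Q i)
             * dil_factor \<theta> (\<alpha> i / n + 1 / Q i) (l i) (norm (B i))) * mh_norm \<omega> (\<alpha> i) (l i) (P i) (Q i) (g i))"
    unfolding n_def
    by (rule mh_partial_prod_linear[OF finite_atLeastAtMost Q(1) Qsum P(1) Psum p q(1) q' q(3) \<alpha> l \<theta> star[unfolded n_def]]) blast+
  define L where "L = (\<Sum>i=1..m. l i)"
  show ?thesis
  proof (rule that[OF C(1)])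
    fix g :: "nat \<Rightarrow> real^'n \<Rightarrow> complex"
    assume g: "\<And>i. i \<in> {1..m} \<Longrightarrow> g i \<in> borel_measurable borel"
    let ?T = "\<lambda>x y. ennreal (norm (hausdorff_integrand m \<Phi> A g x y))"
    let ?M = "\<lambda>i. mh_norm \<omega> (\<alpha> i) (l i) (P i) (Q i) (\<lambda>x. ennreal (norm (g i x)))"
    let ?K = "\<Prod>i=1..m. (\<integral>\<^sup>+y. ennreal (c y * E i y ^ m) \<partial>lebesgue) epowr (1 / real m)"
    have T_eq: "?T x y = ennreal (c y) * (\<Prod>i=1..m. ennreal (norm (g i (A i y *v x))))" for x y
      unfolding hausdorff_integrand_def c_def
      by (simp add: norm_mult norm_divide norm_power prod_norm[symmetric] prod_ennreal prod_nonneg flip: ennreal_mult)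
    have T_meas: "(\<lambda>(x, y). ?T x y) \<in> borel_measurable (lebesgue \<Otimes>\<^sub>M lebesgue)"
      using borel_measurable_hausdorff_integrand[OF \<Phi> A g] by (simp add: split_beta')
    have "mh_partial \<omega> \<alpha>star p qstar (\<lambda>x. \<integral>\<^sup>+y. ?T x y \<partial>lebesgue) k0 \<le> ennreal (W k0 powr (L / n)) * (ennreal C * ?K * (\<Prod>i=1..m. ?M i))" for k0
    proof -
      have "mh_partial \<omega> \<alpha>star p qstar (\<lambda>x. \<integral>\<^sup>+y. ?T x y \<partial>lebesgue) k0
          \<le> (\<integral>\<^sup>+y. mh_partial \<omega> \<alpha>star p qstar (\<lambda>x. ?T x y) k0 \<partial>lebesgue)"
        by (rule mh_partial_Minkowski[OF p q(2) T_meas measurable_weight])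
      also have "\<dots> \<le> (\<integral>\<^sup>+y. (ennreal (W k0 powr (L / n)) * (ennreal C * (\<Prod>i=1..m. ?M i))) * (\<Prod>i=1..m. ennreal (c y * E i y ^ m) epowr (1 / real m)) \<partial>lebesgue)"
      proof (rule nn_integral_mono_AE)
        show "AE y in lebesgue. mh_partial \<omega> \<alpha>star p qstar (\<lambda>x. ?T x y) k0
          \<le> (ennreal (W k0 powr (L / n)) * (ennreal C * (\<Prod>i=1..m. ?M i))) * (\<Prod>i=1..m. ennreal (c y * E i y ^ m) epowr (1 / real m))"
          using det
        proof eventually_elim
          case (elim y)
          let ?F = "\<lambda>x. \<Prod>i=1..m. ennreal (norm (g i (A i y *v x)))"
          have F_meas: "?F \<in> borel_measurable lebesgue"
          proof (rule borel_measurable_prod_ennreal)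
            fix i assume "i \<in> {1..m}"
            then have [measurable]: "(\<lambda>x. g i (A i y *v x)) \<in> borel_measurable borel"
              by (intro measurable_compose[OF borel_measurable_matrix_vector_mult g])
            show "(\<lambda>x. ennreal (norm (g i (A i y *v x)))) \<in> borel_measurable lebesgue"
              by (rule measurable_completion) simp
          qed
          have eq: "mh_partial \<omega> \<alpha>star p qstar (\<lambda>x. ?T x y) k0 = ennreal (c y) * mh_partial \<omega> \<alpha>star p qstar ?F k0"
            unfolding T_eq by (rule mh_partial_cmult[OF p q(2) F_meas measurable_weight])
          have prod: "(\<Prod>i=1..m. ennreal (c y * E i y ^ m) epowr (1 / real m)) = ennreal (c y) * (\<Prod>i=1..m. ennreal (E i y))"
            using prod_epowr_inverse_card[of "{1..m}" "ennreal (c y)" "\<lambda>i. ennreal (E i y)"] m c0 E0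
            by (simp add: ennreal_mult ennreal_power)
          show ?case
          proof (cases "\<Phi> y = 0")
            case True
            then have "c y = 0" by (simp add: c_def)
            then show ?thesis unfolding eq by simp
          next
            case False
            have "w k0 epowr (- L / n) * mh_partial \<omega> \<alpha>star p qstar ?F k0
                \<le> ennreal C * (\<Prod>i=1..m. ennreal (E i y) * ?M i)"
              unfolding E_def L_def by (rule C(2)) (use elim False g in auto)
            then have "ennreal (W k0 powr (L / n)) * (w k0 epowr (- L / n) * mh_partial \<omega> \<alpha>star p qstar ?F k0)
                \<le> ennreal (W k0 powr (L / n)) * (ennreal C * (\<Prod>i=1..m. ennreal (E i y) * ?M i))"
              by (rule mult_left_mono) simp
            then have "mh_partial \<omega> \<alpha>star p qstar ?F k0 \<le> ennreal (W k0 powr (L / n)) * (ennreal C * (\<Prod>i=1..m. ennreal (E i y) * ?M i))"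
              by (simp add: w_epowr mult.assoc[symmetric] powr_add[symmetric] flip: ennreal_mult)
            then have "ennreal (c y) * mh_partial \<omega> \<alpha>star p qstar ?F k0
               \<le> ennreal (c y) * (ennreal (W k0 powr (L / n)) * (ennreal C * (\<Prod>i=1..m. ennreal (E i y) * ?M i)))"
              by (rule mult_left_mono) simp
            then show ?thesis
              unfolding eq prod by (simp add: prod.distrib mult_ac)
          qed
        qed
      qed
      also have "\<dots> = (ennreal (W k0 powr (L / n)) * (ennreal C * (\<Prod>i=1..m. ?M i))) * (\<integral>\<^sup>+y. (\<Prod>i=1..m. ennreal (c y * E i y ^ m) epowr (1 / real m)) \<partial>lebesgue)"
      proof (rule nn_integral_cmult, rule borel_measurable_prod_ennreal)
        fix i assume "i \<in> {1..m}"
        from E_meas[OF this] show "(\<lambda>y. ennreal (c y * E i y ^ m) epowr (1 / real m)) \<in> borel_measurable lebesgue"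
          by measurable
      qed
      also have "\<dots> \<le> (ennreal (W k0 powr (L / n)) * (ennreal C * (\<Prod>i=1..m. ?M i))) * ?K"
      proof (rule mult_left_mono, rule nn_integral_Hoelder)
        fix i assume "i \<in> {1..m}"
        from E_meas[OF this] show "(\<lambda>y. ennreal (c y * E i y ^ m)) \<in> borel_measurable lebesgue"
          by measurable
      qed (use m in auto)
      also have "\<dots> = ennreal (W k0 powr (L / n)) * (ennreal C * ?K * (\<Prod>i=1..m. ?M i))"
        by (simp only: mult_ac)
      finally show ?thesis .
    qed
    then have "w k0 epowr (- L / n) * mh_partial \<omega> \<alpha>star p qstar (\<lambda>x. \<integral>\<^sup>+y. ?T x y \<partial>lebesgue) k0
        \<le> w k0 epowr (- L / n) * (ennreal (W k0 powr (L / n)) * (ennreal C * ?K * (\<Prod>i=1..m. ?M i)))" for k0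
      by (rule mult_left_mono) simp
    moreover have "w k0 epowr (- L / n) * (ennreal (W k0 powr (L / n)) * z) = z" for k0 z
      by (simp add: w_epowr mult.assoc[symmetric] powr_add[symmetric] flip: ennreal_mult)
    ultimately show "mh_norm \<omega> \<alpha>star (\<Sum>i=1..m. l i) p qstar (\<lambda>x. \<integral>\<^sup>+y. ?T x y \<partial>lebesgue)
      \<le> ennreal C * (\<Prod>i=1..m. (\<integral>\<^sup>+y. ennreal (norm (\<Phi> y) / norm y ^ CARD('n) *
              ((1 / \<bar>det (A i y)\<bar>) powr (\<xi> / Q i) * norm (A i y) powr (n * \<xi> / Q i)
                * dil_factor \<theta> (\<alpha> i / n + 1 / Q i) (l i) (norm (A i y))) ^ m) \<partial>lebesgue) epowr (1 / real m)) * (\<Prod>i=1..m. ?M i)"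
      unfolding mh_norm_def L_def[symmetric] n_def[symmetric] c_def[symmetric] E_def[symmetric]
      by (intro SUP_least) simp
  qed
qed

end

text \<open>For almost every y with \<Phi> y \<noteq> 0, the set of x with A i y *v x in N i is null
  by nonsingularity; Fubini exchanges the two quantifiers. Where \<Phi> y = 0 both integrands
  vanish.\<close>

lemma AE_integrand_eq:
  fixes A :: "nat \<Rightarrow> real^'n \<Rightarrow> real^'n^'n" and \<Phi> :: "real^'n \<Rightarrow> complex"
  assumes \<Phi> [measurable]: "\<Phi> \<in> borel_measurable lebesgue"
    and A: "\<And>i. i \<in> {1..m} \<Longrightarrow> A i \<in> borel_measurable lebesgue"
    and det: "AE y in lebesgue. \<Phi> y \<noteq> 0 \<longrightarrow> (\<forall>i\<in>{1..m}. det (A i y) \<noteq> 0)"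
    and N: "\<And>i. i \<in> {1..m} \<Longrightarrow> N i \<in> null_sets lborel"
    and fg: "\<And>i x. i \<in> {1..m} \<Longrightarrow> x \<notin> N i \<Longrightarrow> f i x = g i x"
  shows "AE x in lebesgue. AE y in lebesgue. hausdorff_integrand m \<Phi> A f x y = hausdorff_integrand m \<Phi> A g x y"
proof -
  interpret pair_sigma_finite "lebesgue :: (real^'n) measure" "lebesgue :: (real^'n) measure"
    by (simp add: pair_sigma_finite_def sigma_finite_lebesgue)
  note id = borel_measurable_ident_lebesgue[where 'a="real^'n"]
  have Av [measurable]: "(\<lambda>z. A i (snd z) *v fst z) \<in> borel_measurable (lebesgue \<Otimes>\<^sub>M lebesgue)" if "i \<in> {1..m}" for i
  proof (rule borel_measurable_matrix_vector_mult2)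
    show "(\<lambda>z. A i (snd z)) \<in> borel_measurable (lebesgue \<Otimes>\<^sub>M lebesgue)"
      by (rule measurable_compose[OF measurable_snd A[OF that]])
    show "fst \<in> borel_measurable ((lebesgue :: (real^'n) measure) \<Otimes>\<^sub>M (lebesgue :: (real^'n) measure))"
      by (rule measurable_compose[OF measurable_fst id])
  qed
  have [measurable]: "N i \<in> sets borel" if "i \<in> {1..m}" for i
    using N[OF that] by auto
  have *: "AE x in lebesgue. AE y in lebesgue. \<Phi> y \<noteq> 0 \<longrightarrow> A i y *v x \<notin> N i" if i: "i \<in> {1..m}" for i
  proof (subst AE_commute)
    have [measurable]: "N i \<in> sets borel" using N[OF i] by auto
    note Av[OF i, measurable]
    show "{z \<in> space (lebesgue \<Otimes>\<^sub>M lebesgue). \<Phi> (snd z) \<noteq> 0 \<longrightarrow> A i (snd z) *v fst z \<notin> N i} \<in> sets (lebesgue \<Otimes>\<^sub>M lebesgue)"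
      by measurable
    show "AE y in lebesgue. AE x in lebesgue. \<Phi> y \<noteq> 0 \<longrightarrow> A i y *v x \<notin> N i"
      using det
    proof eventually_elim
      case (elim y)
      then show ?case
        using AE_nonsingular_linear[of "A i y" "N i"] N[OF i] i by (cases "\<Phi> y = 0") auto
    qed
  qed
  then have "AE x in lebesgue. \<forall>i\<in>{1..m}. AE y in lebesgue. \<Phi> y \<noteq> 0 \<longrightarrow> A i y *v x \<notin> N i"
    by (subst AE_ball_countable) auto
  then show ?thesis
  proof eventually_elim
    case (elim x)
    then have "AE y in lebesgue. \<forall>i\<in>{1..m}. \<Phi> y \<noteq> 0 \<longrightarrow> A i y *v x \<notin> N i"
      by (subst AE_ball_countable) auto
    then show ?case
    proof eventually_elim
      case (elim y)
      show ?case
      proof (cases "\<Phi> y = 0")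
        case False
        then have "(\<Prod>i=1..m. f i (A i y *v x)) = (\<Prod>i=1..m. g i (A i y *v x))"
          using elim by (intro prod.cong) (auto simp: fg)
        then show ?thesis by (simp add: hausdorff_integrand_def)
      qed (simp add: hausdorff_integrand_def)
    qed
  qed
qed

lemma powr_power_pos: "0 < x \<Longrightarrow> (x powr a) ^ m = x powr (real m * a)"
  by (simp add: powr_realpow[symmetric] powr_powr mult.commute)

text \<open>Matches the integrand of \<open>hausdorff_const\<close> with the m-th power that the
  norm bound produces.\<close>

lemma power_dilation_factor:
  fixes B :: "real^'n^'n"
  assumes "det B \<noteq> 0" "\<psi> = d ^ m"
  shows "\<bar>det (matrix_inv B)\<bar> powr (real m * \<xi> / q) * norm B powr (real m * \<xi> * n / q) * \<psi>
    = ((1 / \<bar>det B\<bar>) powr (\<xi> / q) * norm B powr (n * \<xi> / q) * d) ^ m"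
proof -
  have "invertible B" using assms(1) by (simp add: invertible_det_nz)
  then have "\<bar>det (matrix_inv B)\<bar> = 1 / \<bar>det B\<bar>" by (simp add: det_matrix_inv)
  moreover have "B \<noteq> 0" using assms(1) det_zero_matrix by metis
  ultimately show ?thesis
    using assms by (simp add: power_mult_distrib powr_power_pos mult_ac)
qed

theorem theorem3p9:
  fixes m :: nat
    and \<Phi> :: "real^'n \<Rightarrow> complex"
    and A :: "nat \<Rightarrow> real^'n \<Rightarrow> real^'n^'n"
    and \<omega> :: "real^'n \<Rightarrow> real"
    and p q qstar \<xi> \<delta> r\<omega> r\<omega>' \<alpha>star lstar :: real
    and ps qs \<alpha>s ls :: "nat \<Rightarrow> real"
  assumes "1 \<le> m"
    and "locally_integrable \<Phi>"
    and "\<forall>i\<in>{1..m}. A i \<in> borel_measurable lebesgue"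
    and "\<forall>i\<in>{1..m}. AE y\<in>support_on UNIV \<Phi> in lebesgue. det (A i y) \<noteq> 0"
    and "1 \<le> p" and "1 \<le> q"
    and "\<forall>i\<in>{1..m}. 1 \<le> ps i \<and> 1 \<le> qs i"
    and "(\<Sum>i=1..m. 1 / ps i) = 1 / p"
    and "(\<Sum>i=1..m. 1 / qs i) = 1 / q"
    and "1 \<le> qstar" and "1 \<le> \<xi>"
    and "\<forall>i\<in>{1..m}. \<alpha>s i < 0 \<and> 0 \<le> ls i"
    and "\<omega> \<in> muckenhoupt \<xi>"
    and "rh_index \<omega> = ereal r\<omega>"
    and "1 / r\<omega> + 1 / r\<omega>' = 1"
    and "q > qstar * \<xi> * r\<omega>'"
    and "1 < \<delta>" and "\<delta> < r\<omega>"
    and "lstar = (\<Sum>i=1..m. ls i)"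
    and "\<alpha>star / real CARD('n) + 1 / qstar = (\<Sum>i=1..m. \<alpha>s i) / real CARD('n) + 1 / q"
    and "(\<forall>i\<in>{1..m}. \<alpha>s i / real CARD('n) + 1 / qs i \<le> 0) \<and>
         hausdorff_const m \<Phi> A \<xi> qs (\<lambda>i. Psi1 m \<xi> \<delta> (\<alpha>s i) (ls i) (qs i) (A i)) < \<infinity>
       \<or> (\<forall>i\<in>{1..m}. \<alpha>s i / real CARD('n) + 1 / qs i > 0) \<and>
         hausdorff_const m \<Phi> A \<xi> qs (\<lambda>i. Psi2 m \<xi> \<delta> (\<alpha>s i) (ls i) (qs i) (A i)) < \<infinity>"
  shows "\<exists>C::real. 0 \<le> C \<and>
    (\<forall>f. (\<forall>i\<in>{1..m}. f i \<in> morrey_herz \<omega> (\<alpha>s i) (ls i) (ps i) (qs i)) \<longrightarrow>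
      (AE x in lebesgue. integrable lebesgue (hausdorff_integrand m \<Phi> A f x)) \<and>
      hausdorff_op m \<Phi> A f \<in> morrey_herz \<omega> \<alpha>star lstar p qstar \<and>
      morrey_herz_norm \<omega> \<alpha>star lstar p qstar (hausdorff_op m \<Phi> A f)
        \<le> ennreal C * (\<Prod>i=1..m. morrey_herz_norm \<omega> (\<alpha>s i) (ls i) (ps i) (qs i) (f i)))"
proof -
  define n where "n = real CARD('n)"
  define \<theta> where "\<theta> = (\<delta> - 1) / \<delta>"
  \<comment> \<open>The hypothesis on q amounts to 1 / r\<omega> < t, which leaves room for a
    reverse Hoelder index s with 1 / s < t.\<close>
  define t where "t = 1 - qstar * \<xi> / q"
  note m = assms(1)
  have q: "0 < q" "1 \<le> q" and qstar: "1 \<le> qstar" and \<xi>: "1 \<le> \<xi>" and p: "1 \<le> p"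
    using assms by auto
  have \<Phi>: "\<Phi> \<in> borel_measurable lebesgue"
    using assms(2) by (rule locally_integrable_imp_measurable)
  have A: "A i \<in> borel_measurable lebesgue" if "i \<in> {1..m}" for i
    using assms(3) that by blast
  have det: "AE y in lebesgue. \<Phi> y \<noteq> 0 \<longrightarrow> (\<forall>i\<in>{1..m}. det (A i y) \<noteq> 0)"
  proof -
    \<comment> \<open>\<open>support_on\<close> is the set where \<Phi> is nonzero, without
      closure.\<close>
    have "AE y in lebesgue. \<forall>i\<in>{1..m}. y \<in> support_on UNIV \<Phi> \<longrightarrow> det (A i y) \<noteq> 0"
      using assms(4) by (subst AE_ball_countable) auto
    then show ?thesis by eventually_elim (simp add: support_on_def)
  qed
  have r\<omega>: "1 < r\<omega>" using assms by linarith
  have "1 / r\<omega> < 1" using r\<omega> by simp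
  then have "0 < 1 / r\<omega>'"
    using assms(15) by linarith
  have "0 < r\<omega>'" using \<open>0 < 1 / r\<omega>'\<close> by simp
  have "qstar * \<xi> / q < 1 / r\<omega>'"
    using assms(16) q(1) \<open>0 < r\<omega>'\<close> by (simp add: field_simps)
  then have "1 / r\<omega> < t" using assms(15) unfolding t_def by linarith
  moreover have "0 < 1 / r\<omega>" using r\<omega> by simp
  ultimately have t: "0 < t" by linarith
  with \<open>1 / r\<omega> < t\<close> have t': "1 / t < r\<omega>"
    using r\<omega> by (simp add: field_simps)
  \<comment> \<open>A single s above both bounds is wanted: s > \<delta> gives \<theta> \<le> 1 -
    1/s, and s > 1/t gives qstar \<xi> / q \<le> 1 - 1/s.\<close>
  have "ereal (max \<delta> (1 / t)) < rh_index \<omega>"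
    using t' assms(14,18) by simp
  then obtain s where s_bounds: "1 < s" "\<omega> \<in> reverse_hoelder s" "\<delta> < s" "1 / t < s"
    unfolding rh_index_def less_Sup_iff by auto
  \<comment> \<open>A weight that vanishes almost everywhere satisfies every reverse Hoelder
    inequality, so its critical index would be infinite.\<close>
  have "\<not> (AE x in lebesgue. \<omega> x = 0)"
  proof
    assume zero: "AE x in lebesgue. \<omega> x = 0"
    have weight: "weight \<omega>" using s_bounds by (simp add: reverse_hoelder_def)
    have "\<omega> \<in> reverse_hoelder r" if "1 < r" for r
    proof -
      have "average (ball z u) (\<lambda>x. ennreal (\<omega> x) epowr r) = 0" for z u
      proof -
        have "(\<integral>\<^sup>+x\<in>ball z u. ennreal (\<omega> x) epowr r \<partial>lebesgue) = (\<integral>\<^sup>+x. 0 \<partial>(lebesgue :: (real^'n) measure))"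
        proof (rule nn_integral_cong_AE)
          show "AE x in lebesgue. ennreal (\<omega> x) epowr r * indicator (ball z u) x = 0"
            using zero by eventually_elim (use that in \<open>simp add: zero_epowr\<close>)
        qed
        then show ?thesis by (simp add: average_def)
      qed
      then show ?thesis
        using weight that by (auto simp: reverse_hoelder_def zero_epowr intro!: exI[of _ 1])
    qed
    then have "ereal (r\<omega> + 1) \<le> rh_index \<omega>"
      unfolding rh_index_def using r\<omega> by (intro Sup_upper) auto
    then show False using assms(14) by simp
  qed
  then interpret rh_weight \<omega> \<xi> s
    using assms(13) \<xi> s_bounds by unfold_locales auto
  have \<theta>: "0 < \<theta>" "\<theta> \<le> 1 - 1 / s"
  proof -
    have "\<theta> = 1 - 1 / \<delta>" using assms(17) by (simp add: \<theta>_def field_simps)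
    moreover have "1 / s \<le> 1 / \<delta>" using s_bounds assms(17) by (intro divide_left_mono) auto
    ultimately show "0 < \<theta>" "\<theta> \<le> 1 - 1 / s" using assms(17) by auto
  qed
  have qs_bound: "qstar * \<xi> / q \<le> 1 - 1 / s"
  proof -
    have "1 / s < t" using s_bounds t by (simp add: field_simps)
    then show ?thesis by (simp add: t_def)
  qed
  define \<gamma> where "\<gamma> i = \<alpha>s i / n + 1 / qs i" for i
  \<comment> \<open>From here cases (a) and (b) are treated together: \<open>dil_factor\<close>
    selects its exponents by the sign of \<gamma> i, and its m-th power is \<open>Psi1\<close> or
    \<open>Psi2\<close> accordingly.\<close>
  obtain \<Psi> where \<Psi>: "hausdorff_const m \<Phi> A \<xi> qs \<Psi> < \<infinity>"
      "\<And>i y. i \<in> {1..m} \<Longrightarrow> 0 < norm (A i y) \<Longrightarrow> \<Psi> i y = dil_factor \<theta> (\<gamma> i) (ls i) (norm (A i y)) ^ m"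
  proof -
    have \<theta>': "(\<delta> - 1) / \<delta> = \<theta>" by (simp add: \<theta>_def)
    have n_card: "real CARD('n) = n" by (simp add: n_def)
    from assms(21) show ?thesis
    proof (elim disjE conjE)
      assume neg: "\<forall>i\<in>{1..m}. \<alpha>s i / real CARD('n) + 1 / qs i \<le> 0"
        and fin: "hausdorff_const m \<Phi> A \<xi> qs (\<lambda>i. Psi1 m \<xi> \<delta> (\<alpha>s i) (ls i) (qs i) (A i)) < \<infinity>"
      show ?thesis
      proof (rule that[OF fin])
        fix i y assume i: "i \<in> {1..m}" and y: "0 < norm (A i y)"
        have \<gamma>: "\<gamma> i \<le> 0" using neg i by (simp add: \<gamma>_def n_def)
        show "Psi1 m \<xi> \<delta> (\<alpha>s i) (ls i) (qs i) (A i) y = dil_factor \<theta> (\<gamma> i) (ls i) (norm (A i y)) ^ m"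
          unfolding Psi1_def dil_factor_def Let_def \<theta>' n_card \<gamma>_def[symmetric] powr_add[symmetric] powr_power_pos[OF y]
          using \<gamma> by (cases "norm (A i y) < 1") (simp_all add: algebra_simps)
      qed
    next
      assume pos: "\<forall>i\<in>{1..m}. 0 < \<alpha>s i / real CARD('n) + 1 / qs i"
        and fin: "hausdorff_const m \<Phi> A \<xi> qs (\<lambda>i. Psi2 m \<xi> \<delta> (\<alpha>s i) (ls i) (qs i) (A i)) < \<infinity>"
      show ?thesis
      proof (rule that[OF fin])
        fix i y assume i: "i \<in> {1..m}" and y: "0 < norm (A i y)"
        have \<gamma>: "0 < \<gamma> i" using pos i by (simp add: \<gamma>_def n_def)
        show "Psi2 m \<xi> \<delta> (\<alpha>s i) (ls i) (qs i) (A i) y = dil_factor \<theta> (\<gamma> i) (ls i) (norm (A i y)) ^ m"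
          unfolding Psi2_def dil_factor_def Let_def \<theta>' n_card \<gamma>_def[symmetric] powr_add[symmetric] powr_power_pos[OF y]
          using \<gamma> by (cases "norm (A i y) < 1") (simp_all add: algebra_simps)
      qed
    qed
  qed
  obtain C :: real where C: "0 \<le> C"
    "\<And>g. (\<And>i. i \<in> {1..m} \<Longrightarrow> g i \<in> borel_measurable borel) \<Longrightarrow>
      mh_norm \<omega> \<alpha>star (\<Sum>i=1..m. ls i) p qstar (\<lambda>x. \<integral>\<^sup>+y. ennreal (norm (hausdorff_integrand m \<Phi> A g x y)) \<partial>lebesgue)
        \<le> ennreal C *
          (\<Prod>i=1..m. (\<integral>\<^sup>+y. ennreal (norm (\<Phi> y) / norm y ^ CARD('n) *
              ((1 / \<bar>det (A i y)\<bar>) powr (\<xi> / qs i) * norm (A i y) powr (real CARD('n) * \<xi> / qs i)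
                * dil_factor \<theta> (\<alpha>s i / real CARD('n) + 1 / qs i) (ls i) (norm (A i y))) ^ m) \<partial>lebesgue) epowr (1 / real m)) *
          (\<Prod>i=1..m. mh_norm \<omega> (\<alpha>s i) (ls i) (ps i) (qs i) (\<lambda>x. ennreal (norm (g i x))))"
  proof (rule hausdorff_mh_norm_bound[where \<Phi>=\<Phi> and A=A and P=ps and Q=qs and \<alpha>=\<alpha>s and l=ls and p=p and q=q
        and qstar=qstar and \<alpha>star=\<alpha>star and \<theta>=\<theta> and m=m])
    show "(\<Sum>i=1..m. 1 / qs i) = 1 / q" "(\<Sum>i=1..m. 1 / ps i) = 1 / p" by fact+
  qed (use m \<Phi> A det assms(7,12,20) p q qstar qs_bound \<theta> in auto)
  \<comment> \<open>The integrands agree wherever \<Phi> vanishes or all the matrices are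
    nonsingular, that is, almost everywhere.\<close>
  have const: "(\<Prod>i=1..m. (\<integral>\<^sup>+y. ennreal (norm (\<Phi> y) / norm y ^ CARD('n) *
              ((1 / \<bar>det (A i y)\<bar>) powr (\<xi> / qs i) * norm (A i y) powr (real CARD('n) * \<xi> / qs i)
                * dil_factor \<theta> (\<alpha>s i / real CARD('n) + 1 / qs i) (ls i) (norm (A i y))) ^ m) \<partial>lebesgue) epowr (1 / real m))
      = hausdorff_const m \<Phi> A \<xi> qs \<Psi>"
    unfolding hausdorff_const_def
  proof (intro prod.cong refl arg_cong[where f="\<lambda>t. t epowr (1 / real m)"] nn_integral_cong_AE)
    fix i assume i: "i \<in> {1..m}"
    show "AE y in lebesgue. ennreal (norm (\<Phi> y) / norm y ^ CARD('n) *
              ((1 / \<bar>det (A i y)\<bar>) powr (\<xi> / qs i) * norm (A i y) powr (real CARD('n) * \<xi> / qs i)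
                * dil_factor \<theta> (\<alpha>s i / real CARD('n) + 1 / qs i) (ls i) (norm (A i y))) ^ m)
       = ennreal (norm (\<Phi> y) / norm y ^ CARD('n) * \<bar>det (matrix_inv (A i y))\<bar> powr (real m * \<xi> / qs i)
          * norm (A i y) powr (real m * \<xi> * real CARD('n) / qs i) * \<Psi> i y)"
      using det
    proof eventually_elim
      case (elim y)
      show ?case
      proof (cases "\<Phi> y = 0")
        case False
        with elim i have d: "det (A i y) \<noteq> 0" by blast
        then have "A i y \<noteq> 0" using det_zero_matrix by metis
        then have "\<Psi> i y = dil_factor \<theta> (\<alpha>s i / real CARD('n) + 1 / qs i) (ls i) (norm (A i y)) ^ m"
          using \<Psi>(2)[OF i, of y] by (simp add: \<gamma>_def n_def)
        from power_dilation_factor[OF d this, of \<xi> "qs i" "real CARD('n)"]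
        show ?thesis by (simp add: mult.assoc)
      qed simp
    qed
  qed
  define K where "K = enn2real (hausdorff_const m \<Phi> A \<xi> qs \<Psi>)"
  have K: "hausdorff_const m \<Phi> A \<xi> qs \<Psi> = ennreal K" "0 \<le> K"
    using \<Psi>(1) by (auto simp: K_def less_top)
  show ?thesis
  proof (intro exI[of _ "C * K"] conjI allI impI)
    show "0 \<le> C * K" using C(1) K(2) by simp
    fix f assume f: "\<forall>i\<in>{1..m}. f i \<in> morrey_herz \<omega> (\<alpha>s i) (ls i) (ps i) (qs i)"
    \<comment> \<open>Function and null set are taken as a pair, so that one choice over i yields
      both.\<close>
    have "\<forall>i\<in>{1..m}. \<exists>gN. fst gN \<in> borel_measurable borel \<and> snd gN \<in> null_sets lborel \<and> (\<forall>x. x \<notin> snd gN \<longrightarrow> f i x = fst gN x)"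
    proof
      fix i assume "i \<in> {1..m}"
      then have "f i \<in> borel_measurable lebesgue" using f by (simp add: morrey_herz_def)
      then obtain g N where "g \<in> borel_measurable borel" "N \<in> null_sets lborel" "\<And>x. x \<notin> N \<Longrightarrow> f i x = g x"
        using ex_borel_modification by blast
      then show "\<exists>gN. fst gN \<in> borel_measurable borel \<and> snd gN \<in> null_sets lborel \<and> (\<forall>x. x \<notin> snd gN \<longrightarrow> f i x = fst gN x)"
        by (intro exI[of _ "(g, N)"]) auto
    qed
    from bchoice[OF this] obtain gN where gN:
      "\<forall>i\<in>{1..m}. fst (gN i) \<in> borel_measurable borel \<and> snd (gN i) \<in> null_sets lborel \<and> (\<forall>x. x \<notin> snd (gN i) \<longrightarrow> f i x = fst (gN i) x)" ..
    define g where "g i = fst (gN i)" for i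
    define N where "N i = snd (gN i)" for i
    have g: "g i \<in> borel_measurable borel" and N: "N i \<in> null_sets lborel" and fg: "x \<notin> N i \<Longrightarrow> f i x = g i x"
      if "i \<in> {1..m}" for i x
      using gN that by (auto simp: g_def N_def)
    let ?M = "\<lambda>i. morrey_herz_norm \<omega> (\<alpha>s i) (ls i) (ps i) (qs i) (f i)"
    let ?G = "\<lambda>x. \<integral>\<^sup>+y. ennreal (norm (hausdorff_integrand m \<Phi> A g x y)) \<partial>lebesgue"
    have M: "mh_norm \<omega> (\<alpha>s i) (ls i) (ps i) (qs i) (\<lambda>x. ennreal (norm (g i x))) = ?M i" if i: "i \<in> {1..m}" for i
    proof -
      have pq: "1 \<le> ps i" "1 \<le> qs i" using assms(7) i by auto
      have "AE x in lebesgue. x \<notin> N i"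
        using AE_not_in[OF N[OF i]] by (rule AE_completion)
      then have "AE x in lebesgue. ennreal (norm (g i x)) = ennreal (norm (f i x))"
        by eventually_elim (use fg[OF i] in simp)
      then show ?thesis
        using pq by (subst morrey_herz_norm_eq[OF nonneg]) (auto intro: mh_norm_cong_AE)
    qed
    have Mfin: "(\<Prod>i=1..m. ?M i) < top"
      using f by (auto simp: less_top[symmetric] ennreal_prod_eq_top morrey_herz_def)
    have bound: "mh_norm \<omega> \<alpha>star lstar p qstar ?G \<le> ennreal (C * K) * (\<Prod>i=1..m. ?M i)"
    proof -
      have "(\<Prod>i=1..m. mh_norm \<omega> (\<alpha>s i) (ls i) (ps i) (qs i) (\<lambda>x. ennreal (norm (g i x)))) = (\<Prod>i=1..m. ?M i)"
        by (rule prod.cong[OF refl M])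
      moreover have "hausdorff_const m \<Phi> A \<xi> qs \<Psi> = ennreal K" "ennreal (C * K) = ennreal C * ennreal K"
        using K C(1) by (simp_all add: ennreal_mult)
      ultimately show ?thesis
        using C(2)[of g, OF g] unfolding const assms(19) by (simp only:)
    qed
    then have Gfin: "mh_norm \<omega> \<alpha>star lstar p qstar ?G < top"
      using Mfin by (auto intro: order.strict_trans1 simp: ennreal_mult_less_top)
    have gmeas: "(\<lambda>(x, y). hausdorff_integrand m \<Phi> A g x y) \<in> borel_measurable (lebesgue \<Otimes>\<^sub>M lebesgue)"
      by (rule borel_measurable_hausdorff_integrand[OF \<Phi> A g])
    have gmeas_y: "hausdorff_integrand m \<Phi> A g x \<in> borel_measurable lebesgue" for x
      using measurable_compose[OF measurable_Pair1' gmeas, of x] by simp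
    interpret L: sigma_finite_measure "lebesgue :: (real^'n) measure" by (rule sigma_finite_lebesgue)
    have Gmeas: "?G \<in> borel_measurable lebesgue"
      using gmeas by measurable
    have Gx: "AE x in lebesgue. ?G x < top"
      by (rule mh_norm_finite_imp_AE_finite[OF p qstar Gfin Gmeas])
    have eq: "AE x in lebesgue. AE y in lebesgue. hausdorff_integrand m \<Phi> A f x y = hausdorff_integrand m \<Phi> A g x y"
      by (rule AE_integrand_eq[OF \<Phi> A det N fg])
    \<comment> \<open>Joint measurability is available for g; for almost every x the section for f
      inherits measurability by completeness.\<close>
    have fmeas: "AE x in lebesgue. hausdorff_integrand m \<Phi> A f x \<in> borel_measurable lebesgue"
      using eq
    proof eventually_elim
      case (elim x)
      then have "AE y in lebesgue. hausdorff_integrand m \<Phi> A g x y = hausdorff_integrand m \<Phi> A f x y"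
        by eventually_elim simp
      then show ?case
        by (rule borel_measurable_lebesgue_AE_cong[OF gmeas_y])
    qed
    have op_eq: "AE x in lebesgue. hausdorff_op m \<Phi> A g x = hausdorff_op m \<Phi> A f x"
      using eq fmeas
    proof eventually_elim
      case (elim x)
      have "AE y in lebesgue. hausdorff_integrand m \<Phi> A g x y = hausdorff_integrand m \<Phi> A f x y"
        using elim(1) by eventually_elim simp
      then show ?case
        unfolding hausdorff_op_def by (rule integral_cong_AE[OF gmeas_y elim(2)])
    qed
    show "AE x in lebesgue. integrable lebesgue (hausdorff_integrand m \<Phi> A f x)"
      using eq fmeas Gx
    proof eventually_elim
      case (elim x)
      have "(\<integral>\<^sup>+y. ennreal (norm (hausdorff_integrand m \<Phi> A f x y)) \<partial>lebesgue) = ?G x"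
        using elim(1) by (intro nn_integral_cong_AE; eventually_elim) simp
      then show ?case
        using elim by (intro integrableI_bounded) auto
    qed
    have op_meas: "hausdorff_op m \<Phi> A f \<in> borel_measurable lebesgue"
    proof (rule borel_measurable_lebesgue_AE_cong[OF _ op_eq])
      show "hausdorff_op m \<Phi> A g \<in> borel_measurable lebesgue"
        using L.borel_measurable_lebesgue_integral[OF gmeas] by (simp add: hausdorff_op_def[abs_def])
    qed
    have "AE x in lebesgue. ennreal (norm (hausdorff_op m \<Phi> A f x)) \<le> ?G x"
      using op_eq
    proof eventually_elim
      case (elim x)
      then show ?case
        using norm_integral_le_nn_integral[of lebesgue "hausdorff_integrand m \<Phi> A g x"]
        by (simp add: hausdorff_op_def)
    qed
    then have "mh_norm \<omega> \<alpha>star lstar p qstar (\<lambda>x. ennreal (norm (hausdorff_op m \<Phi> A f x))) \<le> mh_norm \<omega> \<alpha>star lstar p qstar ?G"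
      by (rule mh_norm_mono_AE[OF p qstar])
    then have le: "morrey_herz_norm \<omega> \<alpha>star lstar p qstar (hausdorff_op m \<Phi> A f) \<le> mh_norm \<omega> \<alpha>star lstar p qstar ?G"
      by (simp add: morrey_herz_norm_eq[OF nonneg p qstar])
    then show "hausdorff_op m \<Phi> A f \<in> morrey_herz \<omega> \<alpha>star lstar p qstar"
      using Gfin op_meas by (intro morrey_herzI[OF p qstar]) auto
    show "morrey_herz_norm \<omega> \<alpha>star lstar p qstar (hausdorff_op m \<Phi> A f) \<le> ennreal (C * K) * (\<Prod>i=1..m. ?M i)"
      by (rule order.trans[OF le bound])
  qed
qed

end
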